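(* Let $\lambda$ be a shifted pavable partition with 2-quotient $(\mu,\nu)$. Then $$\sum_{T}x^T = P_{\mu}\,P_{\nu},$$ where the sum runs over all shifted domino tableaux $T$ of shape $\lambda$ in which no domino on the diagonal $D_0$ is labelled by a primed letter.
   Context: Diagrams. A partition is a finite non-increasing sequence of positive integers; its length is its number of parts. The Young diagram of $\lambda=(\lambda_1,\dots,\lambda_\ell)$ is drawn in $\mathbb{R}^2$ with the first row at the bottom: it consists of the unit cells with lower-left corners $(x,y)$, $0\le y<\ell$, $0\le x<\lambda_{y+1}$. For an integer $k$, $D_k$ is the line of equation $Y=X+k$; the cell with lower-left corner $(x,y)$ is cut by the unique diagonal $D_{y-x}$. The part $\mathrm{up}(\lambda)$ consists of the cells cut by $D_k$ with $k>0$; the other cells form $\mathrm{down}(\lambda)$. 2-core and 2-quotient. A domino is a $1\times2$ or $2\times1$ rectangle of cells. The 2-core of $\lambda$ is obtained by successively removing from the diagram dominoes having no cell above them or to their right, until this is no longer possible (the result does not depend on the order). $\lambda$ is pavable if its 2-core is empty. The 2-quotient $(\mu,\nu)$ of $\lambda=(\lambda_1,\dots,\lambda_\ell)$ is defined as follows: let $L$ be the $\ell$-tuple with $L_i=\lambda_i+\ell-i$; let $M$ be obtained from $L$ by replacing, from right to left, the even entries successively by $0,2,4,\dots$ and the odd entries successively by $1,3,5,\dots$; then $\mu$ is the sequence of the values $(L_i-M_i)/2$ over the $i$ with $L_i$ even, and $\nu$ the sequence of these values over the $i$ with $L_i$ odd (zero parts are dropped). Pavings. A paving of a pavable partition $\lambda$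 is a tiling of its diagram by dominoes. Each domino is cut by exactly one diagonal of even index $D_{2k}$; it is said to be on $D_{2k}$. In a paving, $\mathrm{up}'(\lambda)$ is the set of dominoes on $D_{2k}$ with $k>0$, and $\mathrm{down}'(\lambda)$ is the set of the remaining dominoes. Shifted pavable partitions. A pavable partition $\lambda$ with 2-quotient $(\mu,\nu)$ is a shifted pavable partition if the last part of $\mu$ is at least the length of $\mu$ and the last part of $\nu$ is at least the length of $\nu$ (an empty partition being allowed), and it is considered only with pavings satisfying: there is no vertical domino $d$ on $D_0$ which has adjacent dominoes on its left, all of them belonging to $\mathrm{up}'(\lambda)$. Shifted domino tableaux. A shifted domino tableau of shape $\lambda$ is a paving of $\lambda$ satisfying this last condition, together with a filling of the dominoes of $\mathrm{up}'(\lambda)$ by the symbol $X$ and of the dominoes of $\mathrm{down}'(\lambda)$ by letters of the ordered alphabet $\{1'<1<2'<2<\cdots\}$ such that, disregarding the $X$'s: rows are non-decreasing from left to right and columns are non-decreasing from bottom to top; each unprimed letter appears in at most one domino of each column; each primed letter appears in at most one domino of each row. Two shifted domino tableaux of shape $\lambda$ whose labelled dominoes in $\mathrm{down}'(\lambda)$ coincide are regarded as equal (only the lower part matters). Shifted Young tableaux and P-Schur functions. For a partition $\mu$ whose last part is at least its length $\ell$ (or $\mu$ empty), a shifted Young tableau of shape $\mu$ is a filling of the cells of $\mathrm{up}(\mu)$ by $X$ and of the cells of $\mathrm{down}(\mu)$ by letters of $\{1'<1<2'<2<\cdots\}$ such that, disregarding the $X$'s: rows are non-decreasing from left to right and columns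 non-decreasing from bottom to top; each unprimed letter appears at most once in each column; each primed letter appears at most once in each row. (Deleting the $X$'s gives a usual shifted tableau on the shifted diagram of the strict partition $(\mu_1,\mu_2-1,\dots,\mu_\ell-\ell+1)$.) For a shifted Young tableau or shifted domino tableau $T$, put $x^T=x_1^{a_1}x_2^{a_2}\cdots$, where $a_i$ is the number of cells (respectively dominoes) of $T$ labelled $i$ or $i'$. Then $P_\mu=\sum_t x^t$, the sum being over all shifted Young tableaux $t$ of shape $\mu$ in which the cells on $D_0$ carry no primed letter; equivalently, $P_\mu$ is the usual P-Schur function of the strict partition $(\mu_1,\mu_2-1,\dots,\mu_\ell-\ell+1)$. *)

theory Defs
  imports "HOL-Library.Poly_Mapping"
begin

subsection \<open>Partitions and diagrams\<close>

definition is_partition :: "nat list \<Rightarrow> bool" where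
  "is_partition l \<longleftrightarrow> sorted_wrt (\<ge>) l \<and> (\<forall>p\<in>set l. 0 < p)"

text \<open>A cell is given by its lower-left corner; the first row (part) is at the bottom.\<close>

type_synonym cell = "nat \<times> nat"

definition diagram :: "nat list \<Rightarrow> cell set" where
  "diagram l = {(x, y). y < length l \<and> x < l ! y}"

text \<open>The index \<open>k\<close> of the unique diagonal \<open>Y = X + k\<close> that cuts a cell.\<close>

definition diag_index :: "cell \<Rightarrow> int" where
  "diag_index c = int (snd c) - int (fst c)"

definition up :: "nat list \<Rightarrow> cell set" where
  "up l = {c \<in> diagram l. 0 < diag_index c}"

definition down :: "nat list \<Rightarrow> cell set" where
  "down l = diagram l - up l"

subsection \<open>Dominoes, 2-core and 2-quotient\<close>

type_synonym domino = "cell set"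

definition horizontal :: "domino \<Rightarrow> bool" where
  "horizontal d \<longleftrightarrow> (\<exists>x y. d = {(x, y), (Suc x, y)})"

definition vertical :: "domino \<Rightarrow> bool" where
  "vertical d \<longleftrightarrow> (\<exists>x y. d = {(x, y), (x, Suc y)})"

definition is_domino :: "domino \<Rightarrow> bool" where
  "is_domino d \<longleftrightarrow> horizontal d \<or> vertical d"

definition removable :: "domino \<Rightarrow> cell set \<Rightarrow> bool" where
  "removable d A \<longleftrightarrow> is_domino d \<and> d \<subseteq> A \<and>
     (\<forall>(x, y)\<in>d. (x, Suc y) \<notin> A - d \<and> (Suc x, y) \<notin> A - d)"

definition removal_step :: "cell set \<Rightarrow> cell set \<Rightarrow> bool" where
  "removal_step A B \<longleftrightarrow> (\<exists>d. removable d A \<and> B = A - d)"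

definition is_two_core_diagram :: "nat list \<Rightarrow> cell set \<Rightarrow> bool" where
  "is_two_core_diagram l C \<longleftrightarrow> removal_step\<^sup>*\<^sup>* (diagram l) C \<and> (\<nexists>B. removal_step C B)"

definition pavable :: "nat list \<Rightarrow> bool" where
  "pavable l \<longleftrightarrow> is_two_core_diagram l {}"

text \<open>Positions are counted from 0, so the entry at position \<open>i\<close> is
  \<open>\<lambda>\<^sub>i\<^sub>+\<^sub>1 + \<ell> - (i + 1)\<close>.\<close>

definition L_entry :: "nat list \<Rightarrow> nat \<Rightarrow> nat" where
  "L_entry l i = l ! i + length l - Suc i"

text \<open>Reading from right to left, the entry at position \<open>i\<close> is replaced by the next unused number
  of its parity; the numbers of that parity already used are counted by the positions \<open>j > i\<close>.\<close>

definition M_entry :: "nat list \<Rightarrow> nat \<Rightarrow> nat" where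
  "M_entry l i =
     2 * card {j. i < j \<and> j < length l \<and> even (L_entry l j) = even (L_entry l i)}
       + (if even (L_entry l i) then 0 else 1)"

definition quotient_part :: "(nat \<Rightarrow> bool) \<Rightarrow> nat list \<Rightarrow> nat list" where
  "quotient_part Q l =
     filter (\<lambda>p. p \<noteq> 0)
       (map (\<lambda>i. (L_entry l i - M_entry l i) div 2)
         (filter (\<lambda>i. Q (L_entry l i)) [0..<length l]))"

definition two_quotient :: "nat list \<Rightarrow> nat list \<times> nat list" where
  "two_quotient l = (quotient_part even l, quotient_part odd l)"

subsection \<open>Pavings\<close>

definition is_paving :: "nat list \<Rightarrow> domino set \<Rightarrow> bool" where
  "is_paving l P \<longleftrightarrow>
     (\<forall>d\<in>P. is_domino d) \<and> (\<forall>d\<in>P. \<forall>e\<in>P. d \<noteq> e \<longrightarrow> d \<inter> e = {}) \<and> \<Union>P = diagram l"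

text \<open>\<open>on_diag d k\<close>: the domino \<open>d\<close> is on the diagonal \<open>D\<^sub>2\<^sub>k\<close>.\<close>

definition on_diag :: "domino \<Rightarrow> int \<Rightarrow> bool" where
  "on_diag d k \<longleftrightarrow> (\<exists>c\<in>d. diag_index c = 2 * k)"

definition up' :: "domino set \<Rightarrow> domino set" where
  "up' P = {d \<in> P. \<exists>k>0. on_diag d k}"

definition down' :: "domino set \<Rightarrow> domino set" where
  "down' P = P - up' P"

text \<open>Adjacent means sharing (part of) an edge.\<close>

definition left_adjacent :: "domino set \<Rightarrow> domino \<Rightarrow> domino set" where
  "left_adjacent P d = {e \<in> P. e \<noteq> d \<and> (\<exists>x y. (x, y) \<in> e \<and> (Suc x, y) \<in> d)}"

definition is_shifted_paving :: "nat list \<Rightarrow> domino set \<Rightarrow> bool" where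
  "is_shifted_paving l P \<longleftrightarrow> is_paving l P \<and>
     \<not> (\<exists>d\<in>P. vertical d \<and> on_diag d 0 \<and> left_adjacent P d \<noteq> {} \<and> left_adjacent P d \<subseteq> up' P)"

definition last_part_fits :: "nat list \<Rightarrow> bool" where
  "last_part_fits m \<longleftrightarrow> m = [] \<or> length m \<le> last m"

definition shifted_pavable :: "nat list \<Rightarrow> bool" where
  "shifted_pavable l \<longleftrightarrow> is_partition l \<and> pavable l \<and>
     (case two_quotient l of (m, n) \<Rightarrow> last_part_fits m \<and> last_part_fits n)"

subsection \<open>Letters and fillings\<close>

text \<open>Letters and variables are numbered from 0: \<open>Primed i\<close> and \<open>Unprimed i\<close> stand for
  \<open>(i+1)'\<close> and \<open>i+1\<close>, and the exponent at \<open>i\<close> is that of \<open>x\<^sub>i\<^sub>+\<^sub>1\<close>.\<close>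

datatype letter = Primed (letter_index: nat) | Unprimed (letter_index: nat)

fun letter_rank :: "letter \<Rightarrow> nat" where
  "letter_rank (Primed i) = 2 * i"
| "letter_rank (Unprimed i) = 2 * i + 1"

instantiation letter :: linorder
begin

definition less_eq_letter :: "letter \<Rightarrow> letter \<Rightarrow> bool" where
  "a \<le> b \<longleftrightarrow> letter_rank a \<le> letter_rank b"

definition less_letter :: "letter \<Rightarrow> letter \<Rightarrow> bool" where
  "a < b \<longleftrightarrow> letter_rank a < letter_rank b"

instance
proof
  fix a b :: letter
  assume "a \<le> b" "b \<le> a"
  then have "letter_rank a = letter_rank b" by (simp add: less_eq_letter_def)
  then show "a = b" by (cases a; cases b; simp; presburger)
qed (auto simp: less_eq_letter_def less_letter_def)

end

datatype symbol = X | Letter letter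

text \<open>The exponent of the variable number \<open>i\<close> in the monomial of a filling.\<close>

definition content :: "('t \<rightharpoonup> symbol) \<Rightarrow> nat \<Rightarrow> nat" where
  "content f i = card {t. \<exists>a. f t = Some (Letter a) \<and> letter_index a = i}"

subsection \<open>Shifted domino tableaux\<close>

text \<open>A tableau is a partial map from dominoes to symbols whose domain is the paving.\<close>

definition is_shifted_domino_tableau :: "nat list \<Rightarrow> (domino \<rightharpoonup> symbol) \<Rightarrow> bool" where
  "is_shifted_domino_tableau l f \<longleftrightarrow>
     is_shifted_paving l (dom f) \<and>
     (\<forall>d\<in>up' (dom f). f d = Some X) \<and>
     (\<forall>d\<in>down' (dom f). \<exists>a. f d = Some (Letter a)) \<and>
     (\<forall>d e a b x x' y. f d = Some (Letter a) \<and> f e = Some (Letter b) \<and>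
        (x, y) \<in> d \<and> (x', y) \<in> e \<and> x < x' \<longrightarrow> a \<le> b) \<and>
     (\<forall>d e a b x y y'. f d = Some (Letter a) \<and> f e = Some (Letter b) \<and>
        (x, y) \<in> d \<and> (x, y') \<in> e \<and> y < y' \<longrightarrow> a \<le> b) \<and>
     (\<forall>d e i x y y'. f d = Some (Letter (Unprimed i)) \<and> f e = Some (Letter (Unprimed i)) \<and>
        (x, y) \<in> d \<and> (x, y') \<in> e \<longrightarrow> d = e) \<and>
     (\<forall>d e i x x' y. f d = Some (Letter (Primed i)) \<and> f e = Some (Letter (Primed i)) \<and>
        (x, y) \<in> d \<and> (x', y) \<in> e \<longrightarrow> d = e)"

definition domino_diagonal_unprimed :: "(domino \<rightharpoonup> symbol) \<Rightarrow> bool" where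
  "domino_diagonal_unprimed f \<longleftrightarrow> (\<forall>d i. on_diag d 0 \<longrightarrow> f d \<noteq> Some (Letter (Primed i)))"

text \<open>Tableaux with the same labelled dominoes in \<open>down'\<close> are identified, so a class of tableaux is
  represented by the common restriction of its members to \<open>down'\<close>.\<close>

definition lower_part :: "(domino \<rightharpoonup> symbol) \<Rightarrow> (domino \<rightharpoonup> symbol)" where
  "lower_part f = f |` down' (dom f)"

definition shifted_domino_tableaux :: "nat list \<Rightarrow> (domino \<rightharpoonup> symbol) set" where
  "shifted_domino_tableaux l = lower_part ` {f. is_shifted_domino_tableau l f}"

subsection \<open>Shifted Young tableaux\<close>

definition is_shifted_young_tableau :: "nat list \<Rightarrow> (cell \<rightharpoonup> symbol) \<Rightarrow> bool" where
  "is_shifted_young_tableau m t \<longleftrightarrow>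
     dom t = diagram m \<and>
     (\<forall>c\<in>up m. t c = Some X) \<and>
     (\<forall>c\<in>down m. \<exists>a. t c = Some (Letter a)) \<and>
     (\<forall>x x' y a b. t (x, y) = Some (Letter a) \<and> t (x', y) = Some (Letter b) \<and> x < x' \<longrightarrow> a \<le> b) \<and>
     (\<forall>x y y' a b. t (x, y) = Some (Letter a) \<and> t (x, y') = Some (Letter b) \<and> y < y' \<longrightarrow> a \<le> b) \<and>
     (\<forall>x y y' i. t (x, y) = Some (Letter (Unprimed i)) \<and> t (x, y') = Some (Letter (Unprimed i))
        \<longrightarrow> y = y') \<and>
     (\<forall>x x' y i. t (x, y) = Some (Letter (Primed i)) \<and> t (x', y) = Some (Letter (Primed i))
        \<longrightarrow> x = x')"

definition young_diagonal_unprimed :: "(cell \<rightharpoonup> symbol) \<Rightarrow> bool" where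
  "young_diagonal_unprimed t \<longleftrightarrow> (\<forall>c i. diag_index c = 0 \<longrightarrow> t c \<noteq> Some (Letter (Primed i)))"

subsection \<open>Formal power series in countably many variables\<close>

text \<open>A series is the family of its coefficients, indexed by the exponents of the monomials.\<close>

type_synonym series = "(nat \<Rightarrow>\<^sub>0 nat) \<Rightarrow> int"

definition series_mult :: "series \<Rightarrow> series \<Rightarrow> series"  (infixl "\<odot>" 70) where
  "(F \<odot> G) m = (\<Sum>(p, q) \<in> {(p, q). p + q = m}. F p * G q)"

text \<open>The series \<open>\<Sum>T\<in>S. x\<^sup>T\<close>. The two finiteness lemmas below show that neither \<^const>\<open>card\<close> here
  nor \<^const>\<open>sum\<close> in the product takes its default value.\<close>

definition tableau_series :: "('t \<rightharpoonup> symbol) set \<Rightarrow> series" where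
  "tableau_series S m = int (card {T \<in> S. content T = Poly_Mapping.lookup m})"

definition P_schur :: "nat list \<Rightarrow> series" where
  "P_schur m = tableau_series {t. is_shifted_young_tableau m t \<and> young_diagonal_unprimed t}"

lemma finite_summands: "finite {(p, q). p + q = (m :: nat \<Rightarrow>\<^sub>0 nat)}"
proof -
  define F where "F = {f. (\<forall>i\<in>Poly_Mapping.keys m. f i \<in> {..Max (Poly_Mapping.lookup m ` Poly_Mapping.keys m)}) \<and> (\<forall>i. i \<notin> Poly_Mapping.keys m \<longrightarrow> f i = 0)}"
  have "finite F"
    unfolding F_def using finite_set_of_finite_funs[of "Poly_Mapping.keys m" "{..Max (Poly_Mapping.lookup m ` Poly_Mapping.keys m)}" 0]
    by (rule rev_finite_subset) auto
  have below: "Poly_Mapping.lookup p \<in> F" if "\<And>i. Poly_Mapping.lookup p i \<le> Poly_Mapping.lookup m i" for p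
  proof -
    have "Poly_Mapping.lookup p i \<le> Max (Poly_Mapping.lookup m ` Poly_Mapping.keys m)" if "i \<in> Poly_Mapping.keys m" for i
      using \<open>\<And>i. Poly_Mapping.lookup p i \<le> Poly_Mapping.lookup m i\<close>[of i] that by (meson Max_ge finite_imageI finite_keys image_eqI le_trans)
    moreover have "Poly_Mapping.lookup p i = 0" if "i \<notin> Poly_Mapping.keys m" for i
      using \<open>\<And>i. Poly_Mapping.lookup p i \<le> Poly_Mapping.lookup m i\<close>[of i] that by (simp add: in_keys_iff)
    ultimately show ?thesis by (simp add: F_def)
  qed
  have "finite {p. Poly_Mapping.lookup p \<in> F}"
    using finite_vimageI[OF \<open>finite F\<close>, of Poly_Mapping.lookup] by (simp add: vimage_def inj_def lookup_inject)
  moreover have "{(p, q). p + q = m} \<subseteq> {p. Poly_Mapping.lookup p \<in> F} \<times> {p. Poly_Mapping.lookup p \<in> F}"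
    using below by (auto simp: lookup_add)
  ultimately show ?thesis by (meson finite_SigmaI finite_subset)
qed

lemma finite_fillings:
  assumes "finite A"
  shows "finite {f :: 't \<rightharpoonup> symbol. dom f \<subseteq> A \<and> content f = Poly_Mapping.lookup m}"
proof -
  define B where "B = insert X (Letter ` (Primed ` Poly_Mapping.keys m \<union> Unprimed ` Poly_Mapping.keys m))"
  have fin: "finite (\<Union>D\<in>Pow A. {f. dom f = D \<and> ran f \<subseteq> B})"
    using assms by (auto intro!: finite_set_of_finite_maps intro: finite_subset simp: B_def)
  have "ran f \<subseteq> B" if f: "dom f \<subseteq> A" "content f = Poly_Mapping.lookup m" for f :: "'t \<rightharpoonup> symbol"
  proof
    fix s assume "s \<in> ran f"
    then obtain t where t: "f t = Some s" by (auto simp: ran_def)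
    show "s \<in> B"
    proof (cases s)
      case (Letter a)
      let ?T = "{t. \<exists>b. f t = Some (Letter b) \<and> letter_index b = letter_index a}"
      have "?T \<subseteq> A" using f by auto
      then have "finite ?T" using assms finite_subset by blast
      moreover have "t \<in> ?T" using t Letter by auto
      ultimately have "card ?T \<noteq> 0" by auto
      then have "content f (letter_index a) \<noteq> 0" by (simp add: content_def)
      then have "letter_index a \<in> Poly_Mapping.keys m" using f by (simp add: in_keys_iff)
      then show ?thesis unfolding B_def Letter by (cases a) auto
    qed (simp add: B_def)
  qed
  then have "{f. dom f \<subseteq> A \<and> content f = Poly_Mapping.lookup m} \<subseteq> (\<Union>D\<in>Pow A. {f. dom f = D \<and> ran f \<subseteq> B})"
    by auto
  then show ?thesis using fin finite_subset by blast
qed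

end

(*
  A domino meets two consecutive diagonals Y = X - h and Y = X - h + 1; the labels of the labelled
  dominoes meeting this pair form a set V_h, h = 0, 1, 2, ... The diagonal Y = X - h carries the
  labels V_h and V_(h+1), strictly increasing once ties between the two sets are broken by a rule
  that depends only on primedness. Hence the tableau is recovered from the sets, since the position
  of a label on a diagonal is the number of smaller labels there. The row and column conditions
  become an interlacing condition between V_h and V_(h+2) only, so the even and odd subfamilies are
  independent; each of them describes, by the same analysis of diagonals, a shifted Young tableau
  of shape one component of the 2-quotient.
  The upper part of a paving is not unique. One is found by continuing the family to negative h,
  discarding the least element of V_(h+2) to get V_h.
*)
theory Submission
  imports Defs
begin

subsection \<open>Ranks in finite sets\<close>

text \<open>The independence of the two subfamilies comes from a cancellation. A label of V_(h+1)
  has a position on two diagonals, each position being a count over two of the sets; V_(h+1)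
  contributes the same to both counts, so whether the two cells touch depends on V_h and V_(h+2)
  alone. The sizes of the sets come from the numbers L_i. The length of a diagonal counts the L_i
  above a threshold, and halving the L_i of one parity gives the corresponding numbers of a
  component of the 2-quotient. The two parities must be balanced for this, which an empty 2-core
  provides. The main diagonal is the obstacle: the second cell of a domino of V_0 lies on the
  diagonal above it, where no labels fix its position. The condition on vertical dominoes of D_0
  settles this: a domino of V_0 is vertical exactly when no smaller label lies in V_1. The
  hypothesis on the last parts makes the diagonals above the main one lose one cell per step in each
  component, the rate at which the continuation discards elements.\<close>

definition below :: "nat set \<Rightarrow> nat \<Rightarrow> nat" where
  "below A m = card {r \<in> A. r < m}"

lemma below_mono: "finite A \<Longrightarrow> m \<le> n \<Longrightarrow> below A m \<le> below A n"
  unfolding below_def by (intro card_mono) auto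

lemma below_Suc:
  assumes "finite A"
  shows "below A (Suc m) = below A m + (if m \<in> A then 1 else 0)"
proof -
  have "{r \<in> A. r < Suc m} = (if m \<in> A then insert m {r \<in> A. r < m} else {r \<in> A. r < m})"
    by (auto simp: less_Suc_eq)
  then show ?thesis using assms by (simp add: below_def)
qed

lemma below_less:
  assumes "finite A" "r \<in> A" "r < m"
  shows "below A r < below A m"
proof -
  have "below A (Suc r) \<le> below A m" using assms by (intro below_mono) auto
  then show ?thesis using assms by (simp add: below_Suc)
qed

lemma below_le_card: "finite A \<Longrightarrow> below A m \<le> card A"
  unfolding below_def by (intro card_mono) auto

lemma below_less_card: "finite A \<Longrightarrow> r \<in> A \<Longrightarrow> below A r < card A"
  unfolding below_def by (intro psubset_card_mono) auto

lemma below_less_iff: "finite A \<Longrightarrow> r \<in> A \<Longrightarrow> below A r < below A m \<longleftrightarrow> r < m"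
  using below_less below_mono by (meson leD leI)

lemma below_inj: "finite A \<Longrightarrow> inj_on (below A) A"
  by (rule inj_onI) (metis below_less less_irrefl linorder_neqE_nat)

lemma below_image: "finite A \<Longrightarrow> below A ` A = {..<card A}"
  using below_inj[of A] below_less_card[of A]
  by (intro card_subset_eq) (auto simp: card_image)

lemma below_obtain:
  assumes "finite A" "p < card A"
  obtains r where "r \<in> A" "below A r = p"
  using below_image[OF assms(1)] assms(2) by (metis imageE lessThan_iff)

lemma below_Un:
  assumes "finite A" "finite B" "A \<inter> B = {}"
  shows "below (A \<union> B) m = below A m + below B m"
proof -
  have "{r \<in> A \<union> B. r < m} = {r \<in> A. r < m} \<union> {r \<in> B. r < m}" by auto
  then show ?thesis unfolding below_def using assms by (simp add: card_Un_disjoint disjoint_iff)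
qed

lemma below_image_strict_mono:
  assumes "strict_mono (f :: nat \<Rightarrow> nat)" "\<And>r. f r < m \<longleftrightarrow> r < n"
  shows "below (f ` A) m = below A n"
proof -
  have "{s \<in> f ` A. s < m} = f ` {r \<in> A. r < n}" using assms(2) by auto
  then show ?thesis unfolding below_def
    using strict_mono_on_imp_inj_on[of UNIV f] assms(1) by (simp add: card_image inj_on_subset)
qed

text \<open>Converts positions into ranks: once the labels of a diagonal are known to increase and
  to exhaust a set, position and \<open>below\<close> coincide and the length of the diagonal is the
  cardinality of the set.\<close>

lemma enumeration_below:
  fixes k :: "nat \<Rightarrow> nat"
  assumes mono: "\<And>y. Suc y < n \<Longrightarrow> k y < k (Suc y)" and onto: "k ` {..<n} = S"
  shows "card S = n" "\<And>y. y < n \<Longrightarrow> below S (k y) = y"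
proof -
  have less: "k y < k z" if "y < z" "z < n" for y z
    using that
  proof (induction z)
    case (Suc z)
    then show ?case using mono[of z] by (cases "y = z") (auto intro: less_trans)
  qed simp
  have inj: "inj_on k {..<n}"
    by (rule inj_onI) (metis less lessThan_iff less_irrefl linorder_neqE_nat)
  then show "card S = n" using onto card_image by fastforce
  show "below S (k y) = y" if "y < n" for y
  proof -
    have "{s \<in> S. s < k y} = k ` {..<y}"
    proof (intro equalityI subsetI)
      fix s assume "s \<in> {s \<in> S. s < k y}"
      then obtain z where "z < n" "s = k z" "k z < k y" using onto by auto
      then show "s \<in> k ` {..<y}" using less that by (metis imageI lessThan_iff less_asym linorder_neqE_nat)
    next
      fix s assume "s \<in> k ` {..<y}"
      then show "s \<in> {s \<in> S. s < k y}" using less that onto by auto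
    qed
    then show ?thesis unfolding below_def
      using card_image[OF inj_on_subset[OF inj]] that by (simp add: subset_eq)
  qed
qed

definition drop_least :: "nat \<Rightarrow> nat set \<Rightarrow> nat set" where
  "drop_least k A = {r \<in> A. k \<le> below A r}"

lemma drop_least_0 [simp]: "drop_least 0 A = A"
  by (auto simp: drop_least_def)

lemma finite_drop_least [simp]: "finite A \<Longrightarrow> finite (drop_least k A)"
  by (simp add: drop_least_def)

text \<open>\<open>below A\<close> maps the surviving elements under \<open>m\<close> bijectively
  onto an interval starting at \<open>k\<close>; the truncated subtraction covers the case that
  nothing survives below \<open>m\<close>.\<close>

lemma below_drop_least:
  assumes "finite A"
  shows "below (drop_least k A) m = below A m - k"
proof -
  have "below A ` {r \<in> drop_least k A. r < m} = {k..<below A m}"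
  proof (intro equalityI subsetI)
    fix p assume p: "p \<in> {k..<below A m}"
    then have "p < card A" using below_le_card[OF assms, of m] by auto
    then obtain r where "r \<in> A" "below A r = p" using below_obtain assms by blast
    then show "p \<in> below A ` {r \<in> drop_least k A. r < m}"
      using p below_less_iff[OF assms] by (auto simp: drop_least_def image_iff)
  qed (use assms in \<open>auto simp: drop_least_def intro: below_less\<close>)
  moreover have "inj_on (below A) {r \<in> drop_least k A. r < m}"
    using below_inj[OF assms] by (rule inj_on_subset) (auto simp: drop_least_def)
  ultimately show ?thesis unfolding below_def[of "drop_least k A"]
    by (metis card_atLeastLessThan card_image)
qed

lemma card_drop_least:
  assumes "finite A"
  shows "card (drop_least k A) = card A - k"
proof -
  \<comment> \<open>A cardinality is the value of \<open>below\<close> at a bound beyond all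
    elements, so the previous lemma applies.\<close>
  have *: "card B = below B (Suc (Max (insert 0 A)))" if "B \<subseteq> A" for B
    unfolding below_def using that assms by (intro arg_cong[where f=card]) (auto simp: less_Suc_eq_le)
  show ?thesis using *[of A] *[of "drop_least k A"] below_drop_least[OF assms] by (simp add: drop_least_def)
qed

text \<open>A label \<open>r\<close> on a diagonal comes from a domino shared with the previous diagonal (\<open>keyP\<close>, towards
  the main one) or with the next (\<open>keyN\<close>). Ties: for odd \<open>r\<close> (unprimed letters) the former comes
  first, for even \<open>r\<close> (primed letters) the latter; the opposite order would put two dominoes with
  the same unprimed (primed) letter in one column (row).\<close>

definition keyP :: "nat \<Rightarrow> nat" where "keyP r = 2 * r + (if even r then 1 else 0)"
definition keyN :: "nat \<Rightarrow> nat" where "keyN r = 2 * r + (if even r then 0 else 1)"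

lemma keyP_div2 [simp]: "keyP r div 2 = r" and keyN_div2 [simp]: "keyN r div 2 = r"
  by (auto simp: keyP_def keyN_def)

lemma keyP_parity: "even (keyP r) \<longleftrightarrow> odd r" and keyN_parity: "even (keyN r) \<longleftrightarrow> even r"
  by (auto simp: keyP_def keyN_def)

lemma strict_mono_keyP: "strict_mono keyP"
  by (rule strict_monoI) (simp add: keyP_def)

lemma strict_mono_keyN: "strict_mono keyN"
  by (rule strict_monoI) (simp add: keyN_def)

lemma keyP_eq [simp]: "keyP r = keyP s \<longleftrightarrow> r = s" and keyN_eq [simp]: "keyN r = keyN s \<longleftrightarrow> r = s"
  using strict_mono_eq strict_mono_keyP strict_mono_keyN by blast+

lemma keyP_neq_keyN [simp]: "keyP r \<noteq> keyN s"
proof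
  assume eq: "keyP r = keyN s"
  then have "r = s" using keyP_div2[of r] keyN_div2[of s] by simp
  then show False using eq keyP_parity[of r] keyN_parity[of s] by simp
qed

lemma keyN_neq_keyP [simp]: "keyN s \<noteq> keyP r"
  using keyP_neq_keyN by metis

definition merged :: "nat set \<Rightarrow> nat set \<Rightarrow> nat set" where
  "merged A B = keyP ` A \<union> keyN ` B"

lemma keyP_in_merged [simp]: "keyP r \<in> merged A B \<longleftrightarrow> r \<in> A"
  and keyN_in_merged [simp]: "keyN r \<in> merged A B \<longleftrightarrow> r \<in> B"
  by (auto simp: merged_def)

lemma finite_merged [simp]: "finite (merged A B) \<longleftrightarrow> finite A \<and> finite B"
  by (auto simp: merged_def finite_image_iff inj_on_def)

lemma card_merged: "finite A \<Longrightarrow> finite B \<Longrightarrow> card (merged A B) = card A + card B"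
  unfolding merged_def by (subst card_Un_disjoint) (auto simp: card_image inj_on_def)

text \<open>\<open>n\<close> and \<open>n'\<close> are the thresholds that a key \<open>m\<close>
  induces on the two kinds of labels. In the instances for a key of \<open>r\<close> a threshold is
  \<open>r + 1\<close> instead of \<open>r\<close> exactly where the tie rule puts the equal label
  of the other kind first.\<close>

lemma below_merged:
  assumes "finite A" "finite B" "\<And>r. keyP r < m \<longleftrightarrow> r < n" "\<And>r. keyN r < m \<longleftrightarrow> r < n'"
  shows "below (merged A B) m = below A n + below B n'"
  unfolding merged_def using assms
  by (subst below_Un) (auto simp: below_image_strict_mono[OF strict_mono_keyP] below_image_strict_mono[OF strict_mono_keyN])

lemma below_merged_keyP_even:
  assumes "finite A" "finite B"
  shows "below (merged A B) (keyP (2 * i)) = below A (2 * i) + below B (2 * i + 1)"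
  by (rule below_merged[OF assms]) (simp_all add: keyP_def keyN_def, presburger+)

lemma below_merged_keyP_odd:
  assumes "finite A" "finite B"
  shows "below (merged A B) (keyP (2 * i + 1)) = below A (2 * i + 1) + below B (2 * i + 1)"
  by (rule below_merged[OF assms]) (auto simp: keyP_def keyN_def)

lemma below_merged_keyN_even:
  assumes "finite A" "finite B"
  shows "below (merged A B) (keyN (2 * i)) = below A (2 * i) + below B (2 * i)"
  by (rule below_merged[OF assms]) (auto simp: keyP_def keyN_def)

lemma below_merged_keyN_odd:
  assumes "finite A" "finite B"
  shows "below (merged A B) (keyN (2 * i + 1)) = below A (2 * i + 2) + below B (2 * i + 1)"
  by (rule below_merged[OF assms]) (simp_all add: keyP_def keyN_def, presburger+)

text \<open>Both keys of \<open>r\<close> are among \<open>2 * r\<close> and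
  \<open>2 * r + 1\<close>, so an even bound never separates equal labels.\<close>

lemma below_merged_double:
  assumes "finite A" "finite B"
  shows "below (merged A B) (2 * m) = below A m + below B m"
  by (rule below_merged[OF assms]) (auto simp: keyP_def keyN_def)

subsection \<open>Diagonals of a diagram\<close>

text \<open>The sign is reversed: \<open>g\<close> stands for the diagonal \<open>D\<close> of index \<open>- g\<close>.\<close>

definition diag_cell :: "int \<Rightarrow> nat \<Rightarrow> cell" where
  "diag_cell g p = (p + nat g, p + nat (- g))"

definition diag_len :: "nat list \<Rightarrow> int \<Rightarrow> nat" where
  "diag_len m g = card {p. diag_cell g p \<in> diagram m}"

lemma diag_cell_inject [simp]: "diag_cell g p = diag_cell g' p' \<longleftrightarrow> g = g' \<and> p = p'"
  by (auto simp: diag_cell_def)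

lemma diag_index_diag_cell [simp]: "diag_index (diag_cell g p) = - g"
  by (auto simp: diag_cell_def diag_index_def)

lemma cell_eq_diag_cell: "(x, y) = diag_cell (int x - int y) (min x y)"
  by (auto simp: diag_cell_def)

lemma finite_diagram: "finite (diagram m)"
proof -
  have "diagram m = (\<Union>y<length m. (\<lambda>x. (x, y)) ` {..<m ! y})" by (auto simp: diagram_def)
  then show ?thesis by simp
qed

lemma finite_diag_cells: "finite {p. diag_cell g p \<in> diagram m}"
  by (rule finite_subset[of _ "{..<length m}"]) (auto simp: diag_cell_def diagram_def)

lemma diagram_closed:
  assumes "is_partition m" "(x, y) \<in> diagram m" "x' \<le> x" "y' \<le> y"
  shows "(x', y') \<in> diagram m"
proof -
  have "m ! y \<le> m ! y'"
    using assms by (cases "y' = y") (auto simp: is_partition_def diagram_def sorted_wrt_iff_nth_less)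
  then show ?thesis using assms by (auto simp: diagram_def)
qed

lemma downset_eq_lessThan_card:
  assumes "finite D" "\<And>p q. p \<in> D \<Longrightarrow> q \<le> p \<Longrightarrow> q \<in> D"
  shows "D = {..<card (D :: nat set)}"
proof (cases "D = {}")
  case False
  have "D = {..Max D}"
    using assms(2)[OF Max_in[OF assms(1) False]] Max_ge[OF assms(1)] by (intro equalityI subsetI) simp_all
  then have "D = {..<Suc (Max D)}" by (simp add: lessThan_Suc_atMost)
  then show ?thesis by (metis card_lessThan)
qed simp

lemma diag_cell_in_diagram:
  assumes "is_partition m"
  shows "diag_cell g p \<in> diagram m \<longleftrightarrow> p < diag_len m g"
proof -
  let ?D = "{p. diag_cell g p \<in> diagram m}"
  have "q \<in> ?D" if "p \<in> ?D" "q \<le> p" for p q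
    using that diagram_closed[OF assms, of "p + nat g" "p + nat (- g)"] by (auto simp: diag_cell_def)
  then have "?D = {..<card ?D}"
    by (rule downset_eq_lessThan_card[OF finite_diag_cells])
  then show ?thesis by (auto simp: diag_len_def)
qed

lemma L_entry_int: "y < length m \<Longrightarrow> int (L_entry m y) = int (m ! y) + int (length m) - int y - 1"
  by (auto simp: L_entry_def)

text \<open>The inequality says that \<open>m ! y\<close> exceeds \<open>y + g\<close>. If
  \<open>y + g\<close> is non-negative, row \<open>y\<close> has a cell on the diagonal; the rows
  with \<open>y + g\<close> negative satisfy it for free although the diagonal starts above them,
  and the \<open>min\<close> counts these.\<close>

lemma diag_len_L_entry:
  "diag_len m g + min (length m) (nat (- g)) =
     card {y. y < length m \<and> int (length m) + g \<le> int (L_entry m y)}"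
proof -
  let ?D = "{p. diag_cell g p \<in> diagram m}"
  have iff: "int (length m) + g \<le> int (L_entry m y) \<longleftrightarrow> int y + g < int (m ! y)" if "y < length m" for y
    using L_entry_int[OF that] by auto
  have "{y. y < length m \<and> int (length m) + g \<le> int (L_entry m y)} =
          (\<lambda>p. p + nat (- g)) ` ?D \<union> {..<min (length m) (nat (- g))}" (is "?A = ?B")
  proof (intro equalityI subsetI)
    fix y assume "y \<in> ?A"
    then have y: "y < length m" "int y + g < int (m ! y)" using iff by auto
    show "y \<in> ?B"
    proof (cases "y < nat (- g)")
      case False
      then have "y - nat (- g) \<in> ?D" using y by (auto simp: diag_cell_def diagram_def)
      then show ?thesis using False by (intro UnI1 image_eqI[of _ _ "y - nat (- g)"]) auto
    qed (use y in auto)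
  next
    fix y assume "y \<in> ?B"
    then show "y \<in> ?A"
    proof
      assume "y \<in> (\<lambda>p. p + nat (- g)) ` ?D"
      then show ?thesis using iff by (auto simp: diag_cell_def diagram_def)
    next
      assume "y \<in> {..<min (length m) (nat (- g))}"
      then show ?thesis using iff by auto
    qed
  qed
  moreover have "card ?B = card ?D + min (length m) (nat (- g))"
    using finite_diag_cells[of g m] by (subst card_Un_disjoint) (auto simp: card_image)
  ultimately show ?thesis by (simp add: diag_len_def)
qed

text \<open>The diagram contains the square whose side is the number of rows, so a diagonal that
  starts on the left edge is bounded by the number of rows alone.\<close>

lemma diag_len_last_part_fits:
  assumes "is_partition m" "last_part_fits m" "g \<le> 0"
  shows "diag_len m g = diag_len m 0 - nat (- g)"
proof -
  have "{p. diag_cell g p \<in> diagram m} = {..<length m - nat (- g)}" if "g \<le> 0" for g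
  proof -
    have "length m \<le> m ! y" if "y < length m" for y
    proof -
      have "m ! (length m - 1) \<le> m ! y"
        using assms(1) that by (cases "y = length m - 1") (auto simp: is_partition_def sorted_wrt_iff_nth_less)
      then show ?thesis using assms(2) that by (cases "m = []") (auto simp: last_part_fits_def last_conv_nth)
    qed
    then have "x < m ! y" if "y < length m" "x < length m" for x y using that less_le_trans by blast
    then show ?thesis using \<open>g \<le> 0\<close> by (auto simp: diag_cell_def diagram_def)
  qed
  from this[of g] this[of 0] show ?thesis using assms(3) by (simp add: diag_len_def)
qed

subsection \<open>Diagonals of the 2-quotient\<close>

lemma Cons_in_diagram: "(x, y) \<in> diagram (a # m) \<longleftrightarrow> (case y of 0 \<Rightarrow> x < a | Suc y' \<Rightarrow> (x, y') \<in> diagram m)"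
  by (auto simp: diagram_def split: nat.split)

text \<open>The zeros of a non-increasing list are trailing, so only empty top rows
  disappear.\<close>

lemma diagram_filter_nonzero:
  assumes "sorted_wrt (\<ge>) m"
  shows "diagram (filter (\<lambda>p. p \<noteq> 0) m) = diagram (m :: nat list)"
  using assms
proof (induction m)
  case (Cons a m)
  show ?case
  proof (cases "a = 0")
    case True
    then have zero: "p = 0" if "p \<in> set (a # m)" for p using Cons.prems that by auto
    then have "(a # m) ! y = 0" if "y < length (a # m)" for y
      using that by (intro zero nth_mem)
    moreover have "filter (\<lambda>p. p \<noteq> 0) (a # m) = []"
      using zero by (simp only: filter_empty_conv) blast
    ultimately show ?thesis unfolding diagram_def by (auto simp del: filter.simps)
  next
    case False
    then show ?thesis using Cons by (auto simp: Cons_in_diagram split: nat.splits)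
  qed
qed simp

lemma L_entry_decreasing:
  assumes "is_partition l" "i < j" "j < length l"
  shows "L_entry l j < L_entry l i"
proof -
  have "l ! j \<le> l ! i" using assms by (auto simp: is_partition_def sorted_wrt_iff_nth_less)
  then show ?thesis using assms by (auto simp: L_entry_def)
qed

text \<open>Each later entry forces the value up by at least one. Applied to the halved entries of
  one parity, this ensures that the truncated subtraction in the 2-quotient loses nothing.\<close>

lemma strictly_decreasing_ge:
  assumes "\<And>i j. i < j \<Longrightarrow> j < n \<Longrightarrow> f j < (f i :: nat)" "r < n"
  shows "n - Suc r \<le> f r"
proof -
  have "d \<le> f (n - Suc d)" if "d < n" for d
    using that
  proof (induction d)
    case (Suc d)
    have "f (n - Suc d) < f (n - Suc (Suc d))" using Suc.prems by (intro assms(1)) auto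
    then show ?case using Suc by auto
  qed simp
  from this[of "n - Suc r"] show ?thesis using assms(2) by (auto simp: Suc_diff_Suc)
qed

lemma half_less: "(a::nat) < b \<Longrightarrow> even a = even b \<Longrightarrow> a div 2 < b div 2"
  by presburger

lemma half_diff: "(a - (2 * n + a mod 2)) div 2 = a div 2 - (n::nat)"
  by (cases "even a") (auto elim!: evenE oddE)

context
  fixes l :: "nat list" and Q :: "nat \<Rightarrow> bool"
  assumes l: "is_partition l" and Q: "Q = even \<or> Q = odd"
begin

definition "rows = filter (\<lambda>i. Q (L_entry l i)) [0..<length l]"

text \<open>The zero parts are kept here, so that the length is the number of rows of the given
  parity and does not depend on the values of the parts.\<close>

definition "padded_part = map (\<lambda>i. (L_entry l i - M_entry l i) div 2) rows"

lemma set_rows: "set rows = {i. i < length l \<and> Q (L_entry l i)}"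
  by (auto simp: rows_def)

lemma rows_less: "r < s \<Longrightarrow> s < length rows \<Longrightarrow> rows ! r < rows ! s"
proof -
  have "sorted_wrt (<) rows" unfolding rows_def by (intro sorted_wrt_filter) simp
  then show "r < s \<Longrightarrow> s < length rows \<Longrightarrow> rows ! r < rows ! s" by (auto simp: sorted_wrt_iff_nth_less)
qed

lemma rows_nth: "r < length rows \<Longrightarrow> rows ! r < length l \<and> Q (L_entry l (rows ! r))"
  using set_rows nth_mem by blast

lemma half_L_decreasing:
  assumes "r < s" "s < length rows"
  shows "L_entry l (rows ! s) div 2 < L_entry l (rows ! r) div 2"
proof -
  have "L_entry l (rows ! s) < L_entry l (rows ! r)"
    using assms rows_less rows_nth by (intro L_entry_decreasing[OF l]) auto
  moreover have "even (L_entry l (rows ! s)) = even (L_entry l (rows ! r))"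
    using rows_nth[of r] rows_nth[of s] assms Q by auto
  ultimately show ?thesis by (rule half_less)
qed

lemma M_entry_rows:
  assumes "r < length rows"
  shows "M_entry l (rows ! r) = 2 * (length rows - Suc r) + L_entry l (rows ! r) mod 2"
proof -
  let ?i = "rows ! r"
  have "{j. ?i < j \<and> j < length l \<and> even (L_entry l j) = even (L_entry l ?i)} = (!) rows ` {r<..<length rows}"
    (is "?A = ?B")
  proof (intro equalityI subsetI)
    fix j assume j: "j \<in> ?A"
    then have "j \<in> set rows" using rows_nth[OF assms] Q by (auto simp: set_rows)
    then obtain s where s: "s < length rows" "rows ! s = j" by (auto simp: in_set_conv_nth)
    then have "r < s" using j rows_less[of s r] assms by (metis (no_types, lifting) linorder_neqE_nat less_asym mem_Collect_eq order_less_irrefl)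
    then show "j \<in> ?B" using s by auto
  next
    fix j assume "j \<in> ?B"
    then obtain s where "r < s" "s < length rows" "j = rows ! s" by auto
    then show "j \<in> ?A" using rows_nth[OF assms] rows_nth[of s] rows_less[of r s] Q by auto
  qed
  moreover have "inj_on ((!) rows) {r<..<length rows}"
    by (rule inj_onI) (metis greaterThanLessThan_iff linorder_neqE_nat order_less_irrefl rows_less)
  ultimately have "card ?A = length rows - Suc r" by (simp add: card_image)
  then show ?thesis unfolding M_entry_def by (simp add: odd_iff_mod_2_eq_one)
qed

lemma padded_part_nth:
  assumes "r < length rows"
  shows "padded_part ! r = L_entry l (rows ! r) div 2 - (length rows - Suc r)"
    "length rows - Suc r \<le> L_entry l (rows ! r) div 2"
proof -
  show "length rows - Suc r \<le> L_entry l (rows ! r) div 2"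
    using strictly_decreasing_ge[of "length rows" "\<lambda>r. L_entry l (rows ! r) div 2" r] half_L_decreasing assms
    by blast
  show "padded_part ! r = L_entry l (rows ! r) div 2 - (length rows - Suc r)"
    unfolding padded_part_def using assms M_entry_rows[OF assms] by (simp only: nth_map half_diff)
qed

text \<open>Halving \<open>M_entry\<close> leaves exactly the staircase that \<open>L_entry\<close>
  adds back. So the entries of one parity, halved, are the shifted parts (beta-numbers) of the
  component.\<close>

lemma L_entry_padded_part:
  assumes "r < length rows"
  shows "L_entry padded_part r = L_entry l (rows ! r) div 2"
  using padded_part_nth[OF assms] assms unfolding L_entry_def[of padded_part]
  by (simp add: padded_part_def)

lemma sorted_padded_part: "sorted_wrt (\<ge>) padded_part"
  unfolding sorted_wrt_iff_nth_less
proof (intro allI impI)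
  fix r s assume rs: "r < s" "s < length padded_part"
  then have s: "s < length rows" by (simp add: padded_part_def)
  have "L_entry l (rows ! (r + d)) div 2 + d \<le> L_entry l (rows ! r) div 2" if "r + d < length rows" for d
    using that
  proof (induction d)
    case (Suc d)
    then show ?case using half_L_decreasing[of "r + d" "r + Suc d"] by auto
  qed simp
  from this[of "s - r"] show "padded_part ! s \<le> padded_part ! r"
    using rs s by (auto simp: padded_part_nth)
qed

lemma quotient_part_eq: "quotient_part Q l = filter (\<lambda>p. p \<noteq> 0) padded_part"
  by (simp add: quotient_part_def padded_part_def rows_def)

lemma is_partition_quotient_part: "is_partition (quotient_part Q l)"
  unfolding is_partition_def quotient_part_eq using sorted_padded_part by (auto intro: sorted_wrt_filter)

text \<open>\<open>diag_len_L_entry\<close> is applied to the padded list, whose length is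
  \<open>e\<close>; dropping the zeros changes that length but no diagonal.\<close>

lemma diag_len_quotient_part:
  fixes g :: int
  defines "e \<equiv> card {y. y < length l \<and> Q (L_entry l y)}"
  shows "diag_len (quotient_part Q l) g + min e (nat (- g)) =
    card {y. y < length l \<and> Q (L_entry l y) \<and> int e + g \<le> int (L_entry l y div 2)}"
proof -
  have dist: "distinct rows" by (simp add: rows_def)
  have e: "length rows = e" unfolding e_def set_rows[symmetric] using dist by (simp add: distinct_card)
  have len: "length padded_part = e" using e by (simp add: padded_part_def)
  have "{y. y < length l \<and> Q (L_entry l y) \<and> int e + g \<le> int (L_entry l y div 2)} =
     (!) rows ` {r. r < e \<and> int e + g \<le> int (L_entry padded_part r)}" (is "?A = ?B")
  proof (intro equalityI subsetI)
    fix y assume y: "y \<in> ?A"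
    then have "y \<in> set rows" by (simp add: set_rows)
    then obtain r where "r < e" "y = rows ! r" by (metis in_set_conv_nth e)
    then show "y \<in> ?B" using y L_entry_padded_part[of r] e by auto
  next
    fix y assume "y \<in> ?B"
    then show "y \<in> ?A" using rows_nth L_entry_padded_part e by auto
  qed
  moreover have "inj_on ((!) rows) {r. r < e \<and> int e + g \<le> int (L_entry padded_part r)}"
    by (rule inj_on_nth[OF dist]) (use e in auto)
  ultimately have "card ?A = card {r. r < e \<and> int e + g \<le> int (L_entry padded_part r)}"
    by (simp add: card_image)
  also have "\<dots> = diag_len padded_part g + min e (nat (- g))"
    using diag_len_L_entry[of padded_part g] len by simp
  also have "diag_len padded_part g = diag_len (quotient_part Q l) g"
    unfolding diag_len_def quotient_part_eq diagram_filter_nonzero[OF sorted_padded_part] ..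
  finally show ?thesis by simp
qed

end

subsection \<open>Pavable partitions are balanced\<close>

definition checker :: "cell \<Rightarrow> int" where
  "checker c = (- 1) ^ (fst c + snd c)"

lemma sum_checker_domino: "is_domino d \<Longrightarrow> sum checker d = 0"
  by (auto simp: is_domino_def horizontal_def vertical_def checker_def)

lemma sum_checker_removal_step:
  assumes "removal_step A B" "finite A"
  shows "sum checker A = sum checker B \<and> finite B"
proof -
  obtain d where d: "is_domino d" "d \<subseteq> A" "B = A - d"
    using assms(1) by (auto simp: removal_step_def removable_def)
  then show ?thesis using sum.subset_diff[OF d(2) assms(2), of checker] sum_checker_domino assms(2) by auto
qed

lemma sum_checker_removal_steps:
  assumes "removal_step\<^sup>*\<^sup>* A B" "finite A"
  shows "sum checker A = sum checker B \<and> finite B"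
  using assms by (induction rule: rtranclp_induct) (use sum_checker_removal_step in auto)

lemma sum_alternating: "(\<Sum>x<n. (- 1) ^ x :: int) = (if odd n then 1 else 0)"
  by (induction n) auto

text \<open>A domino has checkerboard sum 0, hence so has a diagram that can be emptied by removals.
  Row \<open>y\<close> contributes \<open>(- 1) ^ y\<close> if its part is odd and 0 otherwise. Now
  \<open>(- 1) ^ L_entry l y\<close> is \<open>(- 1) ^ (n + 1) * (- 1) ^ y\<close> with its sign
  changed exactly for odd parts, where \<open>n\<close> is the length; so summing it over all rows
  leaves an alternating sum, which is the excess of even entries over odd ones.\<close>

lemma pavable_balanced:
  assumes "pavable l"
  shows "card {y. y < length l \<and> even (L_entry l y)} = (length l + 1) div 2"
    "card {y. y < length l \<and> odd (L_entry l y)} = length l div 2"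
proof -
  let ?n = "length l"
  have "0 = sum checker (diagram l)"
    using assms sum_checker_removal_steps[of "diagram l" "{}"] finite_diagram[of l]
    by (simp add: pavable_def is_two_core_diagram_def)
  also have "diagram l = prod.swap ` (SIGMA y:{..<?n}. {..<l ! y})"
    by (auto simp: diagram_def image_iff)
  also have "sum checker \<dots> = (\<Sum>(y, x)\<in>(SIGMA y:{..<?n}. {..<l ! y}). (- 1) ^ (x + y))"
    by (subst sum.reindex) (auto simp: checker_def o_def case_prod_beta)
  also have "\<dots> = (\<Sum>y<?n. \<Sum>x<l ! y. (- 1) ^ (x + y))"
    by (subst sum.Sigma) auto
  also have "\<dots> = (\<Sum>y<?n. (- 1) ^ y * (if odd (l ! y) then 1 else 0))"
    by (intro sum.cong refl) (simp add: power_add sum_distrib_right[symmetric] sum_alternating)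
  finally have bal: "(\<Sum>y<?n. (- 1) ^ y * (if odd (l ! y) then 1 else 0)) = (0::int)" by simp
  have "(\<Sum>y<?n. (- 1) ^ L_entry l y :: int) =
     (\<Sum>y<?n. (- 1) ^ (?n + 1) * ((- 1) ^ y - 2 * ((- 1) ^ y * (if odd (l ! y) then 1 else 0))))"
  proof (intro sum.cong refl)
    fix y assume "y \<in> {..<?n}"
    then have "L_entry l y + y + 1 = l ! y + ?n" by (auto simp: L_entry_def)
    then have "even (L_entry l y) \<longleftrightarrow> even (l ! y + ?n + y + 1)" by presburger
    then show "(- 1) ^ L_entry l y = (- 1) ^ (?n + 1) * ((- 1) ^ y - 2 * ((- 1) ^ y * (if odd (l ! y) then 1 else (0::int))))"
      by (auto simp: minus_one_power_iff)
  qed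
  also have "\<dots> = (- 1) ^ (?n + 1) * (\<Sum>y<?n. (- 1) ^ y)"
    unfolding sum_distrib_left[symmetric] sum_subtractf bal by simp
  also have "\<dots> = (if odd ?n then 1 else 0)" by (simp add: sum_alternating)
  finally have diff: "(\<Sum>y<?n. (- 1) ^ L_entry l y :: int) = (if odd ?n then 1 else 0)" .
  let ?E = "{y. y < ?n \<and> even (L_entry l y)}" and ?O = "{y. y < ?n \<and> odd (L_entry l y)}"
  have un: "{..<?n} = ?E \<union> ?O" by auto
  have "(\<Sum>y<?n. (- 1) ^ L_entry l y :: int) = (\<Sum>y\<in>?E. (- 1) ^ L_entry l y) + (\<Sum>y\<in>?O. (- 1) ^ L_entry l y)"
    by (subst un, rule sum.union_disjoint) auto
  also have "\<dots> = int (card ?E) - int (card ?O)" by (simp add: minus_one_power_iff)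
  finally have diff': "int (card ?E) - int (card ?O) = (if odd ?n then 1 else 0)" using diff by simp
  have sum: "?n = card ?E + card ?O"
    using card_Un_disjoint[of ?E ?O] arg_cong[OF un, of card] by fastforce
  have "a = (n + 1) div 2 \<and> b = n div 2"
    if "int a - int b = (if odd n then 1 else 0)" "n = a + b" for a b n :: nat
    using that by (auto split: if_splits)
  from this[OF diff' sum] show "card ?E = (?n + 1) div 2" "card ?O = ?n div 2" by blast+
qed

text \<open>The parity of the length decides which component of the 2-quotient is read off the sets with
  even index.\<close>

definition even_quotient :: "nat list \<Rightarrow> nat list" where
  "even_quotient l = quotient_part (if even (length l) then even else odd) l"

definition odd_quotient :: "nat list \<Rightarrow> nat list" where
  "odd_quotient l = quotient_part (if even (length l) then odd else even) l"

text \<open>The rows counted by \<open>diag_len_L_entry\<close> are split by the parity of their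
  entry. A threshold of the wrong parity may be moved by one without changing the count, after which
  each class is the count for one component. The balance of parities makes the \<open>min\<close>
  corrections of the components add up to that of \<open>l\<close>.\<close>

lemma diag_len_pavable:
  assumes l: "is_partition l" and "pavable l"
  shows "diag_len l (2 * k) = diag_len (even_quotient l) k + diag_len (odd_quotient l) k"
    "diag_len l (2 * k + 1) = diag_len (odd_quotient l) k + diag_len (even_quotient l) (k + 1)"
proof -
  let ?n = "length l"
  define E where "E t = card {y. y < ?n \<and> even (L_entry l y) \<and> t \<le> int (L_entry l y)}" for t
  define D where "D t = card {y. y < ?n \<and> odd (L_entry l y) \<and> t \<le> int (L_entry l y)}" for t
  have sum: "card {y. y < ?n \<and> t \<le> int (L_entry l y)} = E t + D t" for t
    unfolding E_def D_def
    by (subst card_Un_disjoint[symmetric]) (auto intro: arg_cong[where f=card])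
  have E_odd: "E (2 * t - 1) = E (2 * t)" for t
    unfolding E_def by (intro arg_cong[where f=card] Collect_cong) presburger
  have D_even: "D (2 * t) = D (2 * t + 1)" for t
    unfolding D_def by (intro arg_cong[where f=card] Collect_cong) presburger
  have lam: "diag_len l g + min ?n (nat (- g)) = E (int ?n + g) + D (int ?n + g)" for g
    using diag_len_L_entry[of l g] sum by simp
  have half_even: "c \<le> int (a div 2) \<longleftrightarrow> 2 * c \<le> int a" if "even a" for a c
    using that by (auto elim!: evenE)
  have half_odd: "c \<le> int (a div 2) \<longleftrightarrow> 2 * c + 1 \<le> int a" if "odd a" for a c
    using that by (auto elim!: oddE)
  have mu: "diag_len (quotient_part even l) g + min ((?n + 1) div 2) (nat (- g)) = E (2 * (int ((?n + 1) div 2) + g))" for g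
    using diag_len_quotient_part[OF l, of even g] unfolding pavable_balanced[OF assms(2)] E_def
    by (simp add: half_even cong: conj_cong)
  have nu: "diag_len (quotient_part odd l) g + min (?n div 2) (nat (- g)) = D (2 * (int (?n div 2) + g) + 1)" for g
    using diag_len_quotient_part[OF l, of odd g] unfolding pavable_balanced[OF assms(2)] D_def
    by (simp add: half_odd cong: conj_cong)
  \<comment> \<open>One offset expresses all four corrections; truncated subtraction covers
    non-negative \<open>k\<close>, where all of them are 0.\<close>
  obtain s where s: "nat (- k) = s" "nat (- (2 * k)) = 2 * s" "nat (- (2 * k + 1)) = 2 * s - 1" "nat (- (k + 1)) = s - 1"
    by auto
  note lam1 = lam[of "2 * k", unfolded s] and lam2 = lam[of "2 * k + 1", unfolded s]
  note mu1 = mu[of k, unfolded s] and mu2 = mu[of "k + 1", unfolded s]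
  note nu1 = nu[of k, unfolded s] and nu2 = nu[of "k + 1", unfolded s]
  have "diag_len l (2 * k) = diag_len (even_quotient l) k + diag_len (odd_quotient l) k \<and>
    diag_len l (2 * k + 1) = diag_len (odd_quotient l) k + diag_len (even_quotient l) (k + 1)"
  proof (cases "even ?n")
    case True
    then obtain c where c: "?n = 2 * c" by auto
    have e: "even_quotient l = quotient_part even l" "odd_quotient l = quotient_part odd l"
      using True by (simp_all add: even_quotient_def odd_quotient_def)
    have "int (2 * c) + 2 * k = 2 * (int c + k)" "int (2 * c) + (2 * k + 1) = 2 * (int c + k) + 1"
      "2 * (int c + k) + 1 = 2 * (int c + (k + 1)) - 1" by auto
    then have eqs: "D (int ?n + 2 * k) = D (2 * (int c + k) + 1)" "E (int ?n + 2 * k) = E (2 * (int c + k))"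
      "D (int ?n + (2 * k + 1)) = D (2 * (int c + k) + 1)" "E (int ?n + (2 * k + 1)) = E (2 * (int c + (k + 1)))"
      unfolding c using D_even[of "int c + k"] E_odd[of "int c + (k + 1)"] by metis+
    have div: "(?n + 1) div 2 = c" "?n div 2 = c" using c by auto
    have mins: "min ?n (2 * s) = min c s + min c s" "min ?n (2 * s - 1) = min c s + min c (s - 1)"
      using c by auto
    show ?thesis using lam1 lam2 mu1 mu2 nu1 unfolding e eqs div mins by linarith
  next
    case False
    then obtain c where c: "?n = 2 * c + 1" by (auto elim: oddE)
    have e: "even_quotient l = quotient_part odd l" "odd_quotient l = quotient_part even l"
      using False by (simp_all add: even_quotient_def odd_quotient_def)
    have "int (2 * c + 1) + 2 * k = 2 * (int c + k) + 1" "int (2 * c + 1) + (2 * k + 1) = 2 * (int c + (k + 1))"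
      "2 * (int c + k) + 1 = 2 * (int c + (k + 1)) - 1" "int (c + 1) + k = int c + (k + 1)" by auto
    then have eqs: "E (int ?n + 2 * k) = E (2 * (int (c + 1) + k))" "D (int ?n + 2 * k) = D (2 * (int c + k) + 1)"
      "E (int ?n + (2 * k + 1)) = E (2 * (int (c + 1) + k))" "D (int ?n + (2 * k + 1)) = D (2 * (int c + (k + 1)) + 1)"
      unfolding c using D_even[of "int c + (k + 1)"] E_odd[of "int c + (k + 1)"] by metis+
    have div: "(?n + 1) div 2 = c + 1" "?n div 2 = c" using c by auto
    have mins: "min ?n (2 * s) = min (c + 1) s + min c s" "min ?n (2 * s - 1) = min (c + 1) s + min c (s - 1)"
      using c by auto
    show ?thesis using lam1 lam2 mu1 nu1 nu2 unfolding e eqs div mins by linarith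
  qed
  then show "diag_len l (2 * k) = diag_len (even_quotient l) k + diag_len (odd_quotient l) k"
    "diag_len l (2 * k + 1) = diag_len (odd_quotient l) k + diag_len (even_quotient l) (k + 1)" by auto
qed

text \<open>The thresholds encode strictness: equal labels on neighbouring diagonals are allowed in a row
  only if odd (unprimed) and in a column only if even (primed).\<close>

definition interlaced :: "nat set \<Rightarrow> nat set \<Rightarrow> bool" where
  "interlaced A B \<longleftrightarrow> (\<forall>i. below B (2 * i + 1) \<le> below A (2 * i) \<and> below A (2 * i + 2) \<le> below B (2 * i + 1) + 1)"

lemma interlacedD:
  assumes "interlaced A B"
  shows "below B (2 * i + 1) \<le> below A (2 * i)" "below A (2 * i + 2) \<le> below B (2 * i + 1) + 1"
  using assms by (auto simp: interlaced_def)

text \<open>Every \<open>m\<close> is at or next to a threshold of the right parity, and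
  \<open>below\<close> is monotone. This version forgets the strictness and holds at every
  bound.\<close>

lemma interlaced_below:
  assumes "interlaced A B" "finite A" "finite B"
  shows "below B m \<le> below A m" "below A m \<le> below B m + 1"
proof -
  obtain i where "m = 2 * i \<or> m = 2 * i + 1" by (metis evenE oddE)
  then have "below B m \<le> below B (2 * i + 1)" "below A (2 * i) \<le> below A m"
    using assms(2,3) by (auto intro!: below_mono)
  then show "below B m \<le> below A m" using interlacedD(1)[OF assms(1), of i] by linarith
  obtain j where "m = 2 * j + 1 \<or> m = 2 * j + 2 \<or> m = 0"
    by (metis Suc_1 Suc_eq_plus1 add_Suc_right evenE not0_implies_Suc oddE)
  then show "below A m \<le> below B m + 1"
  proof (elim disjE)
    assume "m = 0"
    then show ?thesis by (simp add: below_def)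
  next
    assume m: "m = 2 * j + 1"
    then have "below A m \<le> below A (2 * j + 2)" using assms(2) by (auto intro!: below_mono)
    then show ?thesis using m interlacedD(2)[OF assms(1), of j] by simp
  next
    assume m: "m = 2 * j + 2"
    then have "below B (2 * j + 1) \<le> below B m" using assms(3) by (auto intro!: below_mono)
    then show ?thesis using m interlacedD(2)[OF assms(1), of j] by simp
  qed
qed

subsection \<open>Pavings from families of sets\<close>

text \<open>Every domino will have one cell on each of two neighbouring diagonals. Tiling then means
  that the two indexings \<open>hi\<close> and \<open>lo\<close> together hit each cell exactly
  once.\<close>

lemma paving_of_matching:
  assumes "inj_on hi I" "inj_on lo I" "hi ` I \<inter> lo ` I = {}" "hi ` I \<union> lo ` I = diagram l"
    and "\<And>i. i \<in> I \<Longrightarrow> is_domino {hi i, lo i}"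
  shows "is_paving l ((\<lambda>i. {hi i, lo i}) ` I)" "inj_on (\<lambda>i. {hi i, lo i}) I"
proof -
  have eq: "i = j" if ij: "i \<in> I" "j \<in> I" and meet: "{hi i, lo i} \<inter> {hi j, lo j} \<noteq> {}" for i j
  proof -
    have "hi i \<noteq> lo j" "hi j \<noteq> lo i" using ij assms(3) by (metis disjoint_iff imageI)+
    then have "hi i = hi j \<or> lo i = lo j" using meet by auto
    then show ?thesis using ij assms(1,2) by (meson inj_onD)
  qed
  then show "inj_on (\<lambda>i. {hi i, lo i}) I" by (intro inj_onI) blast
  show "is_paving l ((\<lambda>i. {hi i, lo i}) ` I)"
    unfolding is_paving_def
  proof (intro conjI ballI impI)
    show "\<Union> ((\<lambda>i. {hi i, lo i}) ` I) = diagram l" unfolding assms(4)[symmetric] by blast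
  qed (use eq assms(5) in blast)+
qed

text \<open>Negative indices serve only to tile the upper part; there a fixed tie-breaking rule is needed,
  which on the main diagonal agrees with the one above because all labels are odd.\<close>

definition extend :: "(nat \<Rightarrow> nat set) \<Rightarrow> int \<Rightarrow> nat set" where
  "extend V g = drop_least (nat ((1 - g) div 2)) (V (if 0 \<le> g then nat g else nat (g mod 2)))"

definition slot :: "int \<Rightarrow> int \<Rightarrow> nat \<Rightarrow> nat" where
  "slot g h r = (if 0 \<le> g then if h = g then keyP r else keyN r else 2 * r + nat (h mod 2))"

definition diag_keys :: "(nat \<Rightarrow> nat set) \<Rightarrow> int \<Rightarrow> nat set" where
  "diag_keys V g = slot g g ` extend V g \<union> slot g (g + 1) ` extend V (g + 1)"

definition pos :: "(nat \<Rightarrow> nat set) \<Rightarrow> int \<Rightarrow> int \<Rightarrow> nat \<Rightarrow> nat" where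
  "pos V g h r = below (diag_keys V g) (slot g h r)"

definition domino_of :: "(nat \<Rightarrow> nat set) \<Rightarrow> int \<times> nat \<Rightarrow> domino" where
  "domino_of V = (\<lambda>(g, r). {diag_cell g (pos V g g r), diag_cell (g - 1) (pos V (g - 1) g r)})"

lemma extend_of_nat [simp]: "extend V (int h) = V h"
proof -
  have "nat ((1 - int h) div 2) = 0" by simp
  then show ?thesis by (simp add: extend_def)
qed

lemma extend_0 [simp]: "extend V 0 = V 0" and extend_1 [simp]: "extend V 1 = V 1"
  using extend_of_nat[of V 0] extend_of_nat[of V 1] by simp_all

lemma strict_mono_slot: "strict_mono (slot g h)"
  using strict_mono_keyP strict_mono_keyN by (auto simp: slot_def strict_mono_def)

lemma slot_eq [simp]: "slot g h r = slot g h s \<longleftrightarrow> r = s"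
  using strict_mono_eq[OF strict_mono_slot] .

lemma slot_neq [simp]: "slot g g r \<noteq> slot g (g + 1) s"
proof (cases "0 \<le> g")
  case False
  have "g mod 2 = 0 \<and> (g + 1) mod 2 = 1 \<or> g mod 2 = 1 \<and> (g + 1) mod 2 = 0" by presburger
  then have "even (nat (g mod 2)) \<longleftrightarrow> odd (nat ((g + 1) mod 2))" by auto
  then have "even (2 * r + nat (g mod 2)) \<noteq> even (2 * s + nat ((g + 1) mod 2))" by simp
  then have "2 * r + nat (g mod 2) \<noteq> 2 * s + nat ((g + 1) mod 2)" by metis
  then show ?thesis using False by (simp add: slot_def)
qed (simp add: slot_def)

lemma diag_keys_of_nat: "diag_keys V (int h) = merged (V h) (V (Suc h))"
  using extend_of_nat[of V "Suc h"] by (simp add: diag_keys_def merged_def slot_def add.commute)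

text \<open>The last assumption ranges over negative \<open>g\<close> too: above the main diagonal
  the continued sets have to shrink exactly as the diagonals do.\<close>

locale domino_family =
  fixes l :: "nat list" and V :: "nat \<Rightarrow> nat set"
  assumes partition: "is_partition l"
    and finite_V [simp]: "finite (V h)"
    and odd_V: "r \<in> V 0 \<Longrightarrow> odd r" "r \<in> V 1 \<Longrightarrow> odd r"
    and interlaced_V: "interlaced (V h) (V (h + 2))"
    and diag_len_V: "diag_len l g = card (extend V g) + card (extend V (g + 1))"
begin

lemma finite_extend [simp]: "finite (extend V g)"
  by (simp add: extend_def)

lemma finite_diag_keys [simp]: "finite (diag_keys V g)"
  by (simp add: diag_keys_def)

lemma card_diag_keys: "card (diag_keys V g) = diag_len l g"
  unfolding diag_keys_def diag_len_V
  by (subst card_Un_disjoint) (auto simp: card_image inj_on_def)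

lemma below_diag_keys:
  assumes "\<And>s. slot g g s < m \<longleftrightarrow> s < n" "\<And>s. slot g (g + 1) s < m \<longleftrightarrow> s < n'"
  shows "below (diag_keys V g) m = below (extend V g) n + below (extend V (g + 1)) n'"
  unfolding diag_keys_def using assms
  by (subst below_Un) (auto simp: below_image_strict_mono[OF strict_mono_slot])

text \<open>Going up by two diagonals discards one more least element, so every count drops by one
  or stays 0.\<close>

lemma below_extend_pred:
  assumes "g \<le> 0"
  shows "below (extend V (g - 1)) t = below (extend V (g + 1)) t - 1"
proof -
  have n: "nat ((1 - (g - 1)) div 2) = nat ((1 - (g + 1)) div 2) + 1" using assms by auto
  have "(g - 1) mod 2 = (g + 1) mod 2" by presburger
  then have i: "nat ((g - 1) mod 2) = (if 0 \<le> g + 1 then nat (g + 1) else nat ((g + 1) mod 2))"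
    using assms by (cases "g = 0"; cases "g = - 1") simp_all
  have "\<not> 0 \<le> g - 1" using assms by simp
  then show ?thesis unfolding extend_def below_drop_least[OF finite_V] n by (simp only: i if_False diff_diff_left)
qed

text \<open>The set containing \<open>r\<close> contributes equally on both diagonals. The other two
  sets involved differ by one discarded least element, so the positions agree if nothing of the
  neighbouring set precedes \<open>r\<close> and differ by one otherwise.\<close>

lemma pos_upper:
  assumes "g \<le> 0" "r \<in> extend V g"
  obtains c where "c = below (extend V (g + 1)) (r + nat (g mod 2))"
    "pos V g g r = below (extend V g) r + c" "pos V (g - 1) g r = below (extend V g) r + (c - 1)"
proof
  have par: "g mod 2 = 0 \<and> (g + 1) mod 2 = 1 \<and> (g - 1) mod 2 = 1 \<or> g mod 2 = 1 \<and> (g + 1) mod 2 = 0 \<and> (g - 1) mod 2 = 0"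
    by presburger
  show "pos V g g r = below (extend V g) r + below (extend V (g + 1)) (r + nat (g mod 2))"
  proof (cases "g = 0")
    case True
    then have "odd r" using assms odd_V by auto
    then obtain i where i: "r = 2 * i + 1" by (metis oddE)
    show ?thesis unfolding pos_def using i True
      by (intro below_diag_keys) (auto simp: slot_def keyP_def keyN_def)
  next
    case False
    then show ?thesis unfolding pos_def using assms par
      by (intro below_diag_keys) (auto simp: slot_def)
  qed
  have "pos V (g - 1) g r = below (extend V (g - 1)) (r + nat (g mod 2)) + below (extend V (g - 1 + 1)) r"
    unfolding pos_def using assms par
    by (intro below_diag_keys) (auto simp: slot_def)
  then show "pos V (g - 1) g r = below (extend V g) r + (below (extend V (g + 1)) (r + nat (g mod 2)) - 1)"
    using below_extend_pred[OF assms(1)] by simp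
qed simp

text \<open>In the difference of the two positions the contributions of \<open>V (Suc h)\<close>
  cancel. What is left compares \<open>V h\<close> with \<open>V (Suc (Suc h))\<close>: one of the
  two bounds is an inequality of \<open>interlaced\<close> at its own threshold, the other follows
  from the weak form.\<close>

lemma pos_lower:
  assumes "r \<in> V (Suc h)"
  shows "pos V (int h) (int h + 1) r = pos V (int h + 1) (int h + 1) r \<or>
         pos V (int h) (int h + 1) r = pos V (int h + 1) (int h + 1) r + 1"
proof -
  have q: "pos V (int h) (int h + 1) r = below (merged (V h) (V (Suc h))) (keyN r)"
    by (simp add: pos_def diag_keys_of_nat slot_def)
  have p: "pos V (int h + 1) (int h + 1) r = below (merged (V (Suc h)) (V (Suc (Suc h)))) (keyP r)"
    using diag_keys_of_nat[of V "Suc h"] by (simp add: pos_def slot_def add.commute)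
  have I: "interlaced (V h) (V (Suc (Suc h)))" using interlaced_V[of h] by simp
  note I1 = interlacedD[OF I] and I2 = interlaced_below[OF I finite_V finite_V]
  obtain i where "r = 2 * i \<or> r = 2 * i + 1" by (metis evenE oddE)
  then show ?thesis
  proof
    assume r: "r = 2 * i"
    have "below (V (Suc (Suc h))) (2 * i) \<le> below (V (Suc (Suc h))) (2 * i + 1)" by (simp add: below_mono)
    then show ?thesis unfolding p q unfolding r below_merged_keyN_even[OF finite_V finite_V] below_merged_keyP_even[OF finite_V finite_V]
      using I1[of i] I2[of "2 * i"] by linarith
  next
    assume r: "r = 2 * i + 1"
    have "below (V (Suc (Suc h))) (2 * i + 1) \<le> below (V (Suc (Suc h))) (2 * i + 2)" by (simp add: below_mono)
    then show ?thesis unfolding p q unfolding r below_merged_keyN_odd[OF finite_V finite_V] below_merged_keyP_odd[OF finite_V finite_V]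
      using I1[of i] I2[of "2 * i + 2"] by linarith
  qed
qed

text \<open>Geometric reading of \<open>pos_upper\<close>: with both diagonals at or above the main
  one, equal positions stack the two cells and a shift by one puts them side by side.\<close>

lemma domino_of_upper:
  assumes "g \<le> 0" "r \<in> extend V g"
  shows "\<exists>p. if below (extend V (g + 1)) (r + nat (g mod 2)) = 0
    then domino_of V (g, r) = {(p, p + nat (- g)), (p, Suc (p + nat (- g)))} \<and> pos V g g r = p
    else domino_of V (g, r) = {(p, Suc (p + nat (- g))), (Suc p, Suc (p + nat (- g)))} \<and> pos V g g r = Suc p"
proof -
  obtain c where c: "c = below (extend V (g + 1)) (r + nat (g mod 2))"
    and p: "pos V g g r = below (extend V g) r + c" "pos V (g - 1) g r = below (extend V g) r + (c - 1)"
    using pos_upper[OF assms] .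
  have n: "nat (1 - g) = Suc (nat (- g))" using assms(1) by auto
  show ?thesis
  proof (cases "c = 0")
    case True
    then show ?thesis using assms(1) p n unfolding c[symmetric]
      by (intro exI[of _ "below (extend V g) r"]) (simp add: domino_of_def diag_cell_def)
  next
    case False
    then obtain c' where "c = Suc c'" using not0_implies_Suc by auto
    then show ?thesis using assms(1) p n unfolding c[symmetric]
      by (intro exI[of _ "below (extend V g) r + c'"]) (simp add: domino_of_def diag_cell_def insert_commute)
  qed
qed

text \<open>With both diagonals at or below the main one the reading is reversed: equal positions
  put the cells side by side, a shift by one stacks them.\<close>

lemma domino_of_lower:
  assumes "r \<in> V (Suc h)"
  obtains p where "domino_of V (int (Suc h), r) = {(p + h, p), (Suc (p + h), p)}" "pos V (int (Suc h)) (int (Suc h)) r = p"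
  | p where "domino_of V (int (Suc h), r) = {(Suc (p + h), p), (Suc (p + h), Suc p)}" "pos V (int (Suc h)) (int (Suc h)) r = p"
proof -
  let ?p = "pos V (int (Suc h)) (int (Suc h)) r"
  have "nat (1 + int h) = Suc h" by simp
  then have "domino_of V (int (Suc h), r) = {(?p + h, ?p), (Suc (?p + h), ?p)} \<or>
    domino_of V (int (Suc h), r) = {(Suc (?p + h), ?p), (Suc (?p + h), Suc ?p)}"
    using pos_lower[OF assms] by (auto simp: domino_of_def diag_cell_def add.commute[of 1])
  then show thesis using that by blast
qed

lemma is_domino_domino_of:
  assumes "r \<in> extend V g"
  shows "is_domino (domino_of V (g, r))"
proof (cases "g \<le> 0")
  case True
  then show ?thesis using domino_of_upper[OF True assms]
    by (auto simp: is_domino_def horizontal_def vertical_def split: if_splits)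
next
  case False
  then obtain h where h: "g = int (Suc h)" by (metis gr0_conv_Suc not_le zero_less_imp_eq_int)
  then have "r \<in> V (Suc h)" using assms by (simp only: extend_of_nat)
  then show ?thesis unfolding h by (rule domino_of_lower) (auto simp: is_domino_def horizontal_def vertical_def)
qed

definition indices :: "(int \<times> nat) set" where
  "indices = {(g, r). r \<in> extend V g}"

text \<open>The slots of \<open>extend V g\<close> and \<open>extend V (g + 1)\<close> on diagonal
  \<open>g\<close> are distinct, and their ranks run through all positions. So each cell is used
  once, as the \<open>hi\<close> cell of the former or the \<open>lo\<close> cell of the
  latter.\<close>

lemma paving_domino_of:
  shows "is_paving l (domino_of V ` indices)" and "inj_on (domino_of V) indices"
proof -
  define hi where "hi = (\<lambda>(g, r). diag_cell g (pos V g g r))"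
  define lo where "lo = (\<lambda>(g, r). diag_cell (g - 1) (pos V (g - 1) g r))"
  have inj: "below (diag_keys V g) m = below (diag_keys V g) n \<longleftrightarrow> m = n"
    if "m \<in> diag_keys V g" "n \<in> diag_keys V g" for g m n
    using inj_on_eq_iff[OF below_inj[OF finite_diag_keys]] that by auto
  have mem: "slot g g r \<in> diag_keys V g" "slot (g - 1) g r \<in> diag_keys V (g - 1)" if "r \<in> extend V g" for g r
    using that by (auto simp: diag_keys_def)
  have "inj_on hi indices" "inj_on lo indices"
    using inj mem by (auto simp: hi_def lo_def inj_on_def pos_def indices_def)
  moreover have "hi ` indices \<inter> lo ` indices = {}"
  proof -
    have False if "r \<in> extend V (g - 1)" "s \<in> extend V g" "pos V (g - 1) (g - 1) r = pos V (g - 1) g s" for g r s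
      using slot_neq[of "g - 1" r s] inj[OF mem(1)[OF that(1)] mem(2)[OF that(2)]] that(3) by (simp add: pos_def)
    then show ?thesis by (fastforce simp: hi_def lo_def indices_def)
  qed
  moreover have "hi ` indices \<union> lo ` indices = diagram l"
  proof (intro equalityI subsetI)
    fix c assume "c \<in> hi ` indices \<union> lo ` indices"
    then show "c \<in> diagram l"
      using mem below_less_card[OF finite_diag_keys]
      by (auto simp: hi_def lo_def indices_def diag_cell_in_diagram[OF partition] pos_def card_diag_keys[symmetric])
  next
    fix c assume c: "c \<in> diagram l"
    obtain g p where gp: "c = diag_cell g p" by (metis cell_eq_diag_cell surj_pair)
    then have "p < card (diag_keys V g)" using c by (simp add: diag_cell_in_diagram[OF partition] card_diag_keys)
    then obtain m where m: "m \<in> diag_keys V g" "below (diag_keys V g) m = p" using below_obtain[OF finite_diag_keys] by blast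
    then consider r where "m = slot g g r" "r \<in> extend V g" | r where "m = slot g (g + 1) r" "r \<in> extend V (g + 1)"
      by (auto simp: diag_keys_def)
    then show "c \<in> hi ` indices \<union> lo ` indices"
    proof cases
      case 1
      then show ?thesis using m gp by (intro UnI1 image_eqI[of _ _ "(g, r)"]) (auto simp: hi_def indices_def pos_def)
    next
      case 2
      then show ?thesis using m gp by (intro UnI2 image_eqI[of _ _ "(g + 1, r)"]) (auto simp: lo_def indices_def pos_def)
    qed
  qed
  moreover have eq: "domino_of V = (\<lambda>i. {hi i, lo i})"
    by (auto simp: domino_of_def hi_def lo_def)
  moreover have "is_domino {hi i, lo i}" if "i \<in> indices" for i
    using that is_domino_domino_of[of "snd i" "fst i"] by (auto simp: indices_def eq)
  ultimately show "is_paving l (domino_of V ` indices)" "inj_on (domino_of V) indices"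
    using paving_of_matching[of hi indices lo l] by auto
qed

end

section \<open>Letters as natural numbers\<close>

definition letter_of :: "nat \<Rightarrow> letter" where
  "letter_of r = (if even r then Primed (r div 2) else Unprimed (r div 2))"

lemma letter_rank_letter_of [simp]: "letter_rank (letter_of r) = r"
  by (auto simp: letter_of_def)

lemma letter_of_letter_rank [simp]: "letter_of (letter_rank a) = a"
  by (cases a) (auto simp: letter_of_def)

lemma letter_of_eq [simp]: "letter_of r = letter_of s \<longleftrightarrow> r = s"
  by (metis letter_rank_letter_of)

lemma letter_of_le [simp]: "letter_of r \<le> letter_of s \<longleftrightarrow> r \<le> s"
  by (simp add: less_eq_letter_def)

lemma letter_index_letter_of [simp]: "letter_index (letter_of r) = r div 2"
  by (simp add: letter_of_def)

lemma letter_cases: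
  obtains r where "a = letter_of r"
  using letter_of_letter_rank by metis

lemma Primed_eq: "Primed i = letter_of (2 * i)" and Unprimed_eq: "Unprimed i = letter_of (2 * i + 1)"
  by (auto simp: letter_of_def)

lemma left_adjacentI:
  "e \<in> P \<Longrightarrow> e \<noteq> d \<Longrightarrow> (x, y) \<in> e \<Longrightarrow> (Suc x, y) \<in> d \<Longrightarrow> e \<in> left_adjacent P d"
  unfolding left_adjacent_def by blast

context domino_family
begin

lemma domino_of_eqD:
  assumes "i \<in> indices" "j \<in> indices" "c \<in> domino_of V i" "c \<in> domino_of V j"
  shows "i = j"
proof -
  have "domino_of V i = domino_of V j"
    using paving_domino_of(1) assms unfolding is_paving_def by blast
  then show ?thesis using paving_domino_of(2) assms(1,2) by (auto dest: inj_onD)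
qed

lemma of_nat_indices [simp]: "(int h, r) \<in> indices \<longleftrightarrow> r \<in> V h"
  by (simp add: indices_def)

lemma zero_indices [simp]: "(0, r) \<in> indices \<longleftrightarrow> r \<in> V 0"
  by (simp add: indices_def)

lemma diag_index_domino_of:
  "diag_index ` domino_of V (g, r) = {- g, 1 - g}"
  by (auto simp: domino_of_def)

section \<open>Row and column conditions for the tableau of a family\<close>

definition width :: "nat \<Rightarrow> nat \<Rightarrow> nat" where
  "width g m = below (V g) m + below (V (Suc g)) m"

lemma width_mono: "m \<le> n \<Longrightarrow> width g m \<le> width g n"
  unfolding width_def by (intro add_mono below_mono) auto

lemma interlaced_V':
  "below (V (Suc (Suc g))) (2 * i + 1) \<le> below (V g) (2 * i)"
  "below (V g) (2 * i + 2) \<le> below (V (Suc (Suc g))) (2 * i + 1) + 1"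
  "below (V (Suc (Suc g))) m \<le> below (V g) m"
  "below (V g) m \<le> below (V (Suc (Suc g))) m + 1"
  using interlacedD[OF interlaced_V[of g]] interlaced_below[OF interlaced_V[of g] finite_V finite_V] by simp_all

text \<open>\<open>width g\<close> and \<open>width (Suc g)\<close> share the set
  \<open>V (Suc g)\<close>, so each step compares \<open>V g\<close> with
  \<open>V (Suc (Suc g))\<close> only and costs at most one.\<close>

lemma width_add: "width (g + d) m \<le> width g m" "width g m \<le> width (g + d) m + d"
proof (induction d)
  case (Suc d)
  { case 1 show ?case using Suc(1) interlaced_V'(3)[of "g + d" m] by (simp add: width_def)
  next
    case 2 show ?case using Suc(2) interlaced_V'(4)[of "g + d" m] by (simp add: width_def) }
qed auto

lemma lower_cell:
  assumes "r \<in> V h" "(x, y) \<in> domino_of V (int h, r)" "y \<le> x"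
  shows "x - y = h \<and> y = below (merged (V (x - y)) (V (Suc (x - y)))) (keyP r) \<or>
         Suc (x - y) = h \<and> y = below (merged (V (x - y)) (V (Suc (x - y)))) (keyN r)"
proof -
  let ?g = "x - y"
  have c: "(x, y) = diag_cell (int ?g) y" using assms(3) by (auto simp: diag_cell_def)
  have "int ?g = int h \<and> y = pos V (int h) (int h) r \<or> int ?g = int h - 1 \<and> y = pos V (int h - 1) (int h) r"
    using assms(2) unfolding c by (auto simp: domino_of_def)
  then show ?thesis
  proof
    assume *: "int ?g = int h \<and> y = pos V (int h) (int h) r"
    have "y = pos V (int h) (int h) r" using * by blast
    also have "\<dots> = below (merged (V h) (V (Suc h))) (keyP r)"
      by (simp add: pos_def diag_keys_of_nat slot_def)
    finally have "y = below (merged (V h) (V (Suc h))) (keyP r)" .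
    moreover have "x - y = h" using conjunct1[OF *] by simp
    ultimately show ?thesis by metis
  next
    assume *: "int ?g = int h - 1 \<and> y = pos V (int h - 1) (int h) r"
    then have "int h - 1 = int ?g" "Suc ?g = h" by auto
    moreover have "y = below (merged (V ?g) (V (Suc ?g))) (keyN r)"
      using * calculation by (simp add: pos_def diag_keys_of_nat slot_def)
    ultimately show ?thesis by metis
  qed
qed

text \<open>Both keys of \<open>r\<close> are among \<open>2 * r\<close> and
  \<open>2 * r + 1\<close>, so the cell lies in the run of cells of its diagonal that carry
  \<open>r\<close>.\<close>

lemma lower_cell_width:
  assumes "r \<in> V h" "(x, y) \<in> domino_of V (int h, r)" "y \<le> x"
  shows "width (x - y) r \<le> y" "y < width (x - y) (Suc r)"
proof -
  let ?S = "merged (V (x - y)) (V (Suc (x - y)))"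
  obtain k where k: "k \<in> ?S" "k = keyP r \<or> k = keyN r" "y = below ?S k"
    using lower_cell[OF assms] assms(1) by (metis keyN_in_merged keyP_in_merged)
  have "2 * r \<le> k" "k < 2 * Suc r" using k(2) by (auto simp: keyP_def keyN_def)
  then have "below ?S (2 * r) \<le> below ?S k" "below ?S k < below ?S (2 * Suc r)"
    using k(1) by (auto intro: below_mono below_less)
  then have "below ?S (2 * r) \<le> y" "y < below ?S (2 * Suc r)"
    by (simp_all only: k(3)[symmetric])
  then show "width (x - y) r \<le> y" "y < width (x - y) (Suc r)"
    unfolding width_def by (simp_all only: below_merged_double[OF finite_V finite_V])
qed

text \<open>The label \<open>r\<close> occurs at most twice on a diagonal, once from each set, and
  the tie rule orders the two occurrences. A cell at a suitable end of the run can therefore be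
  traced to its set.\<close>

lemma lower_cell_type:
  assumes "r \<in> V h" "(x, y) \<in> domino_of V (int h, r)" "y \<le> x"
  shows "even r \<Longrightarrow> r \<in> V (Suc (x - y)) \<Longrightarrow> width (x - y) r = y \<Longrightarrow> h = Suc (x - y)"
    and "even r \<Longrightarrow> r \<in> V (x - y) \<Longrightarrow> width (x - y) (Suc r) = Suc y \<Longrightarrow> h = x - y"
    and "odd r \<Longrightarrow> r \<in> V (x - y) \<Longrightarrow> width (x - y) r = y \<Longrightarrow> h = x - y"
    and "odd r \<Longrightarrow> r \<in> V (Suc (x - y)) \<Longrightarrow> width (x - y) (Suc r) = Suc y \<Longrightarrow> h = Suc (x - y)"
  using lower_cell[OF assms] assms(1) below_Suc[OF finite_V, of "x - y" r] below_Suc[OF finite_V, of "Suc (x - y)" r]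
  by (auto simp: width_def below_merged_keyP_even below_merged_keyN_even elim!: evenE)
    (auto simp: width_def below_merged_keyP_odd[simplified] below_merged_keyN_odd[simplified] elim!: oddE)

text \<open>If \<open>s\<close> were smaller, the farther diagonal would have more labels up to
  \<open>s\<close> than the nearer one. For equal even labels the sharp thresholds of
  \<open>interlaced\<close> leave no room for two or more diagonals in between; on neighbouring
  diagonals they force \<open>r\<close> into the common set, with the left cell first and the right
  cell last in its run, so both come from that set.\<close>

lemma lower_row:
  assumes d: "r \<in> V h" "(x, y) \<in> domino_of V (int h, r)" "y \<le> x"
    and e: "s \<in> V h'" "(x', y) \<in> domino_of V (int h', s)" "x < x'"
  shows "r \<le> s" "r = s \<Longrightarrow> even r \<Longrightarrow> h = h'"
proof -
  let ?g = "x - y"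
  obtain b where b: "x' - y = ?g + Suc b" using d(3) e(3) by (metis add_Suc_right diff_add_assoc2 less_iff_Suc_add)
  have y: "y \<le> x'" using d(3) e(3) by simp
  note wd = lower_cell_width[OF d] and we = lower_cell_width[OF e(1,2) y, unfolded b]
  show "r \<le> s"
  proof (rule ccontr)
    assume "\<not> r \<le> s"
    then have "width ?g (Suc s) \<le> width ?g r" by (intro width_mono) simp
    then show False using wd we width_add(1)[of ?g "Suc b" "Suc s"] by linarith
  qed
  assume rs: "r = s" "even r"
  then obtain i where i: "r = 2 * i" by (elim evenE)
  note we = we[folded rs(1)]
  have w1: "width (Suc ?g) (Suc r) \<le> width ?g r + (if r \<in> V (Suc ?g) then 1 else 0)"
    unfolding width_def using below_Suc[OF finite_V, of "Suc ?g" r] interlaced_V'(1)[of ?g i] i by simp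
  have w2: "width (Suc (Suc ?g)) (Suc r) \<le> width ?g r"
    unfolding width_def using interlaced_V'(1)[of ?g i] interlaced_V'(1)[of "Suc ?g" i] i by simp
  have w3: "width (?g + Suc b) (Suc r) \<le> width (Suc ?g) (Suc r)"
    using width_add(1)[of "Suc ?g" b "Suc r"] by simp
  have b0: "b = 0"
  proof (rule ccontr)
    assume "b \<noteq> 0"
    then obtain b' where "b = Suc b'" using not0_implies_Suc by auto
    then have "width (?g + Suc b) (Suc r) \<le> width (Suc (Suc ?g)) (Suc r)"
      using width_add(1)[of "Suc (Suc ?g)" b' "Suc r"] by simp
    then show False using w2 wd we by linarith
  qed
  have in_V: "r \<in> V (Suc ?g)" using w1 w3 wd we rs by (auto split: if_splits)
  then have "width ?g r = y" "width (x' - y) (Suc r) = Suc y" using w1 w3 wd we rs b b0 by auto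
  then show "h = h'"
    using lower_cell_type(1)[OF d] lower_cell_type(2)[OF e(1,2) y] in_V rs b b0 by auto
qed

text \<open>The argument for rows with odd instead of even labels. Going up a column approaches the
  main diagonal while the position grows by one per step, which the second bound of
  \<open>width_add\<close> absorbs.\<close>

lemma lower_column:
  assumes d: "r \<in> V h" "(x, y) \<in> domino_of V (int h, r)" "y < y'"
    and e: "s \<in> V h'" "(x, y') \<in> domino_of V (int h', s)" "y' \<le> x"
  shows "r \<le> s" "r = s \<Longrightarrow> odd r \<Longrightarrow> h = h'"
proof -
  let ?g = "x - y'"
  obtain b where b: "y' = y + Suc b" using d(3) by (metis add_Suc_right less_iff_Suc_add)
  have g: "x - y = ?g + Suc b" using b e(3) by simp
  have y: "y \<le> x" using d(3) e(3) by simp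
  note wd = lower_cell_width[OF d(1,2) y, unfolded g] and we = lower_cell_width[OF e]
  show "r \<le> s"
  proof (rule ccontr)
    assume "\<not> r \<le> s"
    then have "width (?g + Suc b) (Suc s) \<le> width (?g + Suc b) r" by (intro width_mono) simp
    then show False using wd we width_add(2)[of ?g "Suc s" "Suc b"] b by linarith
  qed
  assume rs: "r = s" "odd r"
  then obtain i where i: "r = 2 * i + 1" by (elim oddE)
  note we = we[folded rs(1)]
  have w1: "width ?g (Suc r) \<le> width (Suc ?g) r + 1 + (if r \<in> V (Suc ?g) then 1 else 0)"
    unfolding width_def using below_Suc[OF finite_V, of "Suc ?g" r] interlaced_V'(2)[of ?g i] i by simp
  have w2: "width ?g (Suc r) \<le> width (Suc (Suc ?g)) r + 2"
    unfolding width_def using interlaced_V'(2)[of ?g i] interlaced_V'(2)[of "Suc ?g" i] i by simp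
  have w3: "width (Suc ?g) r \<le> width (?g + Suc b) r + b"
    using width_add(2)[of "Suc ?g" r b] by simp
  have b0: "b = 0"
  proof (rule ccontr)
    assume "b \<noteq> 0"
    then obtain b' where b': "b = Suc b'" using not0_implies_Suc by auto
    then have "width (Suc (Suc ?g)) r \<le> width (?g + Suc b) r + b'"
      using width_add(2)[of "Suc (Suc ?g)" r b'] by simp
    then show False using w2 wd we b b' by linarith
  qed
  have in_V: "r \<in> V (Suc ?g)" using w1 w3 wd we rs b by (auto split: if_splits)
  then have "width (x - y) r = y" "width ?g (Suc r) = Suc y'" using w1 w3 wd we rs b b0 g by auto
  then show "h = h'"
    using lower_cell_type(3)[OF d(1,2) y] lower_cell_type(4)[OF e] in_V rs g b0 by auto
qed

lemma domino_of_0: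
  assumes "r \<in> V 0"
  obtains p where "below (V 1) r = 0" "domino_of V (0, r) = {(p, p), (p, Suc p)}" "pos V 0 0 r = p"
  | p where "below (V 1) r \<noteq> 0" "domino_of V (0, r) = {(p, Suc p), (Suc p, Suc p)}" "pos V 0 0 r = Suc p"
  using domino_of_upper[of 0 r] assms by (auto split: if_splits)

text \<open>A labelled domino reaches above the main diagonal only if its index is 0. Its other cell
  is then on the main diagonal, directly below or to the right, and can stand in for the upper
  one.\<close>

lemma upper_cell:
  assumes "r \<in> V h" "(x, y) \<in> domino_of V (int h, r)" "x < y"
  shows "h = 0" "y = Suc x" "odd r" "(x, x) \<in> domino_of V (0, r) \<or> (y, y) \<in> domino_of V (0, r)"
proof -
  have "diag_index (x, y) \<in> {- int h, 1 - int h}"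
    using imageI[OF assms(2), of diag_index] by (simp only: diag_index_domino_of)
  then show "h = 0" "y = Suc x" using assms(3) by (auto simp: diag_index_def)
  then show "odd r" "(x, x) \<in> domino_of V (0, r) \<or> (y, y) \<in> domino_of V (0, r)"
    using assms odd_V domino_of_0[of r] by (auto split: if_splits elim!: domino_of_0)
qed

text \<open>Only the left cell can lie above the main diagonal. Its label is then odd, and the
  second claim is void.\<close>

lemma row:
  assumes d: "r \<in> V h" "(x, y) \<in> domino_of V (int h, r)"
    and e: "s \<in> V h'" "(x', y) \<in> domino_of V (int h', s)" and "x < x'"
  shows "r \<le> s" "r = s \<Longrightarrow> even r \<Longrightarrow> h = h'"
proof -
  have "r \<le> s \<and> (r = s \<longrightarrow> even r \<longrightarrow> h = h')"
  proof (cases "y \<le> x")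
    case True
    then show ?thesis using lower_row[OF d True e \<open>x < x'\<close>] by blast
  next
    case False
    then have "x < y" by simp
    note up = upper_cell[OF d this]
    have y: "y \<le> x'" using up \<open>x < x'\<close> by simp
    have "r \<le> s"
      using up(4)
    proof
      \<comment> \<open>The main-diagonal cell of a vertical domino is one row too low for
        \<open>lower_row\<close>; the widths are compared directly.\<close>
      assume xx: "(x, x) \<in> domino_of V (0, r)"
      show ?thesis
      proof (rule ccontr)
        assume "\<not> r \<le> s"
        then have "width 0 (Suc s) \<le> width 0 r" by (intro width_mono) simp
        moreover have "width 0 r \<le> x" using lower_cell_width(1)[of r 0 x x] d up xx by simp
        moreover have "y < width 0 (Suc s)"
          using lower_cell_width(2)[OF e y] width_add(1)[of 0 "x' - y" "Suc s"] by simp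
        ultimately show False using up by simp
      qed
    next
      assume yy: "(y, y) \<in> domino_of V (0, r)"
      show ?thesis
      proof (cases "x' = y")
        case True
        then have "(int 0, r) = (int h', s)" using e yy up d by (intro domino_of_eqD[of _ _ "(y, y)"]) auto
        then show ?thesis by simp
      next
        case False
        then show ?thesis using lower_row(1)[of r 0 y y s h' x'] d e y yy up by simp
      qed
    qed
    then show ?thesis using up(3) by auto
  qed
  then show "r \<le> s" "r = s \<Longrightarrow> even r \<Longrightarrow> h = h'" by auto
qed

text \<open>Only the upper cell can lie above the main diagonal.\<close>

lemma column:
  assumes d: "r \<in> V h" "(x, y) \<in> domino_of V (int h, r)"
    and e: "s \<in> V h'" "(x, y') \<in> domino_of V (int h', s)" and "y < y'"
  shows "r \<le> s" "r = s \<Longrightarrow> odd r \<Longrightarrow> h = h'"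
proof -
  have "r \<le> s \<and> (r = s \<longrightarrow> odd r \<longrightarrow> h = h')"
  proof (cases "y' \<le> x")
    case True
    then show ?thesis using lower_column[OF d \<open>y < y'\<close> e True] by blast
  next
    case False
    then have "x < y'" by simp
    note up = upper_cell[OF e this]
    have y: "y \<le> x" using up \<open>y < y'\<close> by simp
    show ?thesis
      using up(4)
    proof
      assume xx: "(x, x) \<in> domino_of V (0, s)"
      show ?thesis
      proof (cases "y = x")
        case True
        then have "(int h, r) = (int 0, s)" using d e xx up by (intro domino_of_eqD[of _ _ "(x, x)"]) auto
        then show ?thesis using up by simp
      next
        case False
        then have "y < x" using y by simp
        moreover have "s \<in> V 0" "(x, x) \<in> domino_of V (int 0, s)" using e xx up by simp_all
        ultimately show ?thesis using lower_column[OF d, of x s 0] up(1) by blast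
      qed
    next
      \<comment> \<open>The main-diagonal cell of a horizontal domino is in the next column. Its odd
        label comes from \<open>V 0\<close> and precedes an equal one from \<open>V 1\<close>, so
        its position is exactly \<open>width 0 s\<close>; this gives the strict inequality between
        \<open>r\<close> and \<open>s\<close>.\<close>
      assume yy: "(y', y') \<in> domino_of V (0, s)"
      have s0: "s \<in> V 0" using e up by simp
      have "y' = width 0 s"
      proof -
        have "y' = below (merged (V 0) (V (Suc 0))) (keyP s)"
          using lower_cell[of s 0 y' y'] s0 yy by simp
        moreover obtain i where "s = 2 * i + 1" using up(3) by (elim oddE)
        ultimately show ?thesis unfolding width_def by (simp only: below_merged_keyP_odd[OF finite_V finite_V])
      qed
      then have "y' \<le> width (x - y) s + (x - y)" using width_add(2)[of 0 s "x - y"] by simp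
      moreover have "width (x - y) r \<le> y" using lower_cell_width(1)[OF d y] .
      ultimately have "\<not> s \<le> r" using width_mono[of s r "x - y"] up y by linarith
      then show ?thesis by simp
    qed
  qed
  then show "r \<le> s" "r = s \<Longrightarrow> odd r \<Longrightarrow> h = h'" by auto
qed

subsection \<open>The tableau of a family\<close>

definition full_tableau :: "domino \<rightharpoonup> symbol" where
  "full_tableau d = (if d \<in> domino_of V ` indices
     then Some (case inv_into indices (domino_of V) d of (g, r) \<Rightarrow> if 0 \<le> g then Letter (letter_of r) else X)
     else None)"

lemma dom_full_tableau: "dom full_tableau = domino_of V ` indices"
  by (auto simp: full_tableau_def dom_def)

lemma full_tableau_domino_of:
  "i \<in> indices \<Longrightarrow> full_tableau (domino_of V i) = Some (case i of (g, r) \<Rightarrow> if 0 \<le> g then Letter (letter_of r) else X)"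
  using paving_domino_of(2) by (simp add: full_tableau_def)

lemma full_tableau_Letter:
  "full_tableau d = Some (Letter (letter_of r)) \<longleftrightarrow> (\<exists>h. r \<in> V h \<and> d = domino_of V (int h, r))"
proof
  assume L: "full_tableau d = Some (Letter (letter_of r))"
  then have "d \<in> domino_of V ` indices" using dom_full_tableau by blast
  then obtain g s where gs: "(g, s) \<in> indices" "d = domino_of V (g, s)" by auto
  then have "0 \<le> g \<and> s = r" using L full_tableau_domino_of[OF gs(1)] by (simp split: if_splits)
  then have "0 \<le> g" "s = r" by blast+
  then obtain h where "g = int h" using nonneg_int_cases by blast
  then show "\<exists>h. r \<in> V h \<and> d = domino_of V (int h, r)" using gs \<open>s = r\<close> by auto
next
  assume "\<exists>h. r \<in> V h \<and> d = domino_of V (int h, r)"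
  then obtain h where "(int h, r) \<in> indices" "d = domino_of V (int h, r)" by auto
  then show "full_tableau d = Some (Letter (letter_of r))" using full_tableau_domino_of[of "(int h, r)"] by simp
qed

lemma on_diag_domino_of: "on_diag (domino_of V (g, r)) k \<longleftrightarrow> - g = 2 * k \<or> 1 - g = 2 * k"
  by (auto simp: on_diag_def domino_of_def)

text \<open>The domino has cells on the diagonals of index \<open>- g\<close> and
  \<open>1 - g\<close>, and the even one of these is positive exactly for negative \<open>g\<close>;
  for \<open>g = 0\<close> it is 0.\<close>

lemma domino_of_in_up': "(g, r) \<in> indices \<Longrightarrow> domino_of V (g, r) \<in> up' (domino_of V ` indices) \<longleftrightarrow> g < 0"
proof -
  assume "(g, r) \<in> indices"
  then have "domino_of V (g, r) \<in> up' (domino_of V ` indices) \<longleftrightarrow> (\<exists>k>0. - g = 2 * k \<or> 1 - g = 2 * k)"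
    by (auto simp: up'_def on_diag_domino_of)
  also have "\<dots> \<longleftrightarrow> g < 0" by presburger
  finally show ?thesis .
qed

lemma cell_in_domino_of:
  assumes "c \<in> diagram l"
  obtains g r where "(g, r) \<in> indices" "c \<in> domino_of V (g, r)"
proof -
  have "c \<in> \<Union> (domino_of V ` indices)" using assms paving_domino_of(1) by (simp add: is_paving_def)
  then obtain i where "i \<in> indices" "c \<in> domino_of V i" by blast
  then show thesis using that[of "fst i" "snd i"] by simp
qed

text \<open>For index 1 the cell to the left of the lower cell is on the main diagonal, hence in a
  labelled domino. For index 0, vertical means that no label of \<open>V 1\<close> is smaller; so
  the preceding main-diagonal cell belongs to \<open>V 0\<close> and its domino is vertical as well,
  labelled and adjacent on the left.\<close>

lemma shifted_paving: "is_shifted_paving l (domino_of V ` indices)"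
proof -
  let ?P = "domino_of V ` indices"
  have False if d: "d \<in> ?P" "vertical d" "on_diag d 0" and adj: "left_adjacent ?P d \<noteq> {}" "left_adjacent ?P d \<subseteq> up' ?P" for d
  proof -
    have in_l: "c \<in> diagram l" if "c \<in> d" for c
      using that d(1) paving_domino_of(1) by (auto simp: is_paving_def)
    obtain g r where gr: "(g, r) \<in> indices" "d = domino_of V (g, r)" using d(1) by auto
    have "g = 0 \<or> g = 1" using d(3) gr(2) by (auto simp: on_diag_domino_of)
    then show False
    proof
      assume g: "g = 1"
      then have "r \<in> V (Suc 0)" using gr by (simp add: indices_def)
      then obtain p where dp: "d = {(Suc p, p), (Suc p, Suc p)}"
        using d(2) gr(2) g by (auto elim!: domino_of_lower simp: vertical_def doubleton_eq_iff)
      then have "(p, p) \<in> diagram l" using diagram_closed[OF partition in_l[of "(Suc p, p)"]] by simp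
      then obtain g' s where gs: "(g', s) \<in> indices" "(p, p) \<in> domino_of V (g', s)" by (rule cell_in_domino_of)
      have "(p, p) \<notin> d" "(Suc p, p) \<in> d" using dp by simp_all
      then have "domino_of V (g', s) \<in> left_adjacent ?P d"
        using gs by (intro left_adjacentI[where e = "domino_of V (g', s)" and x = p and y = p]) blast+
      then have "g' < 0" using adj(2) domino_of_in_up'[OF gs(1)] by blast
      moreover have "diag_index (p, p) \<in> {- g', 1 - g'}"
        using imageI[OF gs(2), of diag_index] by (simp only: diag_index_domino_of)
      ultimately show False by (auto simp: diag_index_def)
    next
      assume g: "g = 0"
      then have r: "r \<in> V 0" using gr by (simp add: indices_def)
      then obtain p where dp: "below (V 1) r = 0" "d = {(p, p), (p, Suc p)}" "pos V 0 0 r = p"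
        using d(2) gr(2) g r by (auto elim!: domino_of_0 simp: vertical_def doubleton_eq_iff)
      have "\<exists>x y. (Suc x, y) \<in> d" using adj(1) unfolding left_adjacent_def by blast
      \<comment> \<open>A left neighbour exists, so the domino is not in the first column and there
        is a preceding cell on the main diagonal.\<close>
      then obtain p' where p': "p = Suc p'" unfolding dp(2) by auto
      have pr: "below (merged (V 0) (V 1)) (keyP r) = p"
        using dp(3) diag_keys_of_nat[of V 0] by (simp add: pos_def slot_def)
      then have "p < card (merged (V 0) (V 1))" using below_less_card[of "merged (V 0) (V 1)" "keyP r"] r by auto
      then obtain m where m: "m \<in> merged (V 0) (V 1)" "below (merged (V 0) (V 1)) m = p'"
        using below_obtain[of "merged (V 0) (V 1)" p'] p' by auto
      then have less: "m < keyP r" using below_less_iff[of "merged (V 0) (V 1)" m "keyP r"] pr p' by auto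
      have "m \<notin> keyN ` V 1"
      proof
        assume "m \<in> keyN ` V 1"
        then obtain s where s: "s \<in> V 1" "m = keyN s" by auto
        then have "s < r" using less odd_V(1)[OF r] odd_V(2)[OF s(1)] by (simp add: keyP_def keyN_def)
        then show False using below_less[OF finite_V s(1), of r] dp(1) by linarith
      qed
      then obtain s where s: "s \<in> V 0" "m = keyP s" using m(1) by (auto simp: merged_def)
      have "s < r" using less s strict_mono_less[OF strict_mono_keyP] by blast
      then have "below (V 1) s = 0" using below_mono[OF finite_V[of 1], of s r] dp(1) by simp
      moreover have "pos V 0 0 s = p'" using m s diag_keys_of_nat[of V 0] by (simp add: pos_def slot_def)
      ultimately have e: "domino_of V (0, s) = {(p', p'), (p', Suc p')}"
        by - (rule domino_of_0[OF s(1)]; simp)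
      have s0: "(0, s) \<in> indices" using s(1) by (simp add: indices_def)
      have "(p', p') \<in> domino_of V (0, s)" "(p', p) \<in> domino_of V (0, s)" "(p', p') \<notin> d" "(Suc p', p) \<in> d"
        unfolding e dp(2) p' by simp_all
      then have "domino_of V (0, s) \<in> left_adjacent ?P d"
        using s0 by (intro left_adjacentI[where e = "domino_of V (0, s)" and x = p' and y = p]) blast+
      then show False using adj(2) domino_of_in_up'[OF s0] by blast
    qed
  qed
  then show ?thesis using paving_domino_of(1) unfolding is_shifted_paving_def by blast
qed

lemma full_tableau_shifted_domino_tableau: "is_shifted_domino_tableau l full_tableau"
  unfolding is_shifted_domino_tableau_def
proof (intro conjI ballI allI impI; (elim conjE)?)
  show "is_shifted_paving l (dom full_tableau)" unfolding dom_full_tableau by (rule shifted_paving)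
next
  fix d assume "d \<in> up' (dom full_tableau)"
  then obtain g r where "(g, r) \<in> indices" "d = domino_of V (g, r)" "d \<in> up' (domino_of V ` indices)"
    unfolding dom_full_tableau by (auto simp: up'_def)
  then show "full_tableau d = Some X" using domino_of_in_up'[of g r] full_tableau_domino_of[of "(g, r)"] by simp
next
  fix d assume "d \<in> down' (dom full_tableau)"
  then obtain g r where "(g, r) \<in> indices" "d = domino_of V (g, r)" "d \<notin> up' (domino_of V ` indices)"
    unfolding dom_full_tableau by (auto simp: down'_def)
  then show "\<exists>a. full_tableau d = Some (Letter a)" using domino_of_in_up'[of g r] full_tableau_domino_of[of "(g, r)"] by simp
next
  fix d e a b x x' y
  assume "full_tableau d = Some (Letter a)" "full_tableau e = Some (Letter b)" "(x, y) \<in> d" "(x', y) \<in> e" "x < x'"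
  then show "a \<le> b" by (cases a rule: letter_cases; cases b rule: letter_cases) (auto simp: full_tableau_Letter intro: row)
next
  fix d e a b x y y'
  assume "full_tableau d = Some (Letter a)" "full_tableau e = Some (Letter b)" "(x, y) \<in> d" "(x, y') \<in> e" "y < y'"
  then show "a \<le> b" by (cases a rule: letter_cases; cases b rule: letter_cases) (auto simp: full_tableau_Letter intro: column)
next
  fix d e i x y y'
  assume *: "full_tableau d = Some (Letter (Unprimed i))" "full_tableau e = Some (Letter (Unprimed i))" "(x, y) \<in> d" "(x, y') \<in> e"
  then obtain h h' where h: "2 * i + 1 \<in> V h" "d = domino_of V (int h, 2 * i + 1)" "2 * i + 1 \<in> V h'" "e = domino_of V (int h', 2 * i + 1)"
    unfolding Unprimed_eq full_tableau_Letter by blast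
  have "(int h, 2 * i + 1) = (int h', 2 * i + 1)" if "y = y'"
    using * h that by (intro domino_of_eqD[of _ _ "(x, y)"]) auto
  then have "h = h'"
    using column(2)[of "2 * i + 1" h x y "2 * i + 1" h' y'] column(2)[of "2 * i + 1" h' x y' "2 * i + 1" h y] * h
    by (cases y y' rule: linorder_cases) auto
  then show "d = e" using h by simp
next
  fix d e i x x' y
  assume *: "full_tableau d = Some (Letter (Primed i))" "full_tableau e = Some (Letter (Primed i))" "(x, y) \<in> d" "(x', y) \<in> e"
  then obtain h h' where h: "2 * i \<in> V h" "d = domino_of V (int h, 2 * i)" "2 * i \<in> V h'" "e = domino_of V (int h', 2 * i)"
    unfolding Primed_eq full_tableau_Letter by blast
  have "(int h, 2 * i) = (int h', 2 * i)" if "x = x'"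
    using * h that by (intro domino_of_eqD[of _ _ "(x, y)"]) auto
  then have "h = h'"
    using row(2)[of "2 * i" h x y "2 * i" h' x'] row(2)[of "2 * i" h' x' y "2 * i" h x] * h
    by (cases x x' rule: linorder_cases) auto
  then show "d = e" using h by simp
qed

lemma lower_part_full_tableau:
  "lower_part full_tableau d = Some s \<longleftrightarrow> (\<exists>h r. r \<in> V h \<and> d = domino_of V (int h, r) \<and> s = Letter (letter_of r))"
proof -
  have X: "full_tableau d = Some X" if "d \<in> up' (dom full_tableau)"
    using full_tableau_shifted_domino_tableau[unfolded is_shifted_domino_tableau_def, THEN conjunct2, THEN conjunct1] that
    by blast
  have L: "\<exists>a. full_tableau d = Some (Letter a)" if "d \<in> down' (dom full_tableau)"
    using full_tableau_shifted_domino_tableau[unfolded is_shifted_domino_tableau_def, THEN conjunct2, THEN conjunct2, THEN conjunct1] that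
    by blast
  have "lower_part full_tableau d = Some s \<longleftrightarrow> (\<exists>a. s = Letter a) \<and> full_tableau d = Some s"
  proof (cases "d \<in> down' (dom full_tableau)")
    case True
    then show ?thesis using L by (auto simp: lower_part_def)
  next
    case False
    then show ?thesis using X by (auto simp: lower_part_def down'_def)
  qed
  also have "\<dots> \<longleftrightarrow> (\<exists>r. s = Letter (letter_of r) \<and> full_tableau d = Some (Letter (letter_of r)))"
    by (metis letter_cases)
  finally show ?thesis unfolding full_tableau_Letter by blast
qed

lemma lower_part_full_tableau_unprimed: "domino_diagonal_unprimed (lower_part full_tableau)"
  unfolding domino_diagonal_unprimed_def
proof (intro allI impI notI)
  fix d i assume "on_diag d 0" "lower_part full_tableau d = Some (Letter (Primed i))"
  then obtain h where h: "2 * i \<in> V h" "on_diag (domino_of V (int h, 2 * i)) 0"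
    unfolding lower_part_full_tableau Primed_eq by auto
  then have "h = 0 \<or> h = 1" unfolding on_diag_domino_of by auto
  then show False using h(1) odd_V[of "2 * i"] by auto
qed

end

subsection \<open>The family of a tableau\<close>

lemma domino_diag_index:
  assumes "is_domino d" "c \<in> d" "c' \<in> d"
  shows "diag_index c \<le> diag_index c' + 1" "diag_index c = diag_index c' \<Longrightarrow> c = c'"
  using assms by (auto simp: is_domino_def horizontal_def vertical_def diag_index_def)

lemma domino_eq:
  assumes "is_domino d" "c \<in> d" "c' \<in> d" "c \<noteq> c'"
  shows "d = {c, c'}"
  using assms by (auto simp: is_domino_def horizontal_def vertical_def)

lemma domino_next:
  assumes "is_domino d" "(x, y) \<in> d" "c \<in> d" "diag_index c = diag_index (x, y) - 1"
  shows "c = (Suc x, y) \<or> (\<exists>y'. y = Suc y' \<and> c = (x, y'))"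
  using assms by (auto simp: is_domino_def horizontal_def vertical_def diag_index_def)

lemma domino_prev:
  assumes "is_domino d" "(x, y) \<in> d" "c \<in> d" "diag_index c = diag_index (x, y) + 1"
  shows "c = (x, Suc y) \<or> (\<exists>x'. x = Suc x' \<and> c = (x', y))"
  using assms by (auto simp: is_domino_def horizontal_def vertical_def diag_index_def)

text \<open>Plays the role of the index \<open>h\<close> for dominoes of an arbitrary
  paving.\<close>

definition spans :: "domino \<Rightarrow> nat \<Rightarrow> bool" where
  "spans d h \<longleftrightarrow> (\<exists>c\<in>d. diag_index c = - int h) \<and> (\<exists>c\<in>d. diag_index c = 1 - int h)"

definition family_of :: "(domino \<rightharpoonup> symbol) \<Rightarrow> nat \<Rightarrow> nat set" where
  "family_of f h = {r. \<exists>d. f d = Some (Letter (letter_of r)) \<and> spans d h}"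

lemma spans_unique:
  assumes "is_domino d" "spans d h" "spans d h'"
  shows "h = h'"
proof -
  obtain a b a' b' where "a \<in> d" "diag_index a = - int h" "b \<in> d" "diag_index b = 1 - int h"
    "a' \<in> d" "diag_index a' = - int h'" "b' \<in> d" "diag_index b' = 1 - int h'"
    using assms(2,3) unfolding spans_def by blast
  then show ?thesis using domino_diag_index(1)[OF assms(1), of b a'] domino_diag_index(1)[OF assms(1), of b' a] by simp
qed

lemma (in domino_family) spans_domino_of: "spans (domino_of V (int h, r)) h' \<longleftrightarrow> h = h'"
  by (auto simp: spans_def domino_of_def)

lemma (in domino_family) family_of_full_tableau: "family_of (lower_part full_tableau) = V"
proof (intro ext set_eqI)
  fix h r
  show "r \<in> family_of (lower_part full_tableau) h \<longleftrightarrow> r \<in> V h"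
    unfolding family_of_def mem_Collect_eq lower_part_full_tableau
    by (auto simp: spans_domino_of)
qed

locale domino_tableau =
  fixes l :: "nat list" and f :: "domino \<rightharpoonup> symbol"
  assumes partition: "is_partition l" and tableau: "is_shifted_domino_tableau l f"
begin

lemma paving: "is_paving l (dom f)"
  using tableau by (simp add: is_shifted_domino_tableau_def is_shifted_paving_def)

lemma is_domino: "d \<in> dom f \<Longrightarrow> is_domino d"
  using paving by (simp add: is_paving_def)

lemma same_domino: "d \<in> dom f \<Longrightarrow> e \<in> dom f \<Longrightarrow> c \<in> d \<Longrightarrow> c \<in> e \<Longrightarrow> d = e"
  using paving unfolding is_paving_def by blast

lemma in_diagram: "d \<in> dom f \<Longrightarrow> c \<in> d \<Longrightarrow> c \<in> diagram l"
  using paving unfolding is_paving_def by blast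

definition labelled :: "domino \<Rightarrow> nat \<Rightarrow> bool" where
  "labelled d r \<longleftrightarrow> f d = Some (Letter (letter_of r))"

lemma labelled_dom: "labelled d r \<Longrightarrow> d \<in> dom f"
  by (auto simp: labelled_def)

lemma labelled_unique: "labelled d r \<Longrightarrow> labelled d s \<Longrightarrow> r = s"
  by (auto simp: labelled_def)

lemma row:
  assumes "labelled d r" "labelled e s" "(x, y) \<in> d" "(x', y) \<in> e" "x < x'"
  shows "r \<le> s"
proof -
  have "letter_of r \<le> letter_of s"
    using tableau[unfolded is_shifted_domino_tableau_def, THEN conjunct2, THEN conjunct2, THEN conjunct2, THEN conjunct1]
      assms unfolding labelled_def by blast
  then show ?thesis by simp
qed

lemma column:
  assumes "labelled d r" "labelled e s" "(x, y) \<in> d" "(x, y') \<in> e" "y < y'"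
  shows "r \<le> s"
proof -
  have "letter_of r \<le> letter_of s"
    using tableau[unfolded is_shifted_domino_tableau_def, THEN conjunct2, THEN conjunct2, THEN conjunct2, THEN conjunct2, THEN conjunct1]
      assms unfolding labelled_def by blast
  then show ?thesis by simp
qed

lemma column_unprimed:
  assumes "labelled d r" "labelled e r" "odd r" "(x, y) \<in> d" "(x, y') \<in> e"
  shows "d = e"
proof -
  have r: "letter_of r = Unprimed (r div 2)" using assms(3) by (simp add: letter_of_def)
  show ?thesis
    using tableau[unfolded is_shifted_domino_tableau_def, THEN conjunct2, THEN conjunct2, THEN conjunct2, THEN conjunct2, THEN conjunct2, THEN conjunct1]
      assms(1,2,4,5) unfolding labelled_def r by blast
qed

lemma row_primed:
  assumes "labelled d r" "labelled e r" "even r" "(x, y) \<in> d" "(x', y) \<in> e"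
  shows "d = e"
proof -
  have r: "letter_of r = Primed (r div 2)" using assms(3) by (simp add: letter_of_def)
  show ?thesis
    using tableau[unfolded is_shifted_domino_tableau_def, THEN conjunct2, THEN conjunct2, THEN conjunct2, THEN conjunct2, THEN conjunct2, THEN conjunct2]
      assms(1,2,4,5) unfolding labelled_def r by blast
qed

lemma up'_X: "d \<in> up' (dom f) \<Longrightarrow> f d = Some X"
  using tableau[unfolded is_shifted_domino_tableau_def, THEN conjunct2, THEN conjunct1] by blast

lemma down'_labelled:
  assumes "d \<in> down' (dom f)"
  shows "\<exists>r. labelled d r"
proof -
  obtain a where "f d = Some (Letter a)"
    using tableau[unfolded is_shifted_domino_tableau_def, THEN conjunct2, THEN conjunct2, THEN conjunct1] assms by blast
  then show ?thesis unfolding labelled_def by (metis letter_cases)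
qed

lemma labelled_down':
  assumes "labelled d r"
  shows "d \<in> down' (dom f)"
proof -
  have "d \<notin> up' (dom f)" using up'_X[of d] assms by (auto simp: labelled_def)
  then show ?thesis using labelled_dom[OF assms] by (simp add: down'_def)
qed

lemma lower_part_eq: "lower_part f d = Some s \<longleftrightarrow> (\<exists>r. labelled d r \<and> s = Letter (letter_of r))"
proof (cases "d \<in> down' (dom f)")
  case True
  then obtain r where "labelled d r" using down'_labelled by blast
  then show ?thesis using True by (auto simp: lower_part_def labelled_def)
next
  case False
  then show ?thesis using labelled_down' by (auto simp: lower_part_def restrict_map_def)
qed

lemma lower_labelled:
  assumes "d \<in> dom f" "c \<in> d" "diag_index c \<le> 0"
  obtains r where "labelled d r"
proof -
  have "d \<notin> up' (dom f)"
  proof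
    assume "d \<in> up' (dom f)"
    then obtain k c' where k: "k > 0" "c' \<in> d" "diag_index c' = 2 * k" by (auto simp: up'_def on_diag_def)
    then show False using domino_diag_index(1)[OF is_domino[OF assms(1)] k(2) assms(2)] assms(3) by simp
  qed
  then show thesis using that down'_labelled assms(1) by (auto simp: down'_def)
qed

text \<open>If both cells were strictly above the main diagonal, one of the two consecutive positive
  indices would be even, and the domino would be in \<open>up'\<close> and carry
  \<open>X\<close>.\<close>

lemma labelled_spans:
  assumes "labelled d r"
  obtains h where "spans d h"
proof -
  have "d \<notin> up' (dom f)" and d: "d \<in> dom f" using labelled_down'[OF assms] by (auto simp: down'_def)
  then have nup: "diag_index c \<noteq> 2 * k" if "c \<in> d" "k > 0" for c k
    using that by (auto simp: up'_def on_diag_def)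
  obtain x y x' y' where xy: "(x, y) \<in> d" "(x', y') \<in> d" "diag_index (x', y') = diag_index (x, y) + 1"
    using is_domino[OF d] by (fastforce simp: is_domino_def horizontal_def vertical_def diag_index_def)
  have "diag_index (x, y) \<le> 0"
  proof (rule ccontr)
    assume "\<not> diag_index (x, y) \<le> 0"
    then have "\<exists>k>0. diag_index (x, y) = 2 * k \<or> diag_index (x, y) + 1 = 2 * k" by presburger
    then show False using nup[OF xy(1)] nup[OF xy(2)] xy(3) by auto
  qed
  then obtain h where "diag_index (x, y) = - int h" by (metis neg_0_le_iff_le nonneg_int_cases minus_minus neg_le_0_iff_le)
  then have "spans d h" using xy unfolding spans_def by (intro conjI bexI[OF _ xy(1)] bexI[OF _ xy(2)]) auto
  then show thesis by (rule that)
qed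

section \<open>Labels along one diagonal of a given tableau\<close>

definition owner :: "nat \<Rightarrow> nat \<Rightarrow> domino" where
  "owner h y = (THE d. d \<in> dom f \<and> (y + h, y) \<in> d)"

definition label :: "nat \<Rightarrow> nat \<Rightarrow> nat" where
  "label h y = (THE r. labelled (owner h y) r)"

definition key :: "nat \<Rightarrow> nat \<Rightarrow> nat" where
  "key h y = (if spans (owner h y) h then keyP (label h y) else keyN (label h y))"

lemma ownerI: "d \<in> dom f \<Longrightarrow> (y + h, y) \<in> d \<Longrightarrow> owner h y = d"
  unfolding owner_def by (rule the_equality) (simp, metis same_domino)

lemma labelI: "labelled (owner h y) r \<Longrightarrow> label h y = r"
  unfolding label_def by (rule the_equality) (blast intro: labelled_unique)+

lemma owner:
  assumes "(y + h, y) \<in> diagram l"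
  shows "owner h y \<in> dom f" "(y + h, y) \<in> owner h y" "labelled (owner h y) (label h y)"
proof -
  have "(y + h, y) \<in> \<Union> (dom f)" using assms paving by (simp add: is_paving_def)
  then obtain d where d: "d \<in> dom f" "(y + h, y) \<in> d" by blast
  note o = ownerI[OF d]
  show "owner h y \<in> dom f" "(y + h, y) \<in> owner h y" using d o by auto
  obtain r where "labelled d r" using d by (rule lower_labelled) (simp add: diag_index_def)
  then show "labelled (owner h y) (label h y)" using o labelI by metis
qed

lemma owner_spans:
  assumes "(y + h, y) \<in> diagram l"
  shows "spans (owner h y) h \<noteq> spans (owner h y) (Suc h)"
proof -
  note o = owner[OF assms]
  obtain g where g: "spans (owner h y) g" using labelled_spans[OF o(3)] .
  have dom: "is_domino (owner h y)" using is_domino[OF o(1)] .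
  obtain a b where ab: "a \<in> owner h y" "diag_index a = - int g" "b \<in> owner h y" "diag_index b = 1 - int g"
    using g unfolding spans_def by blast
  have "diag_index (y + h, y) = - int h" by (simp add: diag_index_def)
  then have "g = h \<or> g = Suc h"
    using domino_diag_index(1)[OF dom o(2) ab(1)] domino_diag_index(1)[OF dom ab(3) o(2)] ab by auto
  then show ?thesis using g spans_unique[OF dom, of h "Suc h"] by auto
qed

lemma spans_SucI:
  assumes "is_domino d" "(y + h, y) \<in> d" "(z + Suc h, z) \<in> d"
  shows "spans d (Suc h)"
  unfolding spans_def
  by (intro conjI bexI[OF _ assms(2)] bexI[OF _ assms(3)]) (auto simp: diag_index_def)

lemma diagram_diag: "(y + h, y) \<in> diagram l \<longleftrightarrow> y < diag_len l (int h)"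
  using diag_cell_in_diagram[OF partition, of "int h" y] by (simp add: diag_cell_def)

text \<open>The cell to the right of the first cell and below the second has a label between theirs.
  In a tie its domino is \<open>e\<close> for odd labels (column condition) and \<open>d\<close> for
  even ones (row condition). This fixes one of the two keys; the other follows by excluding that the
  remaining domino spans the next diagonal.\<close>

lemma key_less:
  assumes c: "(Suc y + h, Suc y) \<in> diagram l"
  shows "key h y < key h (Suc y)"
proof -
  have c0: "(y + h, y) \<in> diagram l" and c1: "(y + Suc h, y) \<in> diagram l"
    using diagram_closed[OF partition c] by auto
  define d m e where dme: "d = owner h y" "m = owner (Suc h) y" "e = owner h (Suc y)"
  note d = owner[OF c0, folded dme] and m = owner[OF c1, folded dme] and e = owner[OF c, folded dme]
  have dom: "is_domino d" "is_domino m" "is_domino e" using d m e is_domino by auto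
  have m': "(Suc (y + h), y) \<in> m" using m by simp
  have e': "(Suc (y + h), Suc y) \<in> e" using e by simp
  have le: "label h y \<le> label (Suc h) y" "label (Suc h) y \<le> label h (Suc y)"
    using row[OF d(3) m(3) d(2) m'] column[OF m(3) e(3) m' e'] by auto
  have key: "2 * label h y \<le> key h y" "key h y \<le> 2 * label h y + 1"
    "2 * label h (Suc y) \<le> key h (Suc y)" "key h (Suc y) \<le> 2 * label h (Suc y) + 1"
    by (auto simp: key_def keyP_def keyN_def)
  have de: "d \<noteq> e" using domino_diag_index(2)[OF dom(1) d(2), of "(Suc (y + h), Suc y)"] e' by (auto simp: diag_index_def)
  show ?thesis
  proof (cases "label h y = label h (Suc y)")
    case False
    then show ?thesis using le key by linarith
  next
    case True
    define r where "r = label h y"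
    have lab: "labelled d r" "labelled m r" "labelled e r" "label h y = r" "label h (Suc y) = r"
      using True le d(3) m(3) e(3) by (simp_all add: r_def)
    show ?thesis
    proof (cases "odd r")
      case odd: True
      have me: "m = e" using column_unprimed[OF lab(2,3) odd m' e'] .
      have "spans e (Suc h)" using spans_SucI[OF dom(3) e(2)] m me by blast
      then have "\<not> spans e h" using owner_spans[OF c] by (simp add: dme)
      moreover have "spans d h"
      proof (rule ccontr)
        assume "\<not> spans d h"
        then have "spans d (Suc h)" using owner_spans[OF c0] by (simp add: dme)
        then obtain z where z: "z \<in> d" "diag_index z = - int h - 1" by (auto simp: spans_def)
        have "diag_index z = diag_index (y + h, y) - 1" using z by (simp add: diag_index_def)
        from domino_next[OF dom(1) d(2) z(1) this] show False
        proof
          assume "z = (Suc (y + h), y)"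
          then have "d = m" using same_domino[OF d(1) m(1) _ m'] z by blast
          then show False using me de by simp
        next
          assume "\<exists>y'. y = Suc y' \<and> z = (y + h, y')"
          then obtain y' where y': "y = Suc y'" "(y + h, y') \<in> d" using z by auto
          \<comment> \<open>This cell is to the right of the lower cell of \<open>d\<close> and
            below the middle cell, so its label is squeezed to \<open>r\<close> and it lies in
            \<open>e\<close>. Then \<open>e\<close> would contain cells two rows apart.\<close>
          have "(y' + Suc (Suc h), y') \<in> diagram l" using diagram_closed[OF partition c1] y' by simp
          note n = owner[OF this]
          have n': "(Suc (y + h), y') \<in> owner (Suc (Suc h)) y'" using n(2) y' by simp
          have "label (Suc (Suc h)) y' = r"
            using row[OF lab(1) n(3) y'(2) n'] column[OF n(3) lab(2) n' m'] y' by simp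
          then have "owner (Suc (Suc h)) y' = e"
            using column_unprimed[OF _ lab(2) odd n' m'] n(3) me by metis
          then show False using domino_diag_index(1)[OF dom(3) e(2), of "(Suc (y + h), y')"] n' y' by (simp add: diag_index_def)
        qed
      qed
      ultimately show ?thesis using odd lab(4,5) by (simp add: key_def dme keyP_def keyN_def)
    next
      case even: False
      then have even: "even r" by simp
      have dm: "d = m" using row_primed[OF lab(1,2) even d(2) m'] .
      have "spans d (Suc h)" using spans_SucI[OF dom(1) d(2)] m dm by blast
      then have "\<not> spans d h" using owner_spans[OF c0] by (simp add: dme)
      moreover have "spans e h"
      proof (rule ccontr)
        assume "\<not> spans e h"
        then have "spans e (Suc h)" using owner_spans[OF c] by (simp add: dme)
        then obtain z where z: "z \<in> e" "diag_index z = - int h - 1" by (auto simp: spans_def)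
        have "diag_index z = diag_index (Suc (y + h), Suc y) - 1" using z by (simp add: diag_index_def)
        from domino_next[OF dom(3) e' z(1) this] show False
        proof
          assume "\<exists>y'. Suc y = Suc y' \<and> z = (Suc (y + h), y')"
          then have "z = (Suc (y + h), y)" by simp
          then have "e = m" using same_domino[OF e(1) m(1) _ m'] z by blast
          then show False using dm de by simp
        next
          assume "z = (Suc (Suc (y + h)), Suc y)"
          then have z': "(Suc (Suc (y + h)), Suc y) \<in> e" using z by simp
          \<comment> \<open>This cell is to the right of the middle cell and below the second cell
            of \<open>e\<close>. Squeezed to \<open>r\<close>, it lies in \<open>d\<close>, which
            would contain cells two columns apart.\<close>
          have "(y + Suc (Suc h), y) \<in> diagram l" using diagram_closed[OF partition in_diagram[OF e(1) z']] by simp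
          note n = owner[OF this]
          have n': "(Suc (Suc (y + h)), y) \<in> owner (Suc (Suc h)) y" using n(2) by simp
          have "label (Suc (Suc h)) y = r"
            using row[OF lab(2) n(3) m' n'] column[OF n(3) lab(3) n' z'] by simp
          then have "d = owner (Suc (Suc h)) y"
            using row_primed[OF lab(2) _ even m' n'] n(3) dm by metis
          then show False using domino_diag_index(1)[OF dom(1) d(2), of "(Suc (Suc (y + h)), y)"] n' by (simp add: diag_index_def)
        qed
      qed
      ultimately show ?thesis using even lab(4,5) by (simp add: key_def dme keyP_def keyN_def)
    qed
  qed
qed

abbreviation "V \<equiv> family_of f"

lemma family_of_iff: "r \<in> V h \<longleftrightarrow> (\<exists>d. labelled d r \<and> spans d h)"
  by (simp add: family_of_def labelled_def)

lemma diag_cell_of: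
  assumes "diag_index c = - int h"
  obtains y where "c = (y + h, y)"
proof -
  have "c = (snd c + h, snd c)" using assms by (cases c) (auto simp: diag_index_def)
  then show thesis by (rule that)
qed

lemma key_P:
  assumes "labelled d r" "spans d h"
  obtains y where "(y + h, y) \<in> d" "(y + h, y) \<in> diagram l" "key h y = keyP r" "owner h y = d"
proof -
  obtain c where "c \<in> d" "diag_index c = - int h" using assms(2) by (auto simp: spans_def)
  then obtain y where y: "(y + h, y) \<in> d" using diag_cell_of by blast
  have o: "owner h y = d" using ownerI[OF labelled_dom[OF assms(1)] y] .
  then have "label h y = r" using labelI assms(1) by simp
  then show thesis using that[OF y in_diagram[OF labelled_dom[OF assms(1)] y]] o assms(2) by (simp add: key_def)
qed

lemma key_N:
  assumes "labelled d r" "spans d (Suc h)"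
  obtains y where "(y + h, y) \<in> d" "(y + h, y) \<in> diagram l" "key h y = keyN r" "owner h y = d"
proof -
  obtain c where "c \<in> d" "diag_index c = - int h" using assms(2) by (auto simp: spans_def)
  then obtain y where y: "(y + h, y) \<in> d" using diag_cell_of by blast
  have o: "owner h y = d" using ownerI[OF labelled_dom[OF assms(1)] y] .
  then have "label h y = r" using labelI assms(1) by simp
  moreover have "\<not> spans d h" using spans_unique[OF is_domino[OF labelled_dom[OF assms(1)]] assms(2)] by fastforce
  ultimately show thesis using that[OF y in_diagram[OF labelled_dom[OF assms(1)] y]] o by (simp add: key_def)
qed

lemma key_image: "key h ` {..<diag_len l (int h)} = merged (V h) (V (Suc h))"
proof (intro equalityI subsetI)
  fix m assume "m \<in> key h ` {..<diag_len l (int h)}"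
  then obtain y where y: "(y + h, y) \<in> diagram l" "m = key h y" by (auto simp: diagram_diag)
  then show "m \<in> merged (V h) (V (Suc h))"
    using owner_spans[OF y(1)] owner(3)[OF y(1)] by (auto simp: key_def family_of_iff)
next
  fix m assume "m \<in> merged (V h) (V (Suc h))"
  then consider r where "r \<in> V h" "m = keyP r" | r where "r \<in> V (Suc h)" "m = keyN r"
    by (auto simp: merged_def)
  then show "m \<in> key h ` {..<diag_len l (int h)}"
  proof cases
    case 1
    then obtain d where "labelled d r" "spans d h" by (auto simp: family_of_iff)
    then obtain y where "(y + h, y) \<in> diagram l" "key h y = keyP r" by (rule key_P)
    then show ?thesis using 1 by (metis diagram_diag imageI lessThan_iff)
  next
    case 2
    then obtain d where "labelled d r" "spans d (Suc h)" by (auto simp: family_of_iff)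
    then obtain y where "(y + h, y) \<in> diagram l" "key h y = keyN r" by (rule key_N)
    then show ?thesis using 2 by (metis diagram_diag imageI lessThan_iff)
  qed
qed

lemma finite_family [simp]: "finite (V h)"
proof -
  have "finite (merged (V h) (V (Suc h)))" unfolding key_image[symmetric] by simp
  then show ?thesis by simp
qed

lemma key_less': "Suc y < diag_len l (int h) \<Longrightarrow> key h y < key h (Suc y)"
  by (rule key_less) (simp only: diagram_diag)

lemma card_family: "card (V h) + card (V (Suc h)) = diag_len l (int h)"
  using enumeration_below(1)[OF key_less' key_image] by (simp add: card_merged)

lemma below_key: "(y + h, y) \<in> diagram l \<Longrightarrow> below (merged (V h) (V (Suc h))) (key h y) = y"
  using enumeration_below(2)[OF key_less' key_image] by (simp add: diagram_diag)

lemma label_less_iff: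
  assumes "(y + h, y) \<in> diagram l"
  shows "label h y < m \<longleftrightarrow> y < below (V h) m + below (V (Suc h)) m"
proof -
  let ?S = "merged (V h) (V (Suc h))"
  have "key h y \<in> ?S" using assms key_image[of h] by (auto simp: diagram_diag)
  then have "key h y < 2 * m \<longleftrightarrow> below ?S (key h y) < below ?S (2 * m)"
    using below_less_iff[of ?S] by simp
  moreover have "key h y < 2 * m \<longleftrightarrow> label h y < m" by (auto simp: key_def keyP_def keyN_def)
  ultimately show ?thesis by (simp add: below_key[OF assms] below_merged_double)
qed

text \<open>The converse of \<open>pos_lower\<close>: here the domino is given, and the adjacency of
  its cells forces the two ranks to agree or to differ by one.\<close>

lemma spans_positions:
  assumes "labelled d r" "spans d (Suc h)"
  defines "y \<equiv> below (merged (V h) (V (Suc h))) (keyN r)"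
    and "z \<equiv> below (merged (V (Suc h)) (V (Suc (Suc h)))) (keyP r)"
  shows "d = {(z + Suc h, z), (y + h, y)}" "y = z \<or> y = Suc z"
proof -
  have dom: "is_domino d" using is_domino[OF labelled_dom[OF assms(1)]] .
  have y: "(y + h, y) \<in> d"
    using assms(1,2) by (rule key_N) (metis below_key y_def)
  have z: "(z + Suc h, z) \<in> d"
    using assms(1,2) by (rule key_P) (metis below_key z_def)
  show "d = {(z + Suc h, z), (y + h, y)}" using domino_eq[OF dom z y] by simp
  show "y = z \<or> y = Suc z"
    using domino_next[OF dom y z] by (auto simp: diag_index_def)
qed

text \<open>If the threshold label lies in \<open>V (Suc h)\<close>, its domino has a cell on both
  diagonals and \<open>spans_positions\<close> is the inequality, the counts of
  \<open>V (Suc h)\<close> cancelling. Otherwise a violation produces two neighbouring cells with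
  this label; they lie in one domino, which spans \<open>Suc h\<close> and so puts the label into
  \<open>V (Suc h)\<close> after all.\<close>

lemma interlaced_family: "interlaced (V h) (V (h + 2))"
  unfolding interlaced_def
proof (intro allI conjI)
  fix i
  have W: "below (V (Suc h)) (2 * i + 1) = below (V (Suc h)) (2 * i) + (if 2 * i \<in> V (Suc h) then 1 else 0)"
    using below_Suc[OF finite_family, of "Suc h" "2 * i"] by simp
  show "below (V (h + 2)) (2 * i + 1) \<le> below (V h) (2 * i)"
  proof (cases "2 * i \<in> V (Suc h)")
    case True
    then obtain d where "labelled d (2 * i)" "spans d (Suc h)" by (auto simp: family_of_iff)
    from spans_positions(2)[OF this] show ?thesis
      unfolding below_merged_keyN_even[OF finite_family finite_family] below_merged_keyP_even[OF finite_family finite_family]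
      by auto
  next
    case False
    show ?thesis
    proof (rule ccontr)
      assume contra: "\<not> ?thesis"
      \<comment> \<open>The number of smaller labels is the first position on diagonal
        \<open>h\<close> whose label is at least \<open>2 * i\<close>.\<close>
      define p where "p = below (V h) (2 * i) + below (V (Suc h)) (2 * i)"
      have p: "p < below (V (Suc h)) (2 * i + 1) + below (V (Suc (Suc h))) (2 * i + 1)"
        using contra W False by (simp add: p_def)
      also have "\<dots> \<le> card (V (Suc h)) + card (V (Suc (Suc h)))" by (intro add_mono below_le_card) simp_all
      finally have "p < diag_len l (int (Suc h))" by (simp only: card_family)
      then have c1: "(p + Suc h, p) \<in> diagram l" unfolding diagram_diag .
      then have c0: "(p + h, p) \<in> diagram l" using diagram_closed[OF partition] by fastforce
      have "label (Suc h) p < 2 * i + 1" using label_less_iff[OF c1] p by blast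
      moreover have "\<not> label h p < 2 * i" using label_less_iff[OF c0] by (simp add: p_def)
      moreover have c1': "(Suc (p + h), p) \<in> owner (Suc h) p" using owner(2)[OF c1] by simp
      then have "label h p \<le> label (Suc h) p"
        using row[OF owner(3)[OF c0] owner(3)[OF c1] owner(2)[OF c0]] by simp
      ultimately have eq: "label h p = 2 * i" "label (Suc h) p = 2 * i" by auto
      then have "owner h p = owner (Suc h) p"
        using row_primed[OF _ _ _ owner(2)[OF c0] c1'] owner(3)[OF c0] owner(3)[OF c1] by simp
      then have "spans (owner h p) (Suc h)"
        using spans_SucI[OF is_domino[OF owner(1)[OF c0]] owner(2)[OF c0]] owner(2)[OF c1] by simp
      then show False using False owner(3)[OF c0] eq by (auto simp: family_of_iff)
    qed
  qed
next
  fix i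
  have W: "below (V (Suc h)) (2 * i + 2) = below (V (Suc h)) (2 * i + 1) + (if 2 * i + 1 \<in> V (Suc h) then 1 else 0)"
    using below_Suc[OF finite_family, of "Suc h" "2 * i + 1"] by simp
  show "below (V h) (2 * i + 2) \<le> below (V (h + 2)) (2 * i + 1) + 1"
  proof (cases "2 * i + 1 \<in> V (Suc h)")
    case True
    then obtain d where "labelled d (2 * i + 1)" "spans d (Suc h)" by (auto simp: family_of_iff)
    from spans_positions(2)[OF this] show ?thesis
      unfolding below_merged_keyN_odd[OF finite_family finite_family] below_merged_keyP_odd[OF finite_family finite_family]
      by auto
  next
    case False
    show ?thesis
    proof (rule ccontr)
      assume contra: "\<not> ?thesis"
      \<comment> \<open>The first position on diagonal \<open>Suc h\<close> whose label is at least
        \<open>2 * i + 1\<close>; the cell above it has position \<open>Suc p\<close> on diagonal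
        \<open>h\<close>.\<close>
      define p where "p = below (V (Suc h)) (2 * i + 1) + below (V (Suc (Suc h))) (2 * i + 1)"
      have p: "Suc p < below (V h) (2 * i + 2) + below (V (Suc h)) (2 * i + 2)"
        using contra W False by (simp add: p_def)
      also have "\<dots> \<le> card (V h) + card (V (Suc h))" by (intro add_mono below_le_card) simp_all
      finally have "Suc p < diag_len l (int h)" by (simp only: card_family)
      then have c0: "(Suc p + h, Suc p) \<in> diagram l" unfolding diagram_diag .
      then have c1: "(p + Suc h, p) \<in> diagram l" using diagram_closed[OF partition] by fastforce
      have "label h (Suc p) < 2 * i + 2" using label_less_iff[OF c0] p by blast
      moreover have "\<not> label (Suc h) p < 2 * i + 1" using label_less_iff[OF c1] by (simp add: p_def)
      moreover have c1': "(Suc p + h, p) \<in> owner (Suc h) p" using owner(2)[OF c1] by simp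
      then have "label (Suc h) p \<le> label h (Suc p)"
        using column[OF owner(3)[OF c1] owner(3)[OF c0] _ owner(2)[OF c0]] by simp
      ultimately have eq: "label h (Suc p) = 2 * i + 1" "label (Suc h) p = 2 * i + 1" by auto
      then have "owner h (Suc p) = owner (Suc h) p"
        using column_unprimed[OF _ _ _ owner(2)[OF c0] c1'] owner(3)[OF c0] owner(3)[OF c1] by simp
      then have "spans (owner h (Suc p)) (Suc h)"
        using spans_SucI[OF is_domino[OF owner(1)[OF c0]] owner(2)[OF c0]] owner(2)[OF c1] by simp
      then show False using False owner(3)[OF c0] eq by (auto simp: family_of_iff)
    qed
  qed
qed

lemma odd_family:
  assumes "domino_diagonal_unprimed f"
  shows "r \<in> V 0 \<Longrightarrow> odd r" "r \<in> V 1 \<Longrightarrow> odd r"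
proof -
  have "odd r" if "labelled d r" "on_diag d 0" for d
  proof
    assume "even r"
    then have "letter_of r = Primed (r div 2)" by (simp add: letter_of_def)
    then show False using assms that unfolding domino_diagonal_unprimed_def labelled_def by metis
  qed
  then show "r \<in> V 0 \<Longrightarrow> odd r" "r \<in> V 1 \<Longrightarrow> odd r"
    by (fastforce simp: family_of_iff spans_def on_diag_def)+
qed

end

section \<open>Orientation of the dominoes on the main diagonal\<close>

context domino_tableau
begin

lemma shifted_paving: "is_shifted_paving l (dom f)"
  using tableau by (simp add: is_shifted_domino_tableau_def)

text \<open>The cell \<open>(x, Suc x)\<close> makes the set of left neighbours nonempty, so the
  paving condition gives one outside \<open>up'\<close>. It avoids all cells of index 2, hence
  covers \<open>(x, Suc x)\<close>, and the only partner left for that cell is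
  \<open>(x, x)\<close>.\<close>

lemma vertical_pred:
  assumes d: "d \<in> dom f" "(Suc x, Suc x) \<in> d" "(Suc x, Suc (Suc x)) \<in> d"
  obtains e where "e \<in> dom f" "(x, x) \<in> e" "(x, Suc x) \<in> e"
proof -
  have deq: "d = {(Suc x, Suc x), (Suc x, Suc (Suc x))}" using domino_eq[OF is_domino d(2,3)] d(1) by simp
  then have "vertical d" unfolding vertical_def by blast
  have "diag_index (Suc x, Suc x) = 2 * 0" by (simp add: diag_index_def)
  then have "on_diag d 0" using d(2) unfolding on_diag_def by blast
  have "(x, Suc x) \<in> diagram l" using diagram_closed[OF partition in_diagram[OF d(1,2)]] by simp
  then have "(x, Suc x) \<in> \<Union> (dom f)" using paving by (simp add: is_paving_def)
  then obtain e where e: "e \<in> dom f" "(x, Suc x) \<in> e" by blast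
  have "(x, Suc x) \<notin> d" using deq by simp
  then have "e \<in> left_adjacent (dom f) d" using e d(2) by (intro left_adjacentI[of e _ _ x "Suc x"]) blast+
  then have "\<not> left_adjacent (dom f) d \<subseteq> up' (dom f)"
    using shifted_paving \<open>vertical d\<close> \<open>on_diag d 0\<close> d(1) unfolding is_shifted_paving_def by blast
  then obtain e' u v where e': "e' \<in> dom f" "e' \<noteq> d" "e' \<notin> up' (dom f)" "(u, v) \<in> e'" "(Suc u, v) \<in> d"
    unfolding left_adjacent_def by blast
  then have not_up: "diag_index c \<noteq> 2" if "c \<in> e'" for c
    using that by (auto simp: up'_def on_diag_def dest!: spec[of _ "1::int"])
  have "u = x" "v = Suc x \<or> v = Suc (Suc x)" using e'(5) deq by auto
  then have xe': "(x, Suc x) \<in> e'" using e'(4) not_up[of "(x, Suc (Suc x))"] by (auto simp: diag_index_def)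
  have "e' = {(x, Suc x), (x, x)} \<or> e' = {(x, Suc x), (Suc x, Suc x)} \<or> e' = {(x, Suc x), (x, Suc (Suc x))}
    \<or> (\<exists>y. x = Suc y \<and> e' = {(x, Suc x), (y, Suc x)})"
    using is_domino[OF e'(1)] xe' by (auto simp: is_domino_def horizontal_def vertical_def)
  moreover have "(Suc x, Suc x) \<notin> e'" using same_domino[OF e'(1) d(1) _ d(2)] e'(2) by blast
  moreover have "e' \<noteq> {(x, Suc x), (x, Suc (Suc x))}" using not_up[of "(x, Suc (Suc x))"] by (auto simp: diag_index_def)
  moreover have "\<not> (\<exists>y. x = Suc y \<and> e' = {(x, Suc x), (y, Suc x)})"
  proof
    assume "\<exists>y. x = Suc y \<and> e' = {(x, Suc x), (y, Suc x)}"
    then obtain y where "x = Suc y" "(y, Suc x) \<in> e'" by blast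
    then show False using not_up[of "(y, Suc x)"] by (simp add: diag_index_def)
  qed
  ultimately have "(x, x) \<in> e'" by blast
  then show thesis using that e'(1) xe' by blast
qed

lemma spans_0I: "(x, x) \<in> d \<Longrightarrow> (x, Suc x) \<in> d \<Longrightarrow> spans d 0"
  unfolding spans_def by (intro conjI bexI[of _ "(x, x)"] bexI[of _ "(x, Suc x)"]) (simp_all add: diag_index_def)

text \<open>\<open>vertical_pred\<close> propagates a vertical domino down to the corner of the
  diagram.\<close>

lemma vertical_chain:
  assumes "d \<in> dom f" "(x, x) \<in> d" "(x, Suc x) \<in> d" "x' \<le> x"
  shows "spans (owner 0 x') 0"
  using assms
proof (induction x arbitrary: d)
  case 0
  then show ?case using ownerI[of d 0 0] spans_0I[of 0 d] by simp
next
  case (Suc x)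
  show ?case
  proof (cases "x' = Suc x")
    case True
    then show ?thesis using Suc.prems ownerI[of d "Suc x" 0] spans_0I[of "Suc x" d] by simp
  next
    case False
    obtain e where "e \<in> dom f" "(x, x) \<in> e" "(x, Suc x) \<in> e" using vertical_pred[OF Suc.prems(1-3)] .
    then show ?thesis using Suc.IH[of e] Suc.prems(4) False by simp
  qed
qed

lemma diagonal_spans_0:
  assumes "(x, x) \<in> diagram l" "spans (owner 0 x) 0"
  obtains "(x, Suc x) \<in> owner 0 x" | x' where "x = Suc x'" "(x', x) \<in> owner 0 x"
proof -
  have o: "owner 0 x \<in> dom f" "(x, x) \<in> owner 0 x" using owner[of x 0] assms(1) by simp_all
  obtain c where c: "c \<in> owner 0 x" "diag_index c = 1" using assms(2) by (auto simp: spans_def)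
  then show thesis using that domino_prev[OF is_domino[OF o(1)] o(2) c(1)] by (auto simp: diag_index_def)
qed

text \<open>At the corner there is no cell to the left; later the cell to the left is taken by the
  preceding vertical domino. Either way only the cell above remains.\<close>

lemma vertical_of_chain:
  assumes "(x, x) \<in> diagram l" "\<And>x'. x' \<le> x \<Longrightarrow> spans (owner 0 x') 0"
  shows "(x, Suc x) \<in> owner 0 x"
  using assms
proof (induction x)
  case 0
  then show ?case using diagonal_spans_0[of 0] by auto
next
  case (Suc x)
  have c: "(x, x) \<in> diagram l" using diagram_closed[OF partition Suc.prems(1)] by simp
  have IH: "(x, Suc x) \<in> owner 0 x" using Suc c by simp
  have o: "owner 0 x \<in> dom f" "(x, x) \<in> owner 0 x" "owner 0 (Suc x) \<in> dom f" "(Suc x, Suc x) \<in> owner 0 (Suc x)"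
    using owner[of x 0] owner[of "Suc x" 0] c Suc.prems(1) by simp_all
  have "(x, Suc x) \<notin> owner 0 (Suc x)"
  proof
    assume "(x, Suc x) \<in> owner 0 (Suc x)"
    then have "owner 0 (Suc x) = owner 0 x" using same_domino o IH by blast
    then show False using domino_diag_index(2)[OF is_domino[OF o(1)] o(2), of "(Suc x, Suc x)"] o(4)
      by (simp add: diag_index_def)
  qed
  then show ?case using diagonal_spans_0[OF Suc.prems(1)] Suc.prems(2)[of "Suc x"] by auto
qed

text \<open>The orientation is thus a function of the family, by the same criterion as in
  \<open>domino_of_0\<close>. A main-diagonal cell whose domino does not span 0 carries a label of
  \<open>V 1\<close>, so the two chain lemmas turn "no such cell before" into "vertical".\<close>

lemma spans_0_vertical_iff:
  assumes odd: "\<And>s. s \<in> V 0 \<Longrightarrow> odd s" "\<And>s. s \<in> V 1 \<Longrightarrow> odd s"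
    and d: "labelled d r" "spans d 0"
  defines "y \<equiv> below (merged (V 0) (V (Suc 0))) (keyP r)"
  shows "if below (V 1) r = 0 then d = {(y, y), (y, Suc y)} else \<exists>p. y = Suc p \<and> d = {(p, y), (y, y)}"
proof -
  have d': "d \<in> dom f" "is_domino d" using labelled_dom[OF d(1)] is_domino by auto
  have "r \<in> V 0" using d by (auto simp: family_of_iff)
  then have "odd r" using odd by blast
  obtain y' where "(y' + 0, y') \<in> d" "(y' + 0, y') \<in> diagram l" "key 0 y' = keyP r" "owner 0 y' = d"
    using key_P[OF d] .
  moreover have "y' = y" using below_key[OF calculation(2)] calculation(3) by (simp add: y_def)
  ultimately have y: "(y, y) \<in> d" "(y, y) \<in> diagram l" "key 0 y = keyP r" "owner 0 y = d" by simp_all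
  have less: "key 0 x < keyP r \<longleftrightarrow> x < y" if "(x, x) \<in> diagram l" for x
  proof -
    have "key 0 x \<in> merged (V 0) (V (Suc 0))" using that key_image[of 0] diagram_diag[of x 0] by auto
    then show ?thesis
      using below_less_iff[of "merged (V 0) (V (Suc 0))" "key 0 x" "keyP r"] below_key[of x 0] that by (simp add: y_def)
  qed
  show ?thesis
  proof (cases "below (V 1) r = 0")
    case True
    have "spans (owner 0 x) 0" if "x \<le> y" for x
    proof (rule ccontr)
      assume ns: "\<not> spans (owner 0 x) 0"
      have x: "(x, x) \<in> diagram l" using diagram_closed[OF partition y(2)] that by simp
      have "x \<noteq> y" using ns y d by metis
      then have "key 0 x < keyP r" using less[OF x] that by simp
      then have lt: "keyN (label 0 x) < keyP r" using ns by (simp add: key_def)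
      have "label 0 x \<in> V 1" using ns owner_spans[of x 0] owner(3)[of x 0] x by (auto simp: family_of_iff)
      \<comment> \<open>Equality is impossible: an odd label of \<open>V 1\<close> comes after an
        equal one of \<open>V 0\<close>.\<close>
      then have "label 0 x < r" "label 0 x \<in> V 1" using lt odd(2) \<open>odd r\<close> by (auto simp: keyP_def keyN_def)
      then show False using below_less[OF finite_family, of "label 0 x" 1 r] True by simp
    qed
    then have "(y, Suc y) \<in> d" using vertical_of_chain[OF y(2)] y(4) by simp
    then show ?thesis using True domino_eq[OF d'(2) y(1)] by simp
  next
    case False
    then have "{s \<in> V 1. s < r} \<noteq> {}" unfolding below_def by (metis card.empty)
    then obtain s where s: "s \<in> V 1" "s < r" by blast
    then obtain e where e: "labelled e s" "spans e (Suc 0)" by (auto simp: family_of_iff)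
    obtain x where x: "(x + 0, x) \<in> e" "(x + 0, x) \<in> diagram l" "key 0 x = keyN s" "owner 0 x = e" using key_N[OF e] .
    have "\<not> spans (owner 0 x) 0" using spans_unique[of e 0 "Suc 0"] e is_domino labelled_dom x(4) by auto
    moreover have "keyN s < keyP r" using s by (auto simp: keyN_def keyP_def)
    then have "x < y" using less[of x] x by simp
    ultimately have "(y, Suc y) \<notin> d" using vertical_chain[OF d'(1) y(1), of x] by auto
    then obtain p where "y = Suc p" "(p, y) \<in> d" using diagonal_spans_0[OF y(2)] d(2) y(4) by auto
    then show ?thesis using False domino_eq[OF d'(2) _ y(1), of "(p, y)"] by auto
  qed
qed

text \<open>For positive \<open>h\<close> both cells are ranks in the family. For
  \<open>h = 0\<close> only the cell on the main diagonal is, and the orientation criterion supplies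
  the other.\<close>

lemma eq_domino_of:
  assumes "domino_family l V" "labelled d r" "spans d h"
  shows "d = domino_of V (int h, r)"
proof (cases h)
  case 0
  interpret F: domino_family l V by (rule assms(1))
  have d: "labelled d r" "spans d 0" using assms 0 by auto
  let ?y = "below (merged (V 0) (V (Suc 0))) (keyP r)"
  have "r \<in> V 0" using d by (auto simp: family_of_iff)
  have pos: "pos V 0 0 r = ?y" using diag_keys_of_nat[of V 0] by (simp add: pos_def slot_def)
  have sp: "if below (V 1) r = 0 then d = {(?y, ?y), (?y, Suc ?y)} else \<exists>p. ?y = Suc p \<and> d = {(p, ?y), (?y, ?y)}"
    using F.odd_V d by (rule spans_0_vertical_iff)
  from \<open>r \<in> V 0\<close> show ?thesis
  proof (cases rule: F.domino_of_0)
    case (1 p)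
    then show ?thesis using sp 0 pos by simp
  next
    case (2 p)
    then show ?thesis using sp 0 pos by simp
  qed
next
  case (Suc g)
  then have d: "labelled d r" "spans d (Suc g)" using assms by auto
  have n: "int h - 1 = int g" "nat (int h) = Suc g" "nat (- int h) = 0" "nat (int g) = g" "nat (- int g) = 0"
    using Suc by auto
  have "pos V (int h) (int h) r = below (merged (V (Suc g)) (V (Suc (Suc g)))) (keyP r)"
    unfolding pos_def diag_keys_of_nat slot_def using Suc by simp
  moreover have "pos V (int g) (int h) r = below (merged (V g) (V (Suc g))) (keyN r)"
    unfolding pos_def diag_keys_of_nat slot_def using Suc by simp
  ultimately show ?thesis
    using spans_positions(1)[OF d] unfolding domino_of_def diag_cell_def split n by (simp only: n add_0_right)
qed

lemma lower_part_full_tableau_family: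
  assumes "domino_family l V"
  shows "lower_part (domino_family.full_tableau V) = lower_part f"
proof (rule ext)
  interpret F: domino_family l V by (rule assms)
  fix d
  have "lower_part F.full_tableau d = Some s \<longleftrightarrow> lower_part f d = Some s" for s
    unfolding F.lower_part_full_tableau lower_part_eq
    using eq_domino_of[OF assms] labelled_spans family_of_iff by metis
  then show "lower_part F.full_tableau d = lower_part f d" by (metis option.exhaust)
qed

end

subsection \<open>Tableaux correspond to families\<close>

text \<open>Pairs are counted, since the same label may occur in several of the sets.\<close>

definition family_content :: "(nat \<Rightarrow> nat set) \<Rightarrow> nat \<Rightarrow> nat" where
  "family_content V i = card {(h, r). r \<in> V h \<and> r div 2 = i}"

lemma (in domino_family) content_lower_part: "content (lower_part full_tableau) = family_content V"
proof
  fix i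
  let ?A = "{(h, r). r \<in> V h \<and> r div 2 = i}"
  have "(\<exists>a. lower_part full_tableau d = Some (Letter a) \<and> letter_index a = i) \<longleftrightarrow>
    (\<exists>h r. r \<in> V h \<and> d = domino_of V (int h, r) \<and> r div 2 = i)" for d
    unfolding lower_part_full_tableau by (metis letter_index_letter_of symbol.inject)
  then have "{d. \<exists>a. lower_part full_tableau d = Some (Letter a) \<and> letter_index a = i} = (\<lambda>(h, r). domino_of V (int h, r)) ` ?A"
    by auto
  moreover have "inj_on (\<lambda>(h, r). domino_of V (int h, r)) ?A"
  proof (rule inj_onI, clarify)
    fix h r h' r'
    assume "r \<in> V h" "r' \<in> V h'" "domino_of V (int h, r) = domino_of V (int h', r')"
    then have "(int h, r) = (int h', r')" using inj_onD[OF paving_domino_of(2), of "(int h, r)" "(int h', r')"] by simp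
    then show "h = h' \<and> r = r'" by simp
  qed
  ultimately show "content (lower_part full_tableau) i = family_content V i"
    unfolding content_def family_content_def by (simp add: card_image)
qed

text \<open>Any bound will do; it starts a descending induction and bounds the number of nonempty
  sets.\<close>

lemma diag_len_eventually_0: "int (sum_list m + length m) \<le> g \<Longrightarrow> diag_len m g = 0"
proof -
  assume g: "int (sum_list m + length m) \<le> g"
  have "m ! y \<le> sum_list m" if "y < length m" for y using that by (simp add: elem_le_sum_list)
  then have "{p. diag_cell g p \<in> diagram m} = {}" using g by (force simp: diag_cell_def diagram_def)
  then show ?thesis by (simp add: diag_len_def)
qed

section \<open>Sizes of the sets of a family and the 2-quotient\<close>

locale quotient_shape =
  fixes l \<alpha> \<beta> :: "nat list"
  assumes partition: "is_partition l" "is_partition \<alpha>" "is_partition \<beta>"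
    and fits: "last_part_fits \<alpha>" "last_part_fits \<beta>"
    and diag_len: "diag_len l (2 * k) = diag_len \<alpha> k + diag_len \<beta> k"
      "diag_len l (2 * k + 1) = diag_len \<beta> k + diag_len \<alpha> (k + 1)"
begin

definition size_at :: "int \<Rightarrow> nat" where
  "size_at g = (if even g then diag_len \<alpha> (g div 2) else diag_len \<beta> (g div 2))"

lemma diag_len_size_at: "diag_len l g = size_at g + size_at (g + 1)"
proof (cases "even g")
  case True
  then obtain k where "g = 2 * k" by auto
  then show ?thesis using diag_len(1)[of k] by (simp add: size_at_def)
next
  case False
  then obtain k where "g = 2 * k + 1" by (auto elim: oddE)
  then have "size_at g = diag_len \<beta> k" "size_at (g + 1) = diag_len \<alpha> (k + 1)"
    by (simp_all add: size_at_def add.commute)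
  then show ?thesis using diag_len(2)[of k] \<open>g = 2 * k + 1\<close> by simp
qed

definition domino_families :: "(nat \<Rightarrow> nat set) set" where
  "domino_families = {V. (\<forall>h. finite (V h) \<and> card (V h) = size_at (int h)) \<and> (\<forall>r\<in>V 0 \<union> V 1. odd r) \<and>
     (\<forall>h. interlaced (V h) (V (h + 2)))}"

text \<open>For negative \<open>g\<close>, two steps on the diagonals of \<open>l\<close> are one
  step on those of a component. There \<open>last_part_fits\<close> makes each diagonal one cell
  shorter, which is one discarded element.\<close>

lemma card_extend:
  assumes "\<And>h. finite (V h)" "\<And>h. card (V h) = size_at (int h)"
  shows "card (extend V g) = size_at g"
proof (cases "0 \<le> g")
  case True
  then obtain h where "g = int h" using nonneg_int_cases by blast
  then show ?thesis using assms by simp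
next
  case False
  have *: "card (extend V g) = size_at (g mod 2) - nat ((1 - g) div 2)"
    using False assms card_drop_least[OF assms(1)] by (simp add: extend_def)
  show ?thesis
  proof (cases "even g")
    case True
    then obtain k where k: "g = 2 * k" by auto
    then have "(1 - g) div 2 = - k" by simp
    then show ?thesis using * k False diag_len_last_part_fits[OF partition(2) fits(1), of k] by (simp add: size_at_def)
  next
    case odd: False
    then obtain k where k: "g = 2 * k + 1" by (auto elim: oddE)
    then have "(1 - g) div 2 = - k" by simp
    then show ?thesis using * k False diag_len_last_part_fits[OF partition(3) fits(2), of k] by (simp add: size_at_def)
  qed
qed

lemma domino_family: "V \<in> domino_families \<Longrightarrow> domino_family l V"
  unfolding domino_families_def
  by (unfold_locales) (auto simp: partition diag_len_size_at card_extend)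

text \<open>A tableau determines only the sums of neighbouring cardinalities. Beyond the diagram all
  of them vanish, so descending induction yields the individual ones.\<close>

lemma family_of_in_domino_families:
  assumes "is_shifted_domino_tableau l f" "domino_diagonal_unprimed f"
  shows "family_of f \<in> domino_families"
proof -
  interpret domino_tableau l f by (unfold_locales) (use partition assms in auto)
  define H where "H = sum_list l + length l"
  have zero: "card (V h) = 0" "size_at (int h) = 0" if "H \<le> h" for h
    using card_family[of h] diag_len_size_at[of "int h"] diag_len_eventually_0[of l "int h"] that by (simp_all add: H_def)
  have "card (V h) = size_at (int h)" for h
  proof (cases "H \<le> h")
    case False
    then have "h \<le> H" by simp
    then show ?thesis
    proof (induction h rule: inc_induct)
      case (step h)
      have "int (Suc h) = int h + 1" by simp
      then show ?case using card_family[of h] diag_len_size_at[of "int h"] step.IH by (simp add: add.commute)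
    qed (use zero in simp)
  qed (use zero in simp)
  then show ?thesis using odd_family[OF assms(2)] interlaced_family by (auto simp: domino_families_def)
qed

lemma bij_betw_family_of:
  "bij_betw family_of {T \<in> shifted_domino_tableaux l. domino_diagonal_unprimed T} domino_families"
    (is "bij_betw _ ?A _")
  and content_family_of: "T \<in> {T \<in> shifted_domino_tableaux l. domino_diagonal_unprimed T} \<Longrightarrow>
    content T = family_content (family_of T)"
proof -
  let ?G = "\<lambda>V. lower_part (domino_family.full_tableau V)"
  have T: "family_of T \<in> domino_families \<and> ?G (family_of T) = T" if TA: "T \<in> ?A" for T
  proof -
    obtain f where f: "is_shifted_domino_tableau l f" "T = lower_part f"
      using TA by (auto simp: shifted_domino_tableaux_def)
    interpret D: domino_tableau l f by (unfold_locales) (use partition f in auto)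
    \<comment> \<open>\<open>T\<close> keeps exactly the labelled dominoes of \<open>f\<close>, and
      neither the family nor the diagonal condition looks at others; so \<open>f\<close> may replace
      \<open>T\<close> in both.\<close>
    have L: "T d = Some (Letter (letter_of r)) \<longleftrightarrow> f d = Some (Letter (letter_of r))" for d r
      unfolding f(2) D.lower_part_eq D.labelled_def by auto
    have "domino_diagonal_unprimed f"
      using TA L unfolding domino_diagonal_unprimed_def Primed_eq by blast
    then have fam: "family_of f \<in> domino_families" using family_of_in_domino_families f(1) by blast
    have "family_of T = family_of f" unfolding family_of_def L ..
    then show ?thesis using fam D.lower_part_full_tableau_family[OF domino_family[OF fam]] f(2) by simp
  qed
  have V: "?G V \<in> ?A \<and> family_of (?G V) = V" if "V \<in> domino_families" for V
  proof -
    interpret F: domino_family l V using domino_family[OF that] .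
    show ?thesis
      using F.full_tableau_shifted_domino_tableau F.lower_part_full_tableau_unprimed F.family_of_full_tableau
      by (auto simp: shifted_domino_tableaux_def)
  qed
  show "bij_betw family_of ?A domino_families"
    by (rule bij_betw_byWitness[of _ ?G]) (use T V in auto)
  assume "T \<in> ?A"
  then show "content T = family_content (family_of T)"
    using T[of T] domino_family.content_lower_part[OF domino_family, of "family_of T"] by metis
qed

end

subsection \<open>Shifted Young tableaux\<close>

definition young_family_of :: "(cell \<rightharpoonup> symbol) \<Rightarrow> nat \<Rightarrow> nat set" where
  "young_family_of t k = {r. \<exists>y. t (y + k, y) = Some (Letter (letter_of r))}"

definition young_tableau_of :: "nat list \<Rightarrow> (nat \<Rightarrow> nat set) \<Rightarrow> (cell \<rightharpoonup> symbol)" where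
  "young_tableau_of m U = (\<lambda>(x, y). if (x, y) \<in> diagram m
     then Some (if x < y then X else Letter (letter_of (THE r. r \<in> U (x - y) \<and> below (U (x - y)) r = y)))
     else None)"

text \<open>The conditions of \<open>domino_families\<close> after halving the indices: a step of 2
  there is a step of 1 here.\<close>

definition young_families :: "nat list \<Rightarrow> (nat \<Rightarrow> nat set) set" where
  "young_families m = {U. (\<forall>k. finite (U k) \<and> card (U k) = diag_len m (int k)) \<and> (\<forall>r\<in>U 0. odd r) \<and>
     (\<forall>k. interlaced (U k) (U (Suc k)))}"

definition young_tableaux :: "nat list \<Rightarrow> (cell \<rightharpoonup> symbol) set" where
  "young_tableaux m = {t. is_shifted_young_tableau m t \<and> young_diagonal_unprimed t}"

lemma mem_up: "(x, y) \<in> up m \<longleftrightarrow> (x, y) \<in> diagram m \<and> x < y"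
  and mem_down: "(x, y) \<in> down m \<longleftrightarrow> (x, y) \<in> diagram m \<and> y \<le> x"
  by (auto simp: up_def down_def diag_index_def)

locale young_tableau =
  fixes m :: "nat list" and t :: "cell \<rightharpoonup> symbol"
  assumes partition: "is_partition m" and tableau: "is_shifted_young_tableau m t"
begin

definition labelled :: "cell \<Rightarrow> nat \<Rightarrow> bool" where
  "labelled c r \<longleftrightarrow> t c = Some (Letter (letter_of r))"

lemma labelled_unique: "labelled c r \<Longrightarrow> labelled c s \<Longrightarrow> r = s"
  by (auto simp: labelled_def)

lemma dom_t: "dom t = diagram m"
  using tableau by (simp add: is_shifted_young_tableau_def)

lemma labelled_iff: "(\<exists>r. labelled (x, y) r) \<longleftrightarrow> (x, y) \<in> diagram m \<and> y \<le> x"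
proof
  assume "\<exists>r. labelled (x, y) r"
  then obtain r where r: "t (x, y) = Some (Letter (letter_of r))" by (auto simp: labelled_def)
  then have "(x, y) \<in> diagram m" using dom_t by blast
  moreover have "(x, y) \<notin> up m"
    using tableau[unfolded is_shifted_young_tableau_def, THEN conjunct2, THEN conjunct1] r by fastforce
  ultimately show "(x, y) \<in> diagram m \<and> y \<le> x" by (auto simp: mem_up)
next
  assume "(x, y) \<in> diagram m \<and> y \<le> x"
  then have "(x, y) \<in> down m" by (simp add: mem_down)
  then obtain a where "t (x, y) = Some (Letter a)"
    using tableau[unfolded is_shifted_young_tableau_def, THEN conjunct2, THEN conjunct2, THEN conjunct1] by blast
  then show "\<exists>r. labelled (x, y) r" unfolding labelled_def by (metis letter_cases)
qed

lemma upper_X: "(x, y) \<in> diagram m \<Longrightarrow> x < y \<Longrightarrow> t (x, y) = Some X"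
  using tableau[unfolded is_shifted_young_tableau_def, THEN conjunct2, THEN conjunct1] mem_up by blast

lemma row:
  assumes "labelled (x, y) r" "labelled (x', y) s" "x < x'"
  shows "r \<le> s" "r = s \<Longrightarrow> odd r"
proof -
  have "letter_of r \<le> letter_of s"
    using tableau[unfolded is_shifted_young_tableau_def, THEN conjunct2, THEN conjunct2, THEN conjunct2, THEN conjunct1]
      assms unfolding labelled_def by blast
  then show "r \<le> s" by simp
  show "odd r" if "r = s"
  proof
    assume "even r"
    then have "letter_of r = Primed (r div 2)" by (simp add: letter_of_def)
    then have "x = x'"
      using tableau[unfolded is_shifted_young_tableau_def, THEN conjunct2, THEN conjunct2, THEN conjunct2, THEN conjunct2, THEN conjunct2, THEN conjunct2]
        assms(1,2) that unfolding labelled_def by metis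
    then show False using assms(3) by simp
  qed
qed

lemma column:
  assumes "labelled (x, y) r" "labelled (x, y') s" "y < y'"
  shows "r \<le> s" "r = s \<Longrightarrow> even r"
proof -
  have "letter_of r \<le> letter_of s"
    using tableau[unfolded is_shifted_young_tableau_def, THEN conjunct2, THEN conjunct2, THEN conjunct2, THEN conjunct2, THEN conjunct1]
      assms unfolding labelled_def by blast
  then show "r \<le> s" by simp
  show "even r" if "r = s"
  proof (rule ccontr)
    assume "odd r"
    then have "letter_of r = Unprimed (r div 2)" by (simp add: letter_of_def)
    then have "y = y'"
      using tableau[unfolded is_shifted_young_tableau_def, THEN conjunct2, THEN conjunct2, THEN conjunct2, THEN conjunct2, THEN conjunct2, THEN conjunct1]
        assms(1,2) that unfolding labelled_def by metis
    then show False using assms(3) by simp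
  qed
qed

abbreviation "U \<equiv> young_family_of t"

definition label :: "nat \<Rightarrow> nat \<Rightarrow> nat" where
  "label k y = (THE r. labelled (y + k, y) r)"

lemma labelI: "labelled (y + k, y) r \<Longrightarrow> label k y = r"
  unfolding label_def by (rule the_equality) (blast intro: labelled_unique)+

lemma label: "(y + k, y) \<in> diagram m \<Longrightarrow> labelled (y + k, y) (label k y)"
  using labelI labelled_iff[of "y + k" y] by (metis le_add1)

lemma diagram_diag: "(y + k, y) \<in> diagram m \<longleftrightarrow> y < diag_len m (int k)"
  using diag_cell_in_diagram[OF partition, of "int k" y] by (simp add: diag_cell_def)

text \<open>The cell to the right of the first cell and below the second has a label between theirs.
  In a tie all three agree, and the row would require an odd label, the column an even one.\<close>

lemma label_less: "Suc y < diag_len m (int k) \<Longrightarrow> label k y < label k (Suc y)"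
proof -
  assume "Suc y < diag_len m (int k)"
  then have c: "(Suc y + k, Suc y) \<in> diagram m" by (simp only: diagram_diag)
  have c0: "(y + k, y) \<in> diagram m" and c1: "(y + Suc k, y) \<in> diagram m"
    using diagram_closed[OF partition c] by auto
  have l: "labelled (y + k, y) (label k y)" "labelled (Suc (y + k), y) (label (Suc k) y)"
    "labelled (Suc (y + k), Suc y) (label k (Suc y))"
    using label[OF c0] label[OF c1] label[OF c] by simp_all
  show ?thesis using row[OF l(1,2)] column[OF l(2,3)] by (cases "label k y = label k (Suc y)") auto
qed

lemma label_image: "label k ` {..<diag_len m (int k)} = U k"
proof (intro equalityI subsetI)
  fix r assume "r \<in> label k ` {..<diag_len m (int k)}"
  then obtain y where "(y + k, y) \<in> diagram m" "r = label k y" by (auto simp: diagram_diag)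
  then show "r \<in> U k" using label by (auto simp: young_family_of_def labelled_def)
next
  fix r assume "r \<in> U k"
  then obtain y where y: "labelled (y + k, y) r" by (auto simp: young_family_of_def labelled_def)
  then have "(y + k, y) \<in> diagram m" using labelled_iff by blast
  then show "r \<in> label k ` {..<diag_len m (int k)}" using labelI[OF y] by (auto simp: diagram_diag)
qed

lemma finite_U [simp]: "finite (U k)"
  unfolding label_image[symmetric] by simp

lemma card_U: "card (U k) = diag_len m (int k)"
  using enumeration_below(1)[OF label_less label_image] .

lemma below_label: "(y + k, y) \<in> diagram m \<Longrightarrow> below (U k) (label k y) = y"
  using enumeration_below(2)[OF label_less label_image] by (simp add: diagram_diag)

lemma label_less_iff:
  assumes "(y + k, y) \<in> diagram m"
  shows "label k y < n \<longleftrightarrow> y < below (U k) n"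
proof -
  have "label k y \<in> U k" using assms label_image[of k] by (auto simp: diagram_diag)
  then show ?thesis using below_less_iff[OF finite_U, of "label k y" k n] below_label[OF assms] by simp
qed

text \<open>A violation yields two neighbouring cells, in a row or in a column, with the threshold
  label. Its parity is the one forbidden there, as distinct cells cannot merge the way cells of a
  domino do.\<close>

lemma interlaced_U: "interlaced (U k) (U (Suc k))"
  unfolding interlaced_def
proof (intro allI conjI; rule ccontr)
  fix i
  assume contra: "\<not> below (U (Suc k)) (2 * i + 1) \<le> below (U k) (2 * i)"
  define p where "p = below (U k) (2 * i)"
  have p: "p < below (U (Suc k)) (2 * i + 1)" using contra by (simp add: p_def)
  also have "\<dots> \<le> card (U (Suc k))" by (simp add: below_le_card)
  finally have c1: "(p + Suc k, p) \<in> diagram m" by (simp only: card_U diagram_diag)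
  then have c0: "(p + k, p) \<in> diagram m" using diagram_closed[OF partition] by fastforce
  have l: "labelled (p + k, p) (label k p)" "labelled (Suc (p + k), p) (label (Suc k) p)"
    using label[OF c0] label[OF c1] by simp_all
  have "label (Suc k) p < 2 * i + 1" using label_less_iff[OF c1] p by blast
  moreover have "\<not> label k p < 2 * i" using label_less_iff[OF c0] by (simp add: p_def)
  ultimately have "label k p = 2 * i" "label (Suc k) p = 2 * i" using row(1)[OF l] by auto
  then show False using row(2)[OF l] by simp
next
  fix i
  assume contra: "\<not> below (U k) (2 * i + 2) \<le> below (U (Suc k)) (2 * i + 1) + 1"
  define p where "p = below (U (Suc k)) (2 * i + 1)"
  have p: "Suc p < below (U k) (2 * i + 2)" using contra by (simp add: p_def)
  also have "\<dots> \<le> card (U k)" by (simp add: below_le_card)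
  finally have c0: "(Suc p + k, Suc p) \<in> diagram m" by (simp only: card_U diagram_diag)
  then have c1: "(p + Suc k, p) \<in> diagram m" using diagram_closed[OF partition] by fastforce
  have l: "labelled (Suc (p + k), p) (label (Suc k) p)" "labelled (Suc (p + k), Suc p) (label k (Suc p))"
    using label[OF c0] label[OF c1] by simp_all
  have "label k (Suc p) < 2 * i + 2" using label_less_iff[OF c0] p by blast
  moreover have "\<not> label (Suc k) p < 2 * i + 1" using label_less_iff[OF c1] by (simp add: p_def)
  ultimately have "label (Suc k) p = 2 * i + 1" "label k (Suc p) = 2 * i + 1" using column(1)[OF l] by auto
  then show False using column(2)[OF l] by simp
qed

lemma young_tableau_of_young_family_of: "young_tableau_of m U = t"
proof
  fix c :: cell
  obtain x y where c: "c = (x, y)" by fastforce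
  consider "(x, y) \<notin> diagram m" | "(x, y) \<in> diagram m" "x < y" | "(x, y) \<in> diagram m" "y \<le> x" by linarith
  then show "young_tableau_of m U c = t c"
  proof cases
    case 1
    then have "t (x, y) = None" using dom_t by blast
    then show ?thesis using 1 c by (simp add: young_tableau_of_def)
  next
    case 2
    then show ?thesis using upper_X c by (simp add: young_tableau_of_def)
  next
    case 3
    define k where "k = x - y"
    have x: "x = y + k" using 3 by (simp add: k_def)
    have d: "(y + k, y) \<in> diagram m" using 3 x by simp
    have "(THE r. r \<in> U k \<and> below (U k) r = y) = label k y"
    proof (rule the_equality)
      have "label k y \<in> U k" using d label_image[of k] by (auto simp: diagram_diag)
      then show "label k y \<in> U k \<and> below (U k) (label k y) = y" using below_label[OF d] by simp
      show "r = label k y" if "r \<in> U k \<and> below (U k) r = y" for r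
        using inj_onD[OF below_inj[OF finite_U[of k]], of r "label k y"] that \<open>label k y \<in> U k\<close> below_label[OF d] by simp
    qed
    then show ?thesis using label[OF d] d c x by (simp add: young_tableau_of_def labelled_def)
  qed
qed

lemma young_family_of_in_young_families:
  assumes "young_diagonal_unprimed t"
  shows "U \<in> young_families m"
proof -
  have "odd r" if r: "r \<in> U 0" for r
  proof
    assume "even r"
    obtain y where "t (y, y) = Some (Letter (letter_of r))" using r by (auto simp: young_family_of_def)
    then have "t (y, y) = Some (Letter (Primed (r div 2)))" using \<open>even r\<close> by (simp add: letter_of_def)
    then show False using assms unfolding young_diagonal_unprimed_def by (auto simp: diag_index_def)
  qed
  then show ?thesis using card_U interlaced_U by (simp add: young_families_def)
qed

end

locale young_family =
  fixes m :: "nat list" and U :: "nat \<Rightarrow> nat set"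
  assumes partition: "is_partition m" and U: "U \<in> young_families m"
begin

lemma finite_U [simp]: "finite (U k)" and card_U: "card (U k) = diag_len m (int k)"
  and odd_U: "r \<in> U 0 \<Longrightarrow> odd r" and interlaced_U: "interlaced (U k) (U (Suc k))"
  using U by (auto simp: young_families_def)

lemma below_U_add: "below (U (k + d)) n \<le> below (U k) n" "below (U k) n \<le> below (U (k + d)) n + d"
proof (induction d)
  case (Suc d)
  note I = interlaced_below[OF interlaced_U[of "k + d"] finite_U finite_U, of n]
  { case 1 show ?case using Suc(1) I(1) by simp
  next
    case 2 show ?case using Suc(2) I(2) by simp }
qed auto

lemma diagram_diag: "(y + k, y) \<in> diagram m \<longleftrightarrow> y < card (U k)"
  using diag_cell_in_diagram[OF partition, of "int k" y] by (simp add: diag_cell_def card_U)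

lemma labelled_iff:
  "young_tableau_of m U (x, y) = Some (Letter (letter_of r)) \<longleftrightarrow> y \<le> x \<and> r \<in> U (x - y) \<and> below (U (x - y)) r = y"
proof (cases "(x, y) \<in> diagram m \<and> y \<le> x")
  case True
  define k where "k = x - y"
  have "(y + k, y) \<in> diagram m" using True by (simp add: k_def)
  then obtain s where s: "s \<in> U k" "below (U k) s = y" using below_obtain[OF finite_U] diagram_diag by metis
  then have "(THE r. r \<in> U k \<and> below (U k) r = y) = s"
    using inj_onD[OF below_inj[OF finite_U[of k]]] by (intro the_equality) auto
  then have "young_tableau_of m U (x, y) = Some (Letter (letter_of r)) \<longleftrightarrow> r = s"
    using True by (auto simp: young_tableau_of_def k_def)
  then show ?thesis using s True inj_onD[OF below_inj[OF finite_U[of k]], of r s] unfolding k_def by auto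
next
  case False
  have "(x, y) \<in> diagram m" if "y \<le> x" "r \<in> U (x - y)" "below (U (x - y)) r = y"
    using diagram_diag[of y "x - y"] below_less_card[OF finite_U that(2)] that by simp
  then show ?thesis using False by (auto simp: young_tableau_of_def)
qed

text \<open>On the diagonal of \<open>s\<close> exactly \<open>Suc y\<close> labels are below
  \<open>Suc s\<close>, while only \<open>y\<close> labels are below \<open>r\<close> on the other
  one. The weak interlacing then excludes \<open>s < r\<close>, and the strict one at an even
  threshold excludes equal even labels.\<close>

lemma row:
  assumes "young_tableau_of m U (x, y) = Some (Letter (letter_of r))"
    "young_tableau_of m U (x', y) = Some (Letter (letter_of s))" "x < x'"
  shows "r \<le> s" "r = s \<Longrightarrow> odd r"
proof -
  obtain d where d: "x' - y = x - y + Suc d"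
    using assms unfolding labelled_iff by (metis add_Suc_right diff_add_assoc2 less_iff_Suc_add)
  define k where "k = x - y"
  have r: "r \<in> U k" "below (U k) r = y" and s: "s \<in> U (k + Suc d)" "below (U (k + Suc d)) s = y"
    using assms(1,2) d unfolding labelled_iff k_def by auto
  have s': "below (U (k + Suc d)) (Suc s) = Suc y" using s below_Suc[OF finite_U] by simp
  show "r \<le> s"
  proof (rule ccontr)
    assume "\<not> r \<le> s"
    then have "below (U k) (Suc s) \<le> below (U k) r" by (intro below_mono) auto
    then show False using r s' below_U_add(1)[of k "Suc d" "Suc s"] by simp
  qed
  show "odd r" if "r = s"
  proof
    assume "even r"
    then obtain i where "r = 2 * i" by (elim evenE)
    then show False using interlacedD(1)[OF interlaced_U[of k], of i] r s' that below_U_add(1)[of "Suc k" d "Suc s"] by simp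
  qed
qed

lemma column:
  assumes "young_tableau_of m U (x, y) = Some (Letter (letter_of r))"
    "young_tableau_of m U (x, y') = Some (Letter (letter_of s))" "y < y'"
  shows "r \<le> s" "r = s \<Longrightarrow> even r"
proof -
  obtain d where y': "y' = y + Suc d" using assms(3) by (metis add_Suc_right less_iff_Suc_add)
  define k where "k = x - y'"
  have "y' \<le> x" using assms(2) unfolding labelled_iff by simp
  then have d: "x - y = k + Suc d" using y' by (simp add: k_def)
  have r: "r \<in> U (k + Suc d)" "below (U (k + Suc d)) r = y" and s: "s \<in> U k" "below (U k) s = y'"
    using assms(1,2) d unfolding labelled_iff k_def by auto
  have s': "below (U k) (Suc s) = Suc y'" using s below_Suc[OF finite_U] by simp
  show "r \<le> s"
  proof (rule ccontr)
    assume "\<not> r \<le> s"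
    then have "below (U (k + Suc d)) (Suc s) \<le> below (U (k + Suc d)) r" by (intro below_mono) auto
    then show False using r s' y' below_U_add(2)[of k "Suc s" "Suc d"] by simp
  qed
  show "even r" if "r = s"
  proof (rule ccontr)
    assume "odd r"
    then obtain i where "r = 2 * i + 1" by (elim oddE)
    then show False
      using interlacedD(2)[OF interlaced_U[of k], of i] r s' y' that below_U_add(2)[of "Suc k" s d] by simp
  qed
qed

lemma young_tableau_of_in_young_tableaux: "young_tableau_of m U \<in> young_tableaux m"
proof -
  let ?t = "young_tableau_of m U"
  have "is_shifted_young_tableau m ?t"
    unfolding is_shifted_young_tableau_def
  proof (intro conjI ballI allI impI; (elim conjE)?)
    show "dom ?t = diagram m" by (auto simp: young_tableau_of_def split: if_splits)
  next
    fix c assume "c \<in> up m"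
    then show "?t c = Some X" by (cases c) (auto simp: mem_up young_tableau_of_def)
  next
    fix c assume "c \<in> down m"
    then show "\<exists>a. ?t c = Some (Letter a)" by (cases c) (auto simp: mem_down young_tableau_of_def)
  next
    fix x x' y a b
    assume "?t (x, y) = Some (Letter a)" "?t (x', y) = Some (Letter b)" "x < x'"
    then show "a \<le> b" using row(1) by (cases a rule: letter_cases; cases b rule: letter_cases) simp
  next
    fix x y y' a b
    assume "?t (x, y) = Some (Letter a)" "?t (x, y') = Some (Letter b)" "y < y'"
    then show "a \<le> b" using column(1) by (cases a rule: letter_cases; cases b rule: letter_cases) simp
  next
    fix x y y' i
    assume "?t (x, y) = Some (Letter (Unprimed i))" "?t (x, y') = Some (Letter (Unprimed i))"
    then show "y = y'" unfolding Unprimed_eq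
      using column(2)[of x y "2 * i + 1" y' "2 * i + 1"] column(2)[of x y' "2 * i + 1" y "2 * i + 1"]
      by (cases y y' rule: linorder_cases) auto
  next
    fix x x' y i
    assume "?t (x, y) = Some (Letter (Primed i))" "?t (x', y) = Some (Letter (Primed i))"
    then show "x = x'" unfolding Primed_eq
      using row(2)[of x y "2 * i" x' "2 * i"] row(2)[of x' y "2 * i" x "2 * i"]
      by (cases x x' rule: linorder_cases) auto
  qed
  moreover have "young_diagonal_unprimed ?t"
    unfolding young_diagonal_unprimed_def
  proof (intro allI impI notI)
    fix c i assume c: "diag_index c = 0" "?t c = Some (Letter (Primed i))"
    then obtain x where "c = (x, x)" by (cases c) (auto simp: diag_index_def)
    then have "2 * i \<in> U 0" using c(2) unfolding Primed_eq by (simp add: labelled_iff)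
    then show False using odd_U by fastforce
  qed
  ultimately show ?thesis by (simp add: young_tableaux_def)
qed

lemma young_family_of_young_tableau_of: "young_family_of (young_tableau_of m U) = U"
proof (intro ext set_eqI)
  fix k r
  show "r \<in> young_family_of (young_tableau_of m U) k \<longleftrightarrow> r \<in> U k"
    unfolding young_family_of_def mem_Collect_eq labelled_iff by auto
qed

lemma content_young_tableau_of: "content (young_tableau_of m U) = family_content U"
proof
  fix i
  let ?A = "{(k, r). r \<in> U k \<and> r div 2 = i}"
  let ?c = "\<lambda>(k, r). (below (U k) r + k, below (U k) r)"
  have "{c. \<exists>a. young_tableau_of m U c = Some (Letter a) \<and> letter_index a = i} = ?c ` ?A"
  proof (intro equalityI subsetI)
    fix c assume "c \<in> {c. \<exists>a. young_tableau_of m U c = Some (Letter a) \<and> letter_index a = i}"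
    then obtain a where a: "young_tableau_of m U c = Some (Letter a)" "letter_index a = i" by blast
    obtain x y where c: "c = (x, y)" by fastforce
    obtain r where r: "a = letter_of r" by (rule letter_cases)
    then show "c \<in> ?c ` ?A" using a unfolding c r labelled_iff by (intro image_eqI[of _ _ "(x - y, r)"]) auto
  next
    fix c assume "c \<in> ?c ` ?A"
    then obtain k r where kr: "r \<in> U k" "r div 2 = i" "c = (below (U k) r + k, below (U k) r)" by auto
    then have "young_tableau_of m U c = Some (Letter (letter_of r))" unfolding kr(3) labelled_iff by simp
    then show "c \<in> {c. \<exists>a. young_tableau_of m U c = Some (Letter a) \<and> letter_index a = i}" using kr(2) by auto
  qed
  moreover have "inj_on ?c ?A"
    using inj_onD[OF below_inj[OF finite_U]] by (auto intro!: inj_onI)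
  ultimately show "content (young_tableau_of m U) i = family_content U i"
    unfolding content_def family_content_def by (simp add: card_image)
qed

end

lemma bij_betw_young_family_of:
  assumes "is_partition m"
  shows "bij_betw young_family_of (young_tableaux m) (young_families m)"
    and "t \<in> young_tableaux m \<Longrightarrow> content t = family_content (young_family_of t)"
proof -
  have T: "young_family_of t \<in> young_families m \<and> young_tableau_of m (young_family_of t) = t"
    if "t \<in> young_tableaux m" for t
  proof -
    interpret young_tableau m t by (unfold_locales) (use assms that in \<open>auto simp: young_tableaux_def\<close>)
    show ?thesis using young_family_of_in_young_families young_tableau_of_young_family_of that by (auto simp: young_tableaux_def)
  qed
  have U: "young_tableau_of m U \<in> young_tableaux m \<and> young_family_of (young_tableau_of m U) = U \<and>
    content (young_tableau_of m U) = family_content U" if "U \<in> young_families m" for U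
  proof -
    interpret young_family m U by (unfold_locales) (use assms that in auto)
    show ?thesis
      using young_tableau_of_in_young_tableaux young_family_of_young_tableau_of content_young_tableau_of by blast
  qed
  show "bij_betw young_family_of (young_tableaux m) (young_families m)"
    by (rule bij_betw_byWitness[of _ "young_tableau_of m"]) (use T U in auto)
  show "content t = family_content (young_family_of t)" if "t \<in> young_tableaux m"
    using T[OF that] U by metis
qed

subsection \<open>The product formula\<close>

definition interleave :: "(nat \<Rightarrow> nat set) \<Rightarrow> (nat \<Rightarrow> nat set) \<Rightarrow> nat \<Rightarrow> nat set" where
  "interleave A B h = (if even h then A (h div 2) else B (h div 2))"

lemma interleave_even [simp]: "interleave A B (2 * k) = A k"
  and interleave_odd [simp]: "interleave A B (Suc (2 * k)) = B k"
  by (simp_all add: interleave_def)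

lemma interleave_halves: "interleave (\<lambda>k. V (2 * k)) (\<lambda>k. V (Suc (2 * k))) = V"
  by (rule ext) (auto simp: interleave_def elim: oddE)

lemma all_even_odd: "(\<forall>h. P h) \<longleftrightarrow> (\<forall>k. P (2 * k) \<and> P (Suc (2 * k :: nat)))"
  by (metis evenE oddE Suc_eq_plus1)

lemma interleave_eq_iff: "interleave A B = interleave A' B' \<longleftrightarrow> A = A' \<and> B = B'"
  unfolding fun_eq_iff by (subst all_even_odd) auto

lemma young_families_eventually_empty:
  assumes "U \<in> young_families m" "sum_list m + length m \<le> k"
  shows "U k = {}"
proof -
  have "finite (U k)" "card (U k) = 0"
    using assms diag_len_eventually_0[of m "int k"] by (simp_all add: young_families_def del: card_eq_0_iff)
  then show ?thesis by (metis card_0_eq)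
qed

text \<open>Needed for additivity of the content: an infinite set would get cardinality 0.\<close>

lemma finite_family_cells:
  assumes "U \<in> young_families m"
  shows "finite {(k, r). r \<in> U k \<and> r div 2 = i}"
proof -
  define K where "K = sum_list m + length m"
  have K: "U k = {}" if "K \<le> k" for k using young_families_eventually_empty[OF assms] that by (simp add: K_def)
  have "{(k, r). r \<in> U k \<and> r div 2 = i} \<subseteq> (SIGMA k:{..<K}. U k)"
  proof (rule subsetI)
    fix c assume "c \<in> {(k, r). r \<in> U k \<and> r div 2 = i}"
    then obtain k r where c: "c = (k, r)" "r \<in> U k" by auto
    then have "k < K" using K[of k] by (cases "K \<le> k") auto
    then show "c \<in> (SIGMA k:{..<K}. U k)" using c by simp
  qed
  moreover have "finite (SIGMA k:{..<K}. U k)" using assms by (auto simp: young_families_def)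
  ultimately show ?thesis by (rule finite_subset)
qed

lemma family_content_interleave:
  assumes "A \<in> young_families m" "B \<in> young_families n"
  shows "family_content (interleave A B) i = family_content A i + family_content B i"
proof -
  let ?A = "{(k, r). r \<in> A k \<and> r div 2 = i}" and ?B = "{(k, r). r \<in> B k \<and> r div 2 = i}"
  let ?f = "\<lambda>(k, r). (2 * k, r)" and ?g = "\<lambda>(k, r). (Suc (2 * k), r)"
  have "{(h, r). r \<in> interleave A B h \<and> r div 2 = i} = ?f ` ?A \<union> ?g ` ?B" (is "?L = ?R")
  proof (intro equalityI subsetI)
    fix c assume "c \<in> ?L"
    then obtain h r where c: "c = (h, r)" "r \<in> interleave A B h" "r div 2 = i" by auto
    show "c \<in> ?R"
    proof (cases "even h")
      case True
      then obtain k where "h = 2 * k" by auto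
      then show ?thesis using c by (intro UnI1 image_eqI[of _ _ "(k, r)"]) auto
    next
      case False
      then obtain k where "h = Suc (2 * k)" by (auto elim: oddE)
      then show ?thesis using c by (intro UnI2 image_eqI[of _ _ "(k, r)"]) auto
    qed
  qed auto
  moreover have "card ?R = card ?A + card ?B"
  proof -
    have "(2 * k :: nat) \<noteq> Suc (2 * k')" for k k' by presburger
    then have "?f ` ?A \<inter> ?g ` ?B = {}" by auto
    moreover have "inj_on ?f ?A" "inj_on ?g ?B" by (auto intro!: inj_onI)
    ultimately show ?thesis
      using finite_family_cells[OF assms(1)] finite_family_cells[OF assms(2)]
      by (simp add: card_Un_disjoint card_image)
  qed
  ultimately show ?thesis unfolding family_content_def by simp
qed

text \<open>A step by 2 preserves parity, so every condition concerns one half only. The oddness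
  required of \<open>V 0\<close> and \<open>V 1\<close> becomes the condition on the main diagonals
  of the two components.\<close>

lemma (in quotient_shape) interleave_in_domino_families:
  "interleave A B \<in> domino_families \<longleftrightarrow> A \<in> young_families \<alpha> \<and> B \<in> young_families \<beta>"
proof -
  have s: "size_at (2 * int k) = diag_len \<alpha> (int k)" "size_at (1 + 2 * int k) = diag_len \<beta> (int k)" for k
    by (simp_all add: size_at_def)
  have add: "2 * k + 2 = 2 * Suc k" "Suc (2 * k) + 2 = Suc (2 * Suc k)" for k :: nat by simp_all
  have 0: "interleave A B 0 = A 0" "interleave A B 1 = B 0"
    using interleave_even[of A B 0] interleave_odd[of A B 0] by simp_all
  show ?thesis
    unfolding domino_families_def young_families_def mem_Collect_eq 0
      all_even_odd[of "\<lambda>h. finite (interleave A B h) \<and> card (interleave A B h) = size_at (int h)"]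
      all_even_odd[of "\<lambda>h. interlaced (interleave A B h) (interleave A B (h + 2))"] add interleave_even interleave_odd
    by (auto simp: s)
qed

section \<open>Generating series of families\<close>

definition family_series :: "(nat \<Rightarrow> nat set) set \<Rightarrow> series" where
  "family_series F m = int (card {V \<in> F. family_content V = Poly_Mapping.lookup m})"

lemma tableau_series_eq_family_series:
  assumes "bij_betw \<phi> S F" "\<And>T. T \<in> S \<Longrightarrow> content T = family_content (\<phi> T)"
  shows "tableau_series S = family_series F"
proof
  fix m
  have "bij_betw \<phi> {T \<in> S. content T = Poly_Mapping.lookup m} {V \<in> F. family_content V = Poly_Mapping.lookup m}"
    using assms unfolding bij_betw_def by (auto intro: inj_on_subset)
  then show "tableau_series S m = family_series F m"
    by (simp add: tableau_series_def family_series_def bij_betw_same_card)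
qed

lemma P_schur_eq_family_series:
  assumes "is_partition m"
  shows "P_schur m = family_series (young_families m)"
  using tableau_series_eq_family_series[OF bij_betw_young_family_of[OF assms]]
  by (simp add: P_schur_def young_tableaux_def)

text \<open>Finiteness is carried over from fillings of a finite diagram along the bijection with
  tableaux.\<close>

lemma finite_young_families_content:
  assumes "is_partition m"
  shows "finite {U \<in> young_families m. family_content U = Poly_Mapping.lookup p}"
proof -
  have "finite {t :: cell \<rightharpoonup> symbol. dom t \<subseteq> diagram m \<and> content t = Poly_Mapping.lookup p}"
    by (rule finite_fillings[OF finite_diagram])
  then have "finite {t \<in> young_tableaux m. content t = Poly_Mapping.lookup p}"
    by (rule rev_finite_subset) (auto simp: young_tableaux_def is_shifted_young_tableau_def)
  then have "finite (young_family_of ` {t \<in> young_tableaux m. content t = Poly_Mapping.lookup p})" by simp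
  then show ?thesis
  proof (rule rev_finite_subset)
    show "{U \<in> young_families m. family_content U = Poly_Mapping.lookup p} \<subseteq>
      young_family_of ` {t \<in> young_tableaux m. content t = Poly_Mapping.lookup p}"
    proof
      fix U assume U: "U \<in> {U \<in> young_families m. family_content U = Poly_Mapping.lookup p}"
      then obtain t where "t \<in> young_tableaux m" "U = young_family_of t"
        using bij_betw_young_family_of(1)[OF assms] by (auto simp: bij_betw_def)
      then show "U \<in> young_family_of ` {t \<in> young_tableaux m. content t = Poly_Mapping.lookup p}"
        using U bij_betw_young_family_of(2)[OF assms] by auto
    qed
  qed
qed

text \<open>The coefficient counts pairs of families grouped by the way their contents split
  \<open>m\<close>. The splitting is recovered from the pair, so nothing is counted twice.\<close>

lemma (in quotient_shape) family_series_domino_families: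
  "family_series domino_families = family_series (young_families \<alpha>) \<odot> family_series (young_families \<beta>)"
proof
  fix m
  let ?A = "\<lambda>p. {U \<in> young_families \<alpha>. family_content U = Poly_Mapping.lookup p}"
  let ?B = "\<lambda>q. {U \<in> young_families \<beta>. family_content U = Poly_Mapping.lookup q}"
  let ?I = "{(p, q). p + q = (m :: nat \<Rightarrow>\<^sub>0 nat)}"
  let ?S = "SIGMA pq:?I. ?A (fst pq) \<times> ?B (snd pq)"
  let ?f = "\<lambda>(pq, A, B). interleave A B"
  have img: "?f ` ?S = {V \<in> domino_families. family_content V = Poly_Mapping.lookup m}" (is "_ = ?R")
  proof (intro equalityI subsetI)
    fix V assume "V \<in> ?f ` ?S"
    then obtain p q A B where V: "p + q = m" "A \<in> ?A p" "B \<in> ?B q" "V = interleave A B" by auto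
    then have "family_content V = Poly_Mapping.lookup m"
      using family_content_interleave[of A \<alpha> B \<beta>] by (auto simp: lookup_add)
    then show "V \<in> ?R" using V interleave_in_domino_families by simp
  next
    fix V assume V: "V \<in> ?R"
    define A B where "A = (\<lambda>k. V (2 * k))" and "B = (\<lambda>k. V (Suc (2 * k)))"
    have VAB: "V = interleave A B" unfolding A_def B_def by (rule interleave_halves[symmetric])
    then have AB: "A \<in> young_families \<alpha>" "B \<in> young_families \<beta>" using V interleave_in_domino_families by auto
    have sum: "family_content A i + family_content B i = Poly_Mapping.lookup m i" for i
      using V VAB family_content_interleave[OF AB, of i] by simp
    \<comment> \<open>The contents must be finitely supported to be exponents of monomials; being
      summands of \<open>m\<close>, they vanish wherever \<open>m\<close> does.\<close>
    have "{i. family_content A i \<noteq> 0} \<subseteq> {i. Poly_Mapping.lookup m i \<noteq> 0}"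
      "{i. family_content B i \<noteq> 0} \<subseteq> {i. Poly_Mapping.lookup m i \<noteq> 0}"
      by (auto simp: sum[symmetric])
    then have fin: "finite {i. family_content A i \<noteq> 0}" "finite {i. family_content B i \<noteq> 0}"
      using finite_subset finite_lookup by blast+
    define p q where "p = Abs_poly_mapping (family_content A)" and "q = Abs_poly_mapping (family_content B)"
    have pq: "Poly_Mapping.lookup p = family_content A" "Poly_Mapping.lookup q = family_content B"
      using fin by (simp_all add: p_def q_def)
    have "p + q = m" by (rule poly_mapping_eqI) (simp add: lookup_add pq sum)
    then show "V \<in> ?f ` ?S" using AB pq VAB by (intro image_eqI[of _ _ "((p, q), A, B)"]) auto
  qed
  have inj: "inj_on ?f ?S"
  proof (rule inj_onI)
    fix s s' assume s: "s \<in> ?S" "s' \<in> ?S" "?f s = ?f s'"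
    obtain p q A B p' q' A' B' where eq: "s = ((p, q), A, B)" "s' = ((p', q'), A', B')" by (metis surj_pair)
    then have "A = A'" "B = B'" using s by (auto simp: interleave_eq_iff)
    moreover from this have "p = p'" "q = q'" using s eq by (auto intro: poly_mapping_eqI)
    ultimately show "s = s'" using eq by simp
  qed
  have "card ?R = card ?S" using card_image[OF inj] by (simp only: img)
  also have "\<dots> = (\<Sum>pq\<in>?I. card (?A (fst pq) \<times> ?B (snd pq)))"
  proof (rule card_SigmaI)
    show "finite ?I" by (rule finite_summands)
    show "\<forall>pq\<in>?I. finite (?A (fst pq) \<times> ?B (snd pq))"
      using finite_young_families_content[OF partition(2)] finite_young_families_content[OF partition(3)] by blast
  qed
  finally show "family_series domino_families m = (family_series (young_families \<alpha>) \<odot> family_series (young_families \<beta>)) m"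
    by (simp add: family_series_def series_mult_def card_cartesian_product case_prod_beta)
qed

lemma series_mult_commute: "F \<odot> G = G \<odot> F"
proof
  fix m
  have "(\<Sum>(p, q)\<in>{(p, q). p + q = m}. F p * G q) = (\<Sum>(q, p)\<in>{(q, p). q + p = m}. G q * F p)"
    by (rule sum.reindex_bij_witness[of _ prod.swap prod.swap]) (auto simp: add.commute mult.commute)
  then show "(F \<odot> G) m = (G \<odot> F) m" by (simp add: series_mult_def)
qed

theorem mainTheorem3:
  fixes l \<mu> \<nu> :: "nat list"
  assumes "shifted_pavable l"
    and "two_quotient l = (\<mu>, \<nu>)"
  shows "tableau_series {T \<in> shifted_domino_tableaux l. domino_diagonal_unprimed T}
           = P_schur \<mu> \<odot> P_schur \<nu>"
proof -
  have l: "is_partition l" "pavable l" and fits: "last_part_fits \<mu>" "last_part_fits \<nu>"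
    using assms by (simp_all add: shifted_pavable_def)
  have q: "\<mu> = quotient_part even l" "\<nu> = quotient_part odd l" using assms(2) by (simp_all add: two_quotient_def)
  have part: "is_partition \<mu>" "is_partition \<nu>"
    unfolding q using is_partition_quotient_part[OF l(1)] by blast+
  have eo: "even_quotient l = (if even (length l) then \<mu> else \<nu>)" "odd_quotient l = (if even (length l) then \<nu> else \<mu>)"
    by (simp_all add: even_quotient_def odd_quotient_def q)
  interpret quotient_shape l "even_quotient l" "odd_quotient l"
    by (unfold_locales) (use l fits part diag_len_pavable[OF l] in \<open>auto simp: eo\<close>)
  have "tableau_series {T \<in> shifted_domino_tableaux l. domino_diagonal_unprimed T} = family_series domino_families"
    by (rule tableau_series_eq_family_series[OF bij_betw_family_of content_family_of])
  also have "\<dots> = P_schur (even_quotient l) \<odot> P_schur (odd_quotient l)"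
    using family_series_domino_families P_schur_eq_family_series partition by simp
  \<comment> \<open>For odd length the component read off the even indices is \<nu>, so the factors
    appear in the opposite order.\<close>
  also have "\<dots> = P_schur \<mu> \<odot> P_schur \<nu>" by (simp add: eo series_mult_commute)
  finally show ?thesis .
qed

end
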